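(* Let $m\ge 1$, and for each $1\le j\le m$ let $1\le p_j\le q_j<\infty$ be real numbers and let $X_j$ be an order continuous $p_j$-convex Banach function lattice (with $p_j$-convexity constant $1$) on a $\sigma$-finite measure space $(\Omega_j,\Sigma_j,\mu_j)$. Define $q$ by $1/q=1/q_1+\cdots+1/q_m$. Let $Y$ be a Banach space and let $T\colon X_1\times\cdots\times X_m\to Y$ be an $m$-linear operator. Then the following statements are equivalent. (i) $T$ is $(p_1,\ldots,p_m)$-strongly $(q_1,\ldots,q_m)$-concave. (ii) There are regular Borel probability measures $\nu_j$ on $B^{+}_{((X_j)_{p_j})'}$, $1\le j\le m$, such that each $S^{q_j}_{(X_j)_{p_j}}(\nu_j)$ is a Banach function lattice on $(\Omega_j,\Sigma_j,\mu_j)$ and the inclusions $\iota_j\colon X_j\to S^{q_j}_{(X_j)_{p_j}}(\nu_j)$ are continuous, and there is a bounded multilinear operator $$S\colon S^{q_1}_{(X_1)_{p_1}}(\nu_1)\times\cdots\times S^{q_m}_{(X_m)_{p_m}}(\nu_m)\to Y$$ such that $T=S\circ(\iota_1\times\cdots\times\iota_m)$.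
   Context: A Banach function lattice on a $\sigma$-finite measure space $(\Omega,\Sigma,\mu)$ is a Banach space $X\subset L^0(\mu)$ such that $f\in L^0(\mu)$, $g\in X$, $|f|\le|g|$ a.e. imply $f\in X$ and $\|f\|_X\le\|g\|_X$. As a convention, $X$ has full support (no set of positive measure on which all elements of $X$ vanish a.e.), so that the Köthe dual $X'$, the space of functionals in $X^*$ of the form $x\mapsto\int_\Omega xx'\,d\mu$ with $x'\in L^0(\mu)$, is identified with the Banach function lattice of the (unique) representing functions $x'$, with the dual norm. $X$ is $p$-convex with constant $1$ if $\|(\sum_{k=1}^n|x_k|^p)^{1/p}\|_X\le(\sum_{k=1}^n\|x_k\|_X^p)^{1/p}$ for all finite sequences in $X$; then $X_p=\{f\in L^0(\mu):|f|^{1/p}\in X\}$ with norm $\|f\|_{X_p}=\||f|^{1/p}\|_X^p$ is a Banach function lattice (the $p$-concavification). $B^{+}_{(X_p)'}$ is the set of nonnegative functions in the closed unit ball of the Köthe dual $(X_p)'$, with the topology $\sigma((X_p)',X_p)$ (for $X$ order continuous, $(X_p)'=(X_p)^*$ and this set is compact). For $1\le p\le q<\infty$ and a regular Borel probability measure $\xi$ on $B^{+}_{(X_p)'}$, $$S^q_{X_p}(\xi)=\Big\{f\in L^0(\mu):\ \|f\|=\Big(\int_{B^{+}_{(X_p)'}}\Big(\int_\Omega|f|^p\,h\,d\mu\Big)^{q/p}d\xi(h)\Big)^{1/q}<\infty\Big\}.$$ Let $1/r_j=1/p_j-1/q_j$ (with $r_j=\infty$ if $p_j=q_j$). A multilinear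 operator $T\colon X_1\times\cdots\times X_m\to Y$ is $(p_1,\ldots,p_m)$-strongly $(q_1,\ldots,q_m)$-concave if there is $C>0$ such that for every $n$ and all finite sequences $(x_k^j)_{k=1}^n$ in $X_j$, $1\le j\le m$, $$\Big(\sum_{k=1}^n\|T(x_k^1,\ldots,x_k^m)\|_Y^q\Big)^{1/q}\le C\prod_{j=1}^m\ \sup_{(\beta_k^j)\in B_{r_j}^n}\Big\|\Big(\sum_{k=1}^n|\beta_k^jx_k^j|^{p_j}\Big)^{1/p_j}\Big\|_{X_j},$$ where $1/q=1/q_1+\cdots+1/q_m$ and $B_r^n$ is the closed unit ball of $\ell_r^n=(\mathbb R^n,\|\cdot\|_r)$. *)

theory Defs
  imports "HOL-Probability.Probability"
begin

text \<open>
  Elements of \<open>L\<^sup>0(\<mu>)\<close> are handled through representatives: a space of classes of functions is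
  given by the set of all measurable functions whose class belongs to it. The ideal property of
  function lattices makes such sets (and the norms on them) invariant under equality almost
  everywhere, and operators are required to respect it explicitly. Scalars are real.
\<close>

record 'a function_space =
  elems :: "('a \<Rightarrow> real) set"
  fnorm :: "('a \<Rightarrow> real) \<Rightarrow> real"

definition normed_function_space :: "'a measure \<Rightarrow> 'a function_space \<Rightarrow> bool" where
  "normed_function_space M X \<longleftrightarrow>
     elems X \<subseteq> borel_measurable M \<and>
     (\<lambda>_. 0) \<in> elems X \<and>
     (\<forall>f\<in>elems X. \<forall>g\<in>elems X. (\<lambda>\<omega>. f \<omega> + g \<omega>) \<in> elems X \<and>
        fnorm X (\<lambda>\<omega>. f \<omega> + g \<omega>) \<le> fnorm X f + fnorm X g) \<and>
     (\<forall>f\<in>elems X. \<forall>c. (\<lambda>\<omega>. c * f \<omega>) \<in> elems X \<and>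
        fnorm X (\<lambda>\<omega>. c * f \<omega>) = \<bar>c\<bar> * fnorm X f) \<and>
     (\<forall>f\<in>elems X. 0 \<le> fnorm X f \<and> (fnorm X f = 0 \<longleftrightarrow> (AE \<omega> in M. f \<omega> = 0)))"

definition complete_function_space :: "'a function_space \<Rightarrow> bool" where
  "complete_function_space X \<longleftrightarrow>
     (\<forall>u :: nat \<Rightarrow> 'a \<Rightarrow> real.
        (\<forall>n. u n \<in> elems X) \<and>
        (\<forall>e>0. \<exists>K. \<forall>m\<ge>K. \<forall>n\<ge>K. fnorm X (\<lambda>\<omega>. u m \<omega> - u n \<omega>) < e) \<longrightarrow>
        (\<exists>f\<in>elems X. (\<lambda>n. fnorm X (\<lambda>\<omega>. u n \<omega> - f \<omega>)) \<longlonglongrightarrow> 0))"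

text \<open>Full support is part of the definition.\<close>

definition banach_function_lattice :: "'a measure \<Rightarrow> 'a function_space \<Rightarrow> bool" where
  "banach_function_lattice M X \<longleftrightarrow>
     sigma_finite_measure M \<and> normed_function_space M X \<and> complete_function_space X \<and>
     (\<forall>f\<in>borel_measurable M. \<forall>g\<in>elems X.
        (AE \<omega> in M. \<bar>f \<omega>\<bar> \<le> \<bar>g \<omega>\<bar>) \<longrightarrow> f \<in> elems X \<and> fnorm X f \<le> fnorm X g) \<and>
     (\<forall>A\<in>sets M. emeasure M A > 0 \<longrightarrow>
        (\<exists>f\<in>elems X. \<not> (AE \<omega> in M. \<omega> \<in> A \<longrightarrow> f \<omega> = 0)))"

text \<open>
  Over a \<open>\<sigma>\<close>-finite measure, testing order continuity on sequences is the same as testing it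
  on nets.
\<close>

definition order_continuous :: "'a measure \<Rightarrow> 'a function_space \<Rightarrow> bool" where
  "order_continuous M X \<longleftrightarrow>
     (\<forall>u :: nat \<Rightarrow> 'a \<Rightarrow> real.
        (\<forall>n. u n \<in> elems X) \<and> (\<forall>n. AE \<omega> in M. u (Suc n) \<omega> \<le> u n \<omega>) \<and>
        (AE \<omega> in M. (\<lambda>n. u n \<omega>) \<longlonglongrightarrow> 0) \<longrightarrow>
        (\<lambda>n. fnorm X (u n)) \<longlonglongrightarrow> 0)"

text \<open>Convexity constant \<open>1\<close>.\<close>

definition p_convex :: "real \<Rightarrow> 'a function_space \<Rightarrow> bool" where
  "p_convex p X \<longleftrightarrow>
     (\<forall>(n::nat) x. (\<forall>k<n. x k \<in> elems X) \<longrightarrow>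
        fnorm X (\<lambda>\<omega>. (\<Sum>k<n. \<bar>x k \<omega>\<bar> powr p) powr (1 / p))
          \<le> (\<Sum>k<n. fnorm X (x k) powr p) powr (1 / p))"

definition concavification :: "'a measure \<Rightarrow> real \<Rightarrow> 'a function_space \<Rightarrow> 'a function_space" where
  "concavification M p X =
     \<lparr> elems = {f \<in> borel_measurable M. (\<lambda>\<omega>. \<bar>f \<omega>\<bar> powr (1 / p)) \<in> elems X},
       fnorm = (\<lambda>f. fnorm X (\<lambda>\<omega>. \<bar>f \<omega>\<bar> powr (1 / p)) powr p) \<rparr>"

definition koethe_dual :: "'a measure \<Rightarrow> 'a function_space \<Rightarrow> 'a function_space" where
  "koethe_dual M X =
     \<lparr> elems = {h \<in> borel_measurable M.
          (\<forall>f\<in>elems X. integrable M (\<lambda>\<omega>. f \<omega> * h \<omega>)) \<and>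
          (\<exists>C. \<forall>f\<in>elems X. \<bar>\<integral>\<omega>. f \<omega> * h \<omega> \<partial>M\<bar> \<le> C * fnorm X f)},
       fnorm = (\<lambda>h. SUP f\<in>{f \<in> elems X. fnorm X f \<le> 1}. \<bar>\<integral>\<omega>. f \<omega> * h \<omega> \<partial>M\<bar>) \<rparr>"

text \<open>The weak topology \<open>\<sigma>(X', X)\<close> on the Koethe dual \<open>X'\<close>.\<close>

definition koethe_weak_topology :: "'a measure \<Rightarrow> 'a function_space \<Rightarrow> ('a \<Rightarrow> real) topology" where
  "koethe_weak_topology M X =
     topology_generated_by
       {{h \<in> elems (koethe_dual M X). (\<integral>\<omega>. f \<omega> * h \<omega> \<partial>M) \<in> U} | f U. f \<in> elems X \<and> open U}"

text \<open>
  The positive part of the closed unit ball of the Koethe dual of \<open>X\<close>, with \<open>\<sigma>(X', X)\<close>.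
  Points are representatives, so functions that agree almost everywhere are topologically
  indistinguishable; identifying them gives the space of classes. Open sets, hence also Borel
  sets, are unions of classes, so the Borel \<open>\<sigma>\<close>-algebras and the Borel measures of the two spaces
  correspond to each other, and a Borel set is compact in one iff it is compact in the other.
\<close>

definition koethe_pos_ball :: "'a measure \<Rightarrow> 'a function_space \<Rightarrow> ('a \<Rightarrow> real) topology" where
  "koethe_pos_ball M X =
     subtopology (koethe_weak_topology M X)
       {h \<in> elems (koethe_dual M X). (AE \<omega> in M. 0 \<le> h \<omega>) \<and> fnorm (koethe_dual M X) h \<le> 1}"

definition regular_borel_prob :: "'b topology \<Rightarrow> 'b measure \<Rightarrow> bool" where
  "regular_borel_prob T \<nu> \<longleftrightarrow>
     prob_space \<nu> \<and>
     space \<nu> = topspace T \<and> sets \<nu> = sigma_sets (topspace T) {U. openin T U} \<and>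
     (\<forall>A\<in>sets \<nu>.
        emeasure \<nu> A = (INF U\<in>{U. openin T U \<and> A \<subseteq> U}. emeasure \<nu> U) \<and>
        emeasure \<nu> A = (SUP K\<in>{K. compactin T K \<and> K \<in> sets \<nu> \<and> K \<subseteq> A}. emeasure \<nu> K))"

text \<open>Only used for exponents \<open>a > 0\<close>.\<close>

definition ennreal_power :: "ennreal \<Rightarrow> real \<Rightarrow> ennreal" where
  "ennreal_power x a = (if x = \<infinity> then \<infinity> else ennreal (enn2real x powr a))"

definition S_enorm ::
  "'a measure \<Rightarrow> real \<Rightarrow> real \<Rightarrow> ('a \<Rightarrow> real) measure \<Rightarrow> ('a \<Rightarrow> real) \<Rightarrow> ennreal" where
  "S_enorm M p q \<xi> f =
     ennreal_power
       (\<integral>\<^sup>+h. ennreal_power (\<integral>\<^sup>+\<omega>. ennreal (\<bar>f \<omega>\<bar> powr p * h \<omega>) \<partial>M) (q / p) \<partial>\<xi>) (1 / q)"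

text \<open>
  The space \<open>S\<^sup>q\<close> of \<open>\<xi>\<close>; the lattice \<open>X\<close> enters only through \<open>\<xi>\<close>, a measure on
  \<open>koethe_pos_ball M (concavification M p X)\<close>.
\<close>

definition S_space ::
  "'a measure \<Rightarrow> real \<Rightarrow> real \<Rightarrow> ('a \<Rightarrow> real) measure \<Rightarrow> 'a function_space" where
  "S_space M p q \<xi> =
     \<lparr> elems = {f \<in> borel_measurable M. S_enorm M p q \<xi> f < \<infinity>},
       fnorm = (\<lambda>f. enn2real (S_enorm M p q \<xi> f)) \<rparr>"

definition continuous_inclusion :: "'a function_space \<Rightarrow> 'a function_space \<Rightarrow> bool" where
  "continuous_inclusion X Z \<longleftrightarrow>
     elems X \<subseteq> elems Z \<and> (\<exists>C. \<forall>f\<in>elems X. fnorm Z f \<le> C * fnorm X f)"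

text \<open>
  Multilinear operators on a finite product of function spaces, an argument tuple being a function
  on the index type. The last clause says that the operator is well defined on classes.
\<close>

definition multilinear_operator ::
  "('m \<Rightarrow> 'a measure) \<Rightarrow> ('m \<Rightarrow> 'a function_space) \<Rightarrow> (('m \<Rightarrow> 'a \<Rightarrow> real) \<Rightarrow> 'y::real_vector) \<Rightarrow> bool"
where
  "multilinear_operator M X T \<longleftrightarrow>
     (\<forall>x j f g. (\<forall>i. x i \<in> elems (X i)) \<and> f \<in> elems (X j) \<and> g \<in> elems (X j) \<longrightarrow>
        T (x(j := (\<lambda>\<omega>. f \<omega> + g \<omega>))) = T (x(j := f)) + T (x(j := g))) \<and>
     (\<forall>x j f c. (\<forall>i. x i \<in> elems (X i)) \<and> f \<in> elems (X j) \<longrightarrow>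
        T (x(j := (\<lambda>\<omega>. c * f \<omega>))) = c *\<^sub>R T (x(j := f))) \<and>
     (\<forall>x y. (\<forall>i. x i \<in> elems (X i)) \<and> (\<forall>i. y i \<in> elems (X i)) \<and>
        (\<forall>i. AE \<omega> in M i. x i \<omega> = y i \<omega>) \<longrightarrow> T x = T y)"

definition bounded_multilinear_operator ::
  "('m::finite \<Rightarrow> 'a measure) \<Rightarrow> ('m \<Rightarrow> 'a function_space) \<Rightarrow>
     (('m \<Rightarrow> 'a \<Rightarrow> real) \<Rightarrow> 'y::real_normed_vector) \<Rightarrow> bool"
where
  "bounded_multilinear_operator M X T \<longleftrightarrow>
     multilinear_operator M X T \<and>
     (\<exists>C. \<forall>x. (\<forall>j. x j \<in> elems (X j)) \<longrightarrow>
        norm (T x) \<le> C * (\<Prod>j\<in>UNIV. fnorm (X j) (x j)))"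

text \<open>The exponent \<open>r\<close> with \<open>1 / r = 1 / p - 1 / q\<close>.\<close>

definition gap_exponent :: "real \<Rightarrow> real \<Rightarrow> ereal" where
  "gap_exponent p q = (if p = q then \<infinity> else ereal (1 / (1 / p - 1 / q)))"

text \<open>
  The closed unit ball of \<open>\<ell>\<^sub>r\<^sup>n\<close>. Vectors are functions on \<open>nat\<close> of which only the values at
  \<open>k < n\<close> matter.
\<close>

definition lr_ball :: "ereal \<Rightarrow> nat \<Rightarrow> (nat \<Rightarrow> real) set" where
  "lr_ball r n =
     (if r = \<infinity> then {\<beta>. \<forall>k<n. \<bar>\<beta> k\<bar> \<le> 1}
      else {\<beta>. (\<Sum>k<n. \<bar>\<beta> k\<bar> powr real_of_ereal r) powr (1 / real_of_ereal r) \<le> 1})"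

definition strongly_concave ::
  "('m::finite \<Rightarrow> 'a function_space) \<Rightarrow> ('m \<Rightarrow> real) \<Rightarrow> ('m \<Rightarrow> real) \<Rightarrow>
     (('m \<Rightarrow> 'a \<Rightarrow> real) \<Rightarrow> 'y::real_normed_vector) \<Rightarrow> bool"
where
  "strongly_concave X p q T \<longleftrightarrow>
     (let q0 = 1 / (\<Sum>j\<in>UNIV. 1 / q j) in
      \<exists>C>0. \<forall>(n::nat) x. (\<forall>j. \<forall>k<n. x j k \<in> elems (X j)) \<longrightarrow>
        (\<Sum>k<n. norm (T (\<lambda>j. x j k)) powr q0) powr (1 / q0)
          \<le> C * (\<Prod>j\<in>UNIV. SUP \<beta>\<in>lr_ball (gap_exponent (p j) (q j)) n.
                 fnorm (X j) (\<lambda>\<omega>. (\<Sum>k<n. \<bar>\<beta> k * x j k \<omega>\<bar> powr p j) powr (1 / p j))))"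

end

theory Submission
  imports Defs
begin

text \<open>
  By Hahn-Banach and order continuity, positive functionals on the concavification are given by
  functions, so suprema over the ball of \<open>\<ell>\<^sub>r\<^sup>n\<close> become suprema over the positive ball of the Koethe
  dual of sums of powers of pairings. Strong concavity then says, after Young's inequality, that
  a convex cone of functions on the disjoint union of these compact balls has nonnegative sums of
  suprema; a sandwich theorem produces one mean per factor, and these means are represented by
  regular Borel measures. Rescaling the arguments turns the resulting additive bound into a product
  of norms, and \<open>T\<close> extends by density. The converse is Hoelder's inequality.
\<close>

section \<open>Sublinear functionals\<close>

text \<open>The obstacle is that (i) bounds a sum by a product of suprema over different balls,
  while (ii) asks for a separate measure on each ball. Young's inequality replaces the product by a
  weighted sum, and the sum of the suprema over the summands of a disjoint union is a single
  sublinear functional. A linear functional below it splits into one functional per summand, each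
  below its own supremum, so no minimax argument is required. What Young's inequality loses is
  regained by homogeneity, on arguments whose new norms are all 1. Points of the balls are
  representatives, so distinct points can be topologically indistinguishable. Normality therefore
  comes from compactness together with regularity, and the measures are constructed from the means
  by Caratheodory's method. The norm that a measure defines could vanish on functions that are not
  null. Mass at a strictly positive functional prevents this; such a functional exists by order
  continuity and exhaustion.\<close>

definition function_subspace :: "('b \<Rightarrow> real) set \<Rightarrow> bool" where
  "function_subspace V \<longleftrightarrow>
     (\<lambda>_. 0) \<in> V \<and> (\<forall>f\<in>V. \<forall>g\<in>V. (\<lambda>x. f x + g x) \<in> V) \<and> (\<forall>f\<in>V. \<forall>c. (\<lambda>x. c * f x) \<in> V)"

definition sublinear_on :: "('b \<Rightarrow> real) set \<Rightarrow> (('b \<Rightarrow> real) \<Rightarrow> real) \<Rightarrow> bool" where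
  "sublinear_on V \<rho> \<longleftrightarrow>
     (\<forall>f\<in>V. \<forall>g\<in>V. \<rho> (\<lambda>x. f x + g x) \<le> \<rho> f + \<rho> g) \<and>
     (\<forall>f\<in>V. \<forall>c\<ge>0. \<rho> (\<lambda>x. c * f x) = c * \<rho> f)"

definition linear_functional_on :: "('b \<Rightarrow> real) set \<Rightarrow> (('b \<Rightarrow> real) \<Rightarrow> real) \<Rightarrow> bool" where
  "linear_functional_on V \<phi> \<longleftrightarrow>
     (\<forall>f\<in>V. \<forall>g\<in>V. \<phi> (\<lambda>x. f x + g x) = \<phi> f + \<phi> g) \<and>
     (\<forall>f\<in>V. \<forall>c. \<phi> (\<lambda>x. c * f x) = c * \<phi> f)"

lemma function_subspaceD:
  assumes "function_subspace V"
  shows "(\<lambda>_. 0) \<in> V"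
    and "\<And>f g. f \<in> V \<Longrightarrow> g \<in> V \<Longrightarrow> (\<lambda>x. f x + g x) \<in> V"
    and "\<And>f c. f \<in> V \<Longrightarrow> (\<lambda>x. c * f x) \<in> V"
    and "\<And>f. f \<in> V \<Longrightarrow> (\<lambda>x. - f x) \<in> V"
    and "\<And>f g. f \<in> V \<Longrightarrow> g \<in> V \<Longrightarrow> (\<lambda>x. f x - g x) \<in> V"
proof -
  show 0: "(\<lambda>_. 0) \<in> V"
    and add: "\<And>f g. f \<in> V \<Longrightarrow> g \<in> V \<Longrightarrow> (\<lambda>x. f x + g x) \<in> V"
    and sc: "\<And>f c. f \<in> V \<Longrightarrow> (\<lambda>x. c * f x) \<in> V"
    using assms by (auto simp: function_subspace_def)
  show m: "(\<lambda>x. - f x) \<in> V" if "f \<in> V" for f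
    using sc[OF that, of "-1"] by simp
  show "(\<lambda>x. f x - g x) \<in> V" if "f \<in> V" "g \<in> V" for f g
    using add[OF that(1) m[OF that(2)]] by simp
qed

lemma sublinear_onD:
  assumes "sublinear_on V \<rho>"
  shows "\<And>f g. f \<in> V \<Longrightarrow> g \<in> V \<Longrightarrow> \<rho> (\<lambda>x. f x + g x) \<le> \<rho> f + \<rho> g"
    and "\<And>f c. f \<in> V \<Longrightarrow> 0 \<le> c \<Longrightarrow> \<rho> (\<lambda>x. c * f x) = c * \<rho> f"
  using assms by (auto simp: sublinear_on_def)

lemma sublinear_on_zero:
  assumes "function_subspace V" "sublinear_on V \<rho>"
  shows "\<rho> (\<lambda>_. 0) = 0"
  using sublinear_onD(2)[OF assms(2) function_subspaceD(1)[OF assms(1)], of 0] by simp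

lemma sublinear_on_uminus:
  assumes "function_subspace V" "sublinear_on V \<rho>" "f \<in> V"
  shows "- \<rho> (\<lambda>x. - f x) \<le> \<rho> f"
  using sublinear_onD(1)[OF assms(2,3) function_subspaceD(4)[OF assms(1,3)]]
    sublinear_on_zero[OF assms(1,2)] by simp

lemma linear_functional_onD:
  assumes "linear_functional_on V \<phi>"
  shows "\<And>f g. f \<in> V \<Longrightarrow> g \<in> V \<Longrightarrow> \<phi> (\<lambda>x. f x + g x) = \<phi> f + \<phi> g"
    and "\<And>f c. f \<in> V \<Longrightarrow> \<phi> (\<lambda>x. c * f x) = c * \<phi> f"
    and "\<And>f. f \<in> V \<Longrightarrow> \<phi> (\<lambda>x. - f x) = - \<phi> f"
    and "\<And>f. f \<in> V \<Longrightarrow> \<phi> (\<lambda>x. 0) = 0"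
proof -
  show "\<And>f g. f \<in> V \<Longrightarrow> g \<in> V \<Longrightarrow> \<phi> (\<lambda>x. f x + g x) = \<phi> f + \<phi> g"
    and sc: "\<And>f c. f \<in> V \<Longrightarrow> \<phi> (\<lambda>x. c * f x) = c * \<phi> f"
    using assms by (auto simp: linear_functional_on_def)
  show "\<phi> (\<lambda>x. - f x) = - \<phi> f" if "f \<in> V" for f
    using sc[OF that, of "-1"] by simp
  show "\<phi> (\<lambda>x. 0) = 0" if "f \<in> V" for f
    using sc[OF that, of 0] by simp
qed

lemma linear_functional_on_diff:
  assumes "function_subspace V" "linear_functional_on V \<phi>" "f \<in> V" "g \<in> V"
  shows "\<phi> (\<lambda>x. f x - g x) = \<phi> f - \<phi> g"
  using linear_functional_onD(1)[OF assms(2,3) function_subspaceD(4)[OF assms(1,4)]]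
    linear_functional_onD(3)[OF assms(2,4)] by simp

lemma linear_functional_on_sum:
  assumes V: "function_subspace V" and \<phi>: "linear_functional_on V \<phi>"
    and "finite I" "\<And>i. i \<in> I \<Longrightarrow> g i \<in> V"
  shows "(\<lambda>x. \<Sum>i\<in>I. g i x) \<in> V \<and> \<phi> (\<lambda>x. \<Sum>i\<in>I. g i x) = (\<Sum>i\<in>I. \<phi> (g i))"
  using assms(3,4)
proof (induction I rule: finite_induct)
  case empty
  then show ?case
    using function_subspaceD(1)[OF V] linear_functional_onD(4)[OF \<phi> function_subspaceD(1)[OF V]] by simp
next
  case (insert i I)
  then show ?case
    using function_subspaceD(2)[OF V, of "g i" "\<lambda>x. \<Sum>i\<in>I. g i x"]
      linear_functional_onD(1)[OF \<phi>, of "g i" "\<lambda>x. \<Sum>i\<in>I. g i x"] by simp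
qed

text \<open>Infimal convolution: \<open>\<pi>\<close> at \<open>f\<close> is the infimum over
  \<open>w\<close> in \<open>W\<close> of \<open>\<rho>\<close> at \<open>f + w\<close>, minus
  \<open>c w\<close>. The bound \<open>c w \<le> \<rho> w\<close> keeps it above minus
  \<open>\<rho>\<close> at \<open>- f\<close>, and the choice of \<open>w\<close> itself in the
  infimum at \<open>- w\<close> yields the bound \<open>- c w\<close>. A linear functional below
  \<open>\<pi>\<close> therefore dominates \<open>c\<close> on the cone.\<close>

lemma sublinear_minorant:
  assumes V: "function_subspace V" and \<rho>: "sublinear_on V \<rho>"
    and W: "W \<subseteq> V" "(\<lambda>_. 0) \<in> W"
    and W_add: "\<And>v w. v \<in> W \<Longrightarrow> w \<in> W \<Longrightarrow> (\<lambda>x. v x + w x) \<in> W"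
    and W_scale: "\<And>w t. w \<in> W \<Longrightarrow> 0 < t \<Longrightarrow> (\<lambda>x. t * w x) \<in> W"
    and c_add: "\<And>v w. v \<in> W \<Longrightarrow> w \<in> W \<Longrightarrow> c v + c w \<le> c (\<lambda>x. v x + w x)"
    and c_scale: "\<And>w t. w \<in> W \<Longrightarrow> 0 < t \<Longrightarrow> c (\<lambda>x. t * w x) = t * c w"
    and c_le: "\<And>w. w \<in> W \<Longrightarrow> c w \<le> \<rho> w"
  shows "\<exists>\<pi>. sublinear_on V \<pi> \<and> (\<forall>f\<in>V. \<pi> f \<le> \<rho> f) \<and> (\<forall>w\<in>W. \<pi> (\<lambda>x. - w x) \<le> - c w) \<and>
    (\<forall>f. f \<notin> V \<longrightarrow> \<pi> f = 0)"
proof -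
  note Vs = function_subspaceD[OF V]
  note rho = sublinear_onD[OF \<rho>]
  define \<pi> where "\<pi> f = (if f \<in> V then INF w\<in>W. \<rho> (\<lambda>x. f x + w x) - c w else 0)" for f
  have c0: "c (\<lambda>_. 0) = 0"
    using c_scale[OF W(2), of 2] by simp
  have lower: "- \<rho> (\<lambda>x. - f x) \<le> \<rho> (\<lambda>x. f x + w x) - c w" if "f \<in> V" "w \<in> W" for f w
  proof -
    have w: "w \<in> V" using that W by auto
    have "\<rho> w = \<rho> (\<lambda>x. (f x + w x) + - f x)" by simp
    also have "\<dots> \<le> \<rho> (\<lambda>x. f x + w x) + \<rho> (\<lambda>x. - f x)"
      using rho(1)[OF Vs(2)[OF that(1) w] Vs(4)[OF that(1)]] .
    finally show ?thesis using c_le[OF that(2)] by linarith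
  qed
  have bdd: "bdd_below ((\<lambda>w. \<rho> (\<lambda>x. f x + w x) - c w) ` W)" if "f \<in> V" for f
    using lower[OF that] by (intro bdd_belowI2)
  have upper: "\<pi> f \<le> \<rho> (\<lambda>x. f x + w x) - c w" if "f \<in> V" "w \<in> W" for f w
    unfolding \<pi>_def using cINF_lower[OF bdd[OF that(1)] that(2)] that by simp
  have greatest: "b \<le> \<pi> f" if "f \<in> V" "\<And>w. w \<in> W \<Longrightarrow> b \<le> \<rho> (\<lambda>x. f x + w x) - c w" for f b
    unfolding \<pi>_def using that W(2) by (auto intro!: cINF_greatest)
  have le: "\<pi> f \<le> \<rho> f" if "f \<in> V" for f
    using upper[OF that W(2)] c0 by simp
  \<comment> \<open>Replacing \<open>w\<close> by \<open>t * w\<close> in the infimum proves one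
    inequality; the opposite one is the same inequality for \<open>1 / t\<close>.\<close>
  have scale_le: "\<pi> (\<lambda>x. t * f x) \<le> t * \<pi> f" if "f \<in> V" "0 < t" for f t
  proof -
    have "\<pi> (\<lambda>x. t * f x) / t \<le> \<pi> f"
    proof (rule greatest[OF that(1)])
      fix w assume w: "w \<in> W"
      have "\<pi> (\<lambda>x. t * f x) \<le> \<rho> (\<lambda>x. t * f x + t * w x) - c (\<lambda>x. t * w x)"
        using upper[OF Vs(3)[OF that(1)] W_scale[OF w that(2)]] .
      also have "(\<lambda>x. t * f x + t * w x) = (\<lambda>x. t * (f x + w x))" by (simp add: algebra_simps)
      also have "\<rho> \<dots> - c (\<lambda>x. t * w x) = t * (\<rho> (\<lambda>x. f x + w x) - c w)"
        using rho(2)[OF Vs(2)[OF that(1)], of w t] w W(1) that(2) c_scale[OF w that(2)]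
        by (auto simp: algebra_simps)
      finally show "\<pi> (\<lambda>x. t * f x) / t \<le> \<rho> (\<lambda>x. f x + w x) - c w"
        using that(2) by (simp add: divide_simps mult.commute)
    qed
    then show ?thesis using that(2) by (simp add: divide_simps mult.commute)
  qed
  have scale: "\<pi> (\<lambda>x. t * f x) = t * \<pi> f" if "f \<in> V" "0 \<le> t" for f t
  proof (cases "t = 0")
    case True
    have "\<pi> (\<lambda>_. 0) \<le> 0" using le[OF Vs(1)] sublinear_on_zero[OF V \<rho>] by simp
    moreover have "0 \<le> \<pi> (\<lambda>_. 0)"
      by (rule greatest[OF Vs(1)]) (use lower[OF Vs(1)] sublinear_on_zero[OF V \<rho>] in simp)
    ultimately show ?thesis using True by simp
  next
    case False
    with that have t: "0 < t" by simp
    have "\<pi> f = \<pi> (\<lambda>x. (1 / t) * (t * f x))" using t by simp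
    also have "\<dots> \<le> (1 / t) * \<pi> (\<lambda>x. t * f x)"
      using scale_le[OF Vs(3)[OF that(1)], of "1 / t" t] t by simp
    finally have "t * \<pi> f \<le> \<pi> (\<lambda>x. t * f x)" using t by (simp add: divide_simps mult.commute)
    with scale_le[OF that(1) t] show ?thesis by simp
  qed
  have add: "\<pi> (\<lambda>x. f x + g x) \<le> \<pi> f + \<pi> g" if fg: "f \<in> V" "g \<in> V" for f g
  proof -
    have *: "\<pi> (\<lambda>x. f x + g x) \<le> (\<rho> (\<lambda>x. f x + v x) - c v) + (\<rho> (\<lambda>x. g x + w x) - c w)"
      if vw: "v \<in> W" "w \<in> W" for v w
    proof -
      have vw': "v \<in> V" "w \<in> V" using vw W by auto
      have "\<pi> (\<lambda>x. f x + g x) \<le> \<rho> (\<lambda>x. (f x + g x) + (v x + w x)) - c (\<lambda>x. v x + w x)"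
        by (rule upper[OF Vs(2)[OF fg] W_add[OF vw]])
      also have "(\<lambda>x. (f x + g x) + (v x + w x)) = (\<lambda>x. (f x + v x) + (g x + w x))"
        by (simp add: algebra_simps)
      also have "\<rho> \<dots> \<le> \<rho> (\<lambda>x. f x + v x) + \<rho> (\<lambda>x. g x + w x)"
        by (rule rho(1)[OF Vs(2)[OF fg(1) vw'(1)] Vs(2)[OF fg(2) vw'(2)]])
      finally show ?thesis using c_add[OF vw] by simp
    qed
    have "\<pi> (\<lambda>x. f x + g x) - (\<rho> (\<lambda>x. f x + v x) - c v) \<le> \<pi> g" if v: "v \<in> W" for v
      by (rule greatest[OF fg(2)]) (use *[OF v] in \<open>simp add: algebra_simps\<close>)
    then have "\<pi> (\<lambda>x. f x + g x) - \<pi> g \<le> \<pi> f"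
      by (intro greatest[OF fg(1)]) (simp add: algebra_simps)
    then show ?thesis by simp
  qed
  have "\<pi> (\<lambda>x. - w x) \<le> - c w" if "w \<in> W" for w
    using upper[OF Vs(4) that, of w] that W sublinear_on_zero[OF V \<rho>] by auto
  moreover have "sublinear_on V \<pi>"
    using add scale by (auto simp: sublinear_on_def)
  moreover have "\<And>f. f \<notin> V \<Longrightarrow> \<pi> f = 0" by (simp add: \<pi>_def)
  ultimately show ?thesis using le by blast
qed

text \<open>Zorn's lemma for the reversed pointwise order. Values outside \<open>V\<close> are
  pinned to 0, since otherwise they could be lowered forever and nothing would be minimal. The lower
  bound of a chain is its pointwise infimum, which is finite because every member at
  \<open>f\<close> is at least minus \<open>\<rho>\<close> at \<open>- f\<close>.\<close>

lemma ex_minimal_sublinear: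
  assumes V: "function_subspace V" and \<rho>: "sublinear_on V \<rho>"
  defines "A \<equiv> {\<sigma>. sublinear_on V \<sigma> \<and> (\<forall>f\<in>V. \<sigma> f \<le> \<rho> f) \<and> (\<forall>f. f \<notin> V \<longrightarrow> \<sigma> f = 0)}"
  shows "\<exists>\<sigma>\<in>A. \<forall>\<tau>\<in>A. \<tau> \<le> \<sigma> \<longrightarrow> \<tau> = \<sigma>"
proof -
  note Vs = function_subspaceD[OF V]
  have lower: "- \<rho> (\<lambda>x. - f x) \<le> \<sigma> f" if "\<sigma> \<in> A" "f \<in> V" for \<sigma> f
    using sublinear_on_uminus[OF V _ that(2), of \<sigma>] that Vs(4)[OF that(2)]
    unfolding A_def by force
  show ?thesis
  proof (rule predicate_Zorn[where P = "\<lambda>\<sigma> \<tau>. \<tau> \<le> \<sigma>"])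
    show "partial_order_on A (relation_of (\<lambda>\<sigma> \<tau>. \<tau> \<le> \<sigma>) A)"
      by (auto simp: partial_order_on_def preorder_on_def refl_on_def trans_def antisym_def
          relation_of_def)
    fix C assume C: "C \<in> Chains (relation_of (\<lambda>\<sigma> \<tau>. \<tau> \<le> \<sigma>) A)"
    then have CA: "C \<subseteq> A" and chain: "\<And>\<sigma> \<tau>. \<sigma> \<in> C \<Longrightarrow> \<tau> \<in> C \<Longrightarrow> \<sigma> \<le> \<tau> \<or> \<tau> \<le> \<sigma>"
      unfolding Chains_def relation_of_def by blast+
    show "\<exists>u\<in>A. \<forall>a\<in>C. u \<le> a"
    proof (cases "C = {}")
      case True
      have "(\<lambda>f. if f \<in> V then \<rho> f else 0) \<in> A"
        using \<rho> Vs unfolding A_def sublinear_on_def by auto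
      with True show ?thesis by blast
    next
      case False
      define u where "u f = (if f \<in> V then INF \<sigma>\<in>C. \<sigma> f else 0)" for f
      have bdd: "bdd_below ((\<lambda>\<sigma>. \<sigma> f) ` C)" if "f \<in> V" for f
        using lower[OF _ that] CA by (intro bdd_belowI2) auto
      have up: "u f \<le> \<sigma> f" if "f \<in> V" "\<sigma> \<in> C" for f \<sigma>
        unfolding u_def using cINF_lower[OF bdd[OF that(1)] that(2)] that by simp
      have gr: "b \<le> u f" if "f \<in> V" "\<And>\<sigma>. \<sigma> \<in> C \<Longrightarrow> b \<le> \<sigma> f" for b f
        unfolding u_def using that False by (auto intro!: cINF_greatest)
      have sub: "sublinear_on V \<sigma>" if "\<sigma> \<in> C" for \<sigma> using that CA by (auto simp: A_def)
      have "u (\<lambda>x. f x + g x) \<le> u f + u g" if fg: "f \<in> V" "g \<in> V" for f g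
      proof -
        have *: "u (\<lambda>x. f x + g x) \<le> \<sigma> f + \<tau> g" if st: "\<sigma> \<in> C" "\<tau> \<in> C" for \<sigma> \<tau>
        proof -
          \<comment> \<open>The chain condition enters here: two members have a common lower bound
            inside the chain, which makes the infimum subadditive.\<close>
          obtain \<kappa> where k: "\<kappa> \<in> C" "\<kappa> \<le> \<sigma>" "\<kappa> \<le> \<tau>"
            using chain[OF st] st by auto
          have "u (\<lambda>x. f x + g x) \<le> \<kappa> f + \<kappa> g"
            using up[OF Vs(2)[OF fg] k(1)] sublinear_onD(1)[OF sub[OF k(1)] fg] by simp
          also have "\<dots> \<le> \<sigma> f + \<tau> g"
            using k(2,3) by (intro add_mono) (auto simp: le_fun_def)
          finally show ?thesis .
        qed
        have "u (\<lambda>x. f x + g x) - \<sigma> f \<le> u g" if "\<sigma> \<in> C" for \<sigma>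
          by (rule gr[OF fg(2)]) (use *[OF that] in \<open>simp add: algebra_simps\<close>)
        then have "u (\<lambda>x. f x + g x) - u g \<le> u f"
          by (intro gr[OF fg(1)]) (simp add: algebra_simps)
        then show ?thesis by simp
      qed
      moreover have "u (\<lambda>x. c * f x) = c * u f" if f: "f \<in> V" "0 \<le> c" for f c
      proof (cases "c = 0")
        case True
        have "\<sigma> (\<lambda>_. 0) = 0" if "\<sigma> \<in> C" for \<sigma>
          using sublinear_on_zero[OF V sub[OF that]] .
        then have "(\<lambda>\<sigma>. \<sigma> (\<lambda>_. 0)) ` C = (\<lambda>_. 0) ` C" by (intro image_cong) auto
        also have "\<dots> = {0}" using False by auto
        finally have "u (\<lambda>_. 0) = 0" using Vs(1) by (simp add: u_def)
        with True show ?thesis by simp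
      next
        case False
        with f have c: "0 < c" by simp
        show ?thesis
        proof (rule antisym)
          have "u (\<lambda>x. c * f x) / c \<le> u f"
          proof (rule gr[OF f(1)])
            fix \<sigma> assume s: "\<sigma> \<in> C"
            show "u (\<lambda>x. c * f x) / c \<le> \<sigma> f"
              using up[OF Vs(3)[OF f(1)] s, of c] sublinear_onD(2)[OF sub[OF s] f] c
              by (simp add: divide_simps mult.commute)
          qed
          then show "u (\<lambda>x. c * f x) \<le> c * u f" using c by (simp add: divide_simps mult.commute)
          show "c * u f \<le> u (\<lambda>x. c * f x)"
          proof (rule gr[OF Vs(3)[OF f(1)]])
            fix \<sigma> assume s: "\<sigma> \<in> C"
            show "c * u f \<le> \<sigma> (\<lambda>x. c * f x)"
              using up[OF f(1) s] sublinear_onD(2)[OF sub[OF s] f] c by simp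
          qed
        qed
      qed
      moreover have "u f \<le> \<rho> f" if "f \<in> V" for f
      proof -
        obtain \<sigma> where "\<sigma> \<in> C" using False by blast
        then show ?thesis using up[OF that] CA that unfolding A_def by force
      qed
      ultimately have "u \<in> A"
        unfolding A_def sublinear_on_def by (auto simp: u_def)
      moreover have "u \<le> a" if "a \<in> C" for a
        using up that CA by (auto simp: le_fun_def u_def A_def)
      ultimately show ?thesis by blast
    qed
  qed
qed

text \<open>A minimal sublinear functional is linear. Its minorant for the ray through
  \<open>f\<close>, with \<open>c\<close> the functional itself, lies below it and so equals it,
  which forces the value at \<open>- f\<close> to be at most minus the value at \<open>f\<close>. An
  odd subadditive functional is additive.\<close>

theorem hahn_banach_sublinear:
  assumes V: "function_subspace V" and \<rho>: "sublinear_on V \<rho>"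
  obtains \<phi> where "linear_functional_on V \<phi>" "\<And>f. f \<in> V \<Longrightarrow> \<phi> f \<le> \<rho> f"
proof -
  note Vs = function_subspaceD[OF V]
  obtain \<sigma> where s: "sublinear_on V \<sigma>" "\<And>f. f \<in> V \<Longrightarrow> \<sigma> f \<le> \<rho> f" "\<And>f. f \<notin> V \<Longrightarrow> \<sigma> f = 0"
    and min: "\<And>\<tau>. sublinear_on V \<tau> \<Longrightarrow> (\<And>f. f \<in> V \<Longrightarrow> \<tau> f \<le> \<rho> f) \<Longrightarrow>
      (\<And>f. f \<notin> V \<Longrightarrow> \<tau> f = 0) \<Longrightarrow> \<tau> \<le> \<sigma> \<Longrightarrow> \<tau> = \<sigma>"
    using ex_minimal_sublinear[OF V \<rho>] by blast
  note sD = sublinear_onD[OF s(1)]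
  have neg: "\<sigma> (\<lambda>x. - f x) = - \<sigma> f" if f: "f \<in> V" for f
  proof -
    define W where "W = {g. \<exists>t\<ge>0. g = (\<lambda>x. t * f x)}"
    have sW: "\<sigma> (\<lambda>x. t * f x) = t * \<sigma> f" if "0 \<le> t" for t
      using sD(2)[OF f that] .
    have "W \<subseteq> V" using Vs(3)[OF f] by (auto simp: W_def)
    moreover have "(\<lambda>_. 0) \<in> W" by (auto simp: W_def intro!: exI[of _ 0])
    moreover have addW: "(\<lambda>x. v x + w x) \<in> W \<and> \<sigma> v + \<sigma> w \<le> \<sigma> (\<lambda>x. v x + w x)"
      if "v \<in> W" "w \<in> W" for v w
    proof -
      have "\<exists>a. 0 \<le> a \<and> v = (\<lambda>x. a * f x)" "\<exists>b. 0 \<le> b \<and> w = (\<lambda>x. b * f x)"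
        using that by (simp_all add: W_def)
      from this(1) obtain a where a: "0 \<le> a \<and> v = (\<lambda>x. a * f x)" ..
      from \<open>\<exists>b. 0 \<le> b \<and> w = (\<lambda>x. b * f x)\<close> obtain b where b: "0 \<le> b \<and> w = (\<lambda>x. b * f x)" ..
      note ab = conjunct1[OF a] conjunct1[OF b] conjunct2[OF a] conjunct2[OF b]
      have "(\<lambda>x. v x + w x) = (\<lambda>x. (a + b) * f x)" using ab by (simp add: algebra_simps)
      then show ?thesis
        using ab sW[of a] sW[of b] sW[of "a + b"]
        by (auto simp: W_def algebra_simps intro!: exI[of _ "a + b"])
    qed
    moreover have scaleW: "(\<lambda>x. t * w x) \<in> W \<and> \<sigma> (\<lambda>x. t * w x) = t * \<sigma> w"
      if "w \<in> W" "0 < t" for t w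
    proof -
      have "\<exists>b. 0 \<le> b \<and> w = (\<lambda>x. b * f x)" using that by (simp add: W_def)
      then obtain b where "0 \<le> b \<and> w = (\<lambda>x. b * f x)" ..
      note b = conjunct1[OF this] conjunct2[OF this]
      from b have "0 \<le> t * b" "(\<lambda>x. t * w x) = (\<lambda>x. (t * b) * f x)"
        using that(2) by (simp_all add: algebra_simps)
      then show ?thesis
        using sW[of b] sW[of "t * b"] b unfolding W_def by auto
    qed
    ultimately have "\<exists>\<pi>. sublinear_on V \<pi> \<and> (\<forall>f\<in>V. \<pi> f \<le> \<sigma> f) \<and>
      (\<forall>w\<in>W. \<pi> (\<lambda>x. - w x) \<le> - \<sigma> w) \<and> (\<forall>f. f \<notin> V \<longrightarrow> \<pi> f = 0)"
      by (intro sublinear_minorant[OF V s(1)]) simp_all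
    then obtain \<pi> where p: "sublinear_on V \<pi>" "\<And>f. f \<in> V \<Longrightarrow> \<pi> f \<le> \<sigma> f"
      "\<And>w. w \<in> W \<Longrightarrow> \<pi> (\<lambda>x. - w x) \<le> - \<sigma> w" "\<And>f. f \<notin> V \<Longrightarrow> \<pi> f = 0"
      by blast
    have "\<pi> = \<sigma>"
    proof (rule min[OF p(1) _ p(4)])
      show "\<pi> f \<le> \<rho> f" if "f \<in> V" for f using p(2)[OF that] s(2)[OF that] by simp
      show "\<pi> \<le> \<sigma>" using p(2,4) s(3) by (metis le_funI order_refl)
    qed
    moreover have "f \<in> W" by (auto simp: W_def intro!: exI[of _ 1])
    ultimately have "\<sigma> (\<lambda>x. - f x) \<le> - \<sigma> f" using p(3)[of f] by simp
    moreover have "- \<sigma> (\<lambda>x. - f x) \<le> \<sigma> f" using sublinear_on_uminus[OF V s(1) f] .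
    ultimately show ?thesis by simp
  qed
  have "\<sigma> (\<lambda>x. f x + g x) = \<sigma> f + \<sigma> g" if "f \<in> V" "g \<in> V" for f g
  proof (rule antisym)
    show "\<sigma> (\<lambda>x. f x + g x) \<le> \<sigma> f + \<sigma> g" using sD(1)[OF that] .
    have "- \<sigma> (\<lambda>x. f x + g x) = \<sigma> (\<lambda>x. - (f x + g x))" using neg[OF Vs(2)[OF that]] by simp
    also have "(\<lambda>x. - (f x + g x)) = (\<lambda>x. - f x + - g x)" by simp
    also have "\<sigma> \<dots> \<le> \<sigma> (\<lambda>x. - f x) + \<sigma> (\<lambda>x. - g x)"
      by (rule sD(1)[OF Vs(4)[OF that(1)] Vs(4)[OF that(2)]])
    finally show "\<sigma> f + \<sigma> g \<le> \<sigma> (\<lambda>x. f x + g x)" using neg that by simp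
  qed
  moreover have "\<sigma> (\<lambda>x. c * f x) = c * \<sigma> f" if "f \<in> V" for f c
  proof (cases "0 \<le> c")
    case True then show ?thesis using sD(2)[OF that] by simp
  next
    case False
    have "\<sigma> (\<lambda>x. - (c * f x)) = (- c) * \<sigma> f" using sD(2)[OF that, of "- c"] False by simp
    then show ?thesis using neg[OF Vs(3)[OF that, of c]] by simp
  qed
  ultimately have "linear_functional_on V \<sigma>" by (auto simp: linear_functional_on_def)
  then show thesis using that s(2) by blast
qed

text \<open>Hahn-Banach is run below the minorant of the cone. The result serves with
  \<open>c\<close> the norm on a ray, to find norming functionals, and with \<open>c\<close> zero on
  the cone built from the operator, to find the means.\<close>

theorem mazur_orlicz:
  assumes V: "function_subspace V" and \<rho>: "sublinear_on V \<rho>"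
    and W: "W \<subseteq> V" "(\<lambda>_. 0) \<in> W"
    and W_add: "\<And>v w. v \<in> W \<Longrightarrow> w \<in> W \<Longrightarrow> (\<lambda>x. v x + w x) \<in> W"
    and W_scale: "\<And>w t. w \<in> W \<Longrightarrow> 0 < t \<Longrightarrow> (\<lambda>x. t * w x) \<in> W"
    and c_add: "\<And>v w. v \<in> W \<Longrightarrow> w \<in> W \<Longrightarrow> c v + c w \<le> c (\<lambda>x. v x + w x)"
    and c_scale: "\<And>w t. w \<in> W \<Longrightarrow> 0 < t \<Longrightarrow> c (\<lambda>x. t * w x) = t * c w"
    and c_le: "\<And>w. w \<in> W \<Longrightarrow> c w \<le> \<rho> w"
  shows "\<exists>\<phi>. linear_functional_on V \<phi> \<and> (\<forall>f\<in>V. \<phi> f \<le> \<rho> f) \<and> (\<forall>w\<in>W. c w \<le> \<phi> w)"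
proof -
  obtain \<pi> where p: "sublinear_on V \<pi>" "\<And>f. f \<in> V \<Longrightarrow> \<pi> f \<le> \<rho> f"
    "\<And>w. w \<in> W \<Longrightarrow> \<pi> (\<lambda>x. - w x) \<le> - c w"
    using sublinear_minorant[OF assms] by blast
  obtain \<phi> where phi: "linear_functional_on V \<phi>" "\<And>f. f \<in> V \<Longrightarrow> \<phi> f \<le> \<pi> f"
    using hahn_banach_sublinear[OF V p(1)] by metis
  have "c w \<le> \<phi> w" if "w \<in> W" for w
  proof -
    have w: "w \<in> V" using that W by auto
    show ?thesis
      using phi(2)[OF function_subspaceD(4)[OF V w]] p(3)[OF that]
        linear_functional_onD(3)[OF phi(1) w] by simp
  qed
  moreover have "\<phi> f \<le> \<rho> f" if "f \<in> V" for f
    using phi(2)[OF that] p(2)[OF that] by simp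
  ultimately show ?thesis using phi(1) by blast
qed

section \<open>Representation of means on compact spaces\<close>

lemma less_add_ennreal:
  assumes "x < \<top>" "0 < e"
  shows "x < x + ennreal e"
  using ennreal_add_left_cancel_less[of x 0 "ennreal e"] assms by auto

text \<open>For positive \<open>y\<close> the count is \<open>\<lceil>y\<rceil> - 1\<close>, so it
  falls short of \<open>y\<close> by at most 1. It counts the level sets containing a point in the
  step function of \<open>integral_le_unit\<close>.\<close>

lemma card_grid_below:
  fixes y :: real
  assumes "0 \<le> y" "y \<le> real n"
  shows "y \<le> 1 + real (card {i \<in> {1..n}. real i < y})"
    and "real (card {i \<in> {1..n}. real i < y}) \<le> y"
proof -
  have "{i \<in> {1..n}. real i < y} = {1..nat (\<lceil>y\<rceil> - 1)}"
  proof (intro set_eqI iffI)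
    fix i assume "i \<in> {i \<in> {1..n}. real i < y}"
    then have "1 \<le> i" "int i < \<lceil>y\<rceil>" by (auto simp: less_ceiling_iff)
    then show "i \<in> {1..nat (\<lceil>y\<rceil> - 1)}" by auto
  next
    fix i assume "i \<in> {1..nat (\<lceil>y\<rceil> - 1)}"
    then have "1 \<le> i" "int i < \<lceil>y\<rceil>" by auto
    then have "real i < y" by (simp add: less_ceiling_iff)
    with \<open>1 \<le> i\<close> assms show "i \<in> {i \<in> {1..n}. real i < y}" by auto
  qed
  then have c: "card {i \<in> {1..n}. real i < y} = nat (\<lceil>y\<rceil> - 1)" by simp
  show "y \<le> 1 + real (card {i \<in> {1..n}. real i < y})"
    unfolding c by linarith
  show "real (card {i \<in> {1..n}. real i < y}) \<le> y"
    unfolding c using assms by linarith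
qed

section \<open>Bounded functions and the supremum functional\<close>

definition bounded_functions_on :: "'b set \<Rightarrow> ('b \<Rightarrow> real) set" where
  "bounded_functions_on K = {f. bounded (f ` K)}"

lemma bounded_functions_onI:
  assumes "\<And>x. x \<in> K \<Longrightarrow> \<bar>f x\<bar> \<le> B"
  shows "f \<in> bounded_functions_on K"
  using assms unfolding bounded_functions_on_def bounded_iff by auto

lemma bounded_functions_onE:
  assumes "f \<in> bounded_functions_on K"
  obtains B where "0 < B" "\<And>x. x \<in> K \<Longrightarrow> \<bar>f x\<bar> \<le> B"
  using assms unfolding bounded_functions_on_def bounded_pos by auto

lemma function_subspace_bounded_functions_on: "function_subspace (bounded_functions_on K)"
  unfolding function_subspace_def
proof (intro conjI ballI allI)
  show "(\<lambda>_. 0) \<in> bounded_functions_on K" by (rule bounded_functions_onI[of _ _ 0]) simp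
  fix f assume f: "f \<in> bounded_functions_on K"
  obtain B where B: "\<And>x. x \<in> K \<Longrightarrow> \<bar>f x\<bar> \<le> B" using bounded_functions_onE[OF f] by metis
  show "(\<lambda>x. c * f x) \<in> bounded_functions_on K" for c
    by (rule bounded_functions_onI[of _ _ "\<bar>c\<bar> * B"]) (auto simp: abs_mult intro!: mult_left_mono B)
  fix g assume g: "g \<in> bounded_functions_on K"
  obtain C where C: "\<And>x. x \<in> K \<Longrightarrow> \<bar>g x\<bar> \<le> C" using bounded_functions_onE[OF g] by metis
  show "(\<lambda>x. f x + g x) \<in> bounded_functions_on K"
    by (rule bounded_functions_onI[of _ _ "B + C"]) (use B C in \<open>smt (verit)\<close>)
qed

lemma bdd_above_bounded_functions_on: "f \<in> bounded_functions_on K \<Longrightarrow> bdd_above (f ` K)"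
  by (simp add: bounded_functions_on_def bounded_imp_bdd_above)

lemma SUP_affine_ge:
  fixes f :: "'b \<Rightarrow> real"
  assumes "K \<noteq> {}" "0 < c" and bdd: "bdd_above ((\<lambda>x. c * f x + d) ` K)"
  shows "c * (SUP x\<in>K. f x) + d \<le> (SUP x\<in>K. c * f x + d)"
proof -
  have "(SUP x\<in>K. f x) \<le> ((SUP x\<in>K. c * f x + d) - d) / c"
  proof (rule cSUP_least[OF assms(1)])
    fix x assume "x \<in> K"
    from cSUP_upper[OF this bdd] show "f x \<le> ((SUP x\<in>K. c * f x + d) - d) / c"
      using assms(2) by (simp add: pos_le_divide_eq mult.commute)
  qed
  then show ?thesis using assms(2) by (simp add: pos_le_divide_eq mult.commute)
qed

lemma sublinear_SUP:
  assumes K: "K \<noteq> {}"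
  shows "sublinear_on (bounded_functions_on K) (\<lambda>f. SUP x\<in>K. f x)"
  unfolding sublinear_on_def
proof (intro conjI ballI allI impI)
  note Vs = function_subspaceD[OF function_subspace_bounded_functions_on[of K]]
  note bdd = bdd_above_bounded_functions_on
  fix f assume f: "f \<in> bounded_functions_on K"
  show "(SUP x\<in>K. c * f x) = c * (SUP x\<in>K. f x)" if "0 \<le> c" for c
  proof (cases "c = 0")
    case True
    then show ?thesis using K by simp
  next
    case False
    with that have c: "0 < c" by simp
    show ?thesis
    proof (rule antisym)
      show "(SUP x\<in>K. c * f x) \<le> c * (SUP x\<in>K. f x)"
        using c by (intro cSUP_least[OF K] mult_left_mono cSUP_upper bdd f) auto
      show "c * (SUP x\<in>K. f x) \<le> (SUP x\<in>K. c * f x)"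
        using SUP_affine_ge[OF K c, of f 0] bdd[OF Vs(3)[OF f, of c]] by simp
    qed
  qed
  fix g assume g: "g \<in> bounded_functions_on K"
  show "(SUP x\<in>K. f x + g x) \<le> (SUP x\<in>K. f x) + (SUP x\<in>K. g x)"
    by (intro cSUP_least[OF K] add_mono cSUP_upper bdd f g)
qed

lemma continuous_map_bounded_functions_on:
  assumes "compact_space T" "continuous_map T euclideanreal f"
  shows "f \<in> bounded_functions_on (topspace T)"
  using image_compactin[OF _ assms(2), of "topspace T"] assms(1)
  by (simp add: compact_space_def bounded_functions_on_def compact_imp_bounded)

lemma regular_borel_prob_measurable:
  assumes "regular_borel_prob T \<nu>" "continuous_map T euclideanreal f"
  shows "f \<in> borel_measurable \<nu>"
proof (rule borel_measurableI)
  have \<nu>: "space \<nu> = topspace T" "sets \<nu> = sigma_sets (topspace T) {U. openin T U}"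
    using assms(1) by (auto simp: regular_borel_prob_def)
  fix S :: "real set" assume "open S"
  then have "openin T {x \<in> topspace T. f x \<in> S}"
    using openin_continuous_map_preimage[OF assms(2), of S] by simp
  moreover have "f -` S \<inter> space \<nu> = {x \<in> topspace T. f x \<in> S}" by (auto simp: \<nu>)
  ultimately show "f -` S \<inter> space \<nu> \<in> sets \<nu>" unfolding \<nu>(2) by auto
qed

text \<open>
  The functional is defined on all bounded functions, so it yields a finitely additive probability
  on all subsets; the measure is obtained from it by inner approximation of open sets by
  closed sets, followed by outer approximation by open sets.
\<close>

locale bounded_mean =
  fixes T :: "'b topology" and \<Lambda> :: "('b \<Rightarrow> real) \<Rightarrow> real"
  assumes compact: "compact_space T" and normal: "normal_space T"
    and nonempty: "topspace T \<noteq> {}"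
    and linear: "linear_functional_on (bounded_functions_on (topspace T)) \<Lambda>"
    and le_SUP: "\<And>f. f \<in> bounded_functions_on (topspace T) \<Longrightarrow> \<Lambda> f \<le> (SUP x\<in>topspace T. f x)"
begin

abbreviation "\<Omega> \<equiv> topspace T"
abbreviation "BF \<equiv> bounded_functions_on \<Omega>"

lemmas BF_subspace = function_subspaceD[OF function_subspace_bounded_functions_on[of \<Omega>]]
lemmas Lambda_simps = linear_functional_onD[OF linear]

lemma le_const:
  assumes "f \<in> BF" "\<And>x. x \<in> \<Omega> \<Longrightarrow> f x \<le> c"
  shows "\<Lambda> f \<le> c"
  by (rule order_trans[OF le_SUP[OF assms(1)] cSUP_least[OF nonempty assms(2)]])

text \<open>Domination by the supremum already contains positivity, because \<open>f - g\<close> has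
  supremum at most 0. Tested on the constants \<open>c\<close> and \<open>- c\<close> it contains
  normalization as well.\<close>

lemma mono:
  assumes "f \<in> BF" "g \<in> BF" "\<And>x. x \<in> \<Omega> \<Longrightarrow> f x \<le> g x"
  shows "\<Lambda> f \<le> \<Lambda> g"
proof -
  have "\<Lambda> (\<lambda>x. f x - g x) \<le> 0"
    by (rule le_const[OF BF_subspace(5)[OF assms(1,2)]]) (use assms(3) in simp)
  then show ?thesis
    using linear_functional_on_diff[OF function_subspace_bounded_functions_on linear assms(1,2)]
    by simp
qed

lemma const: "\<Lambda> (\<lambda>_. c) = c"
proof -
  have BF: "(\<lambda>_. d) \<in> BF" for d by (rule bounded_functions_onI[of _ _ "\<bar>d\<bar>"]) simp
  have "\<Lambda> (\<lambda>_. c) \<le> c" "\<Lambda> (\<lambda>_. - c) \<le> - c" by (rule le_const[OF BF]; simp)+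
  with Lambda_simps(3)[OF BF, of c] show ?thesis by simp
qed

lemma indicator_BF: "(indicator A :: 'b \<Rightarrow> real) \<in> BF"
  by (rule bounded_functions_onI[of _ _ 1]) (simp add: indicator_def)

section \<open>Set functions derived from a mean\<close>

definition "m A = \<Lambda> (indicator A)"

lemma m_mono: "A \<inter> \<Omega> \<subseteq> B \<Longrightarrow> m A \<le> m B"
  unfolding m_def by (rule mono[OF indicator_BF indicator_BF]) (auto simp: indicator_def)

lemma m_nonneg: "0 \<le> m A"
  using mono[OF BF_subspace(1) indicator_BF, of A] const[of 0] unfolding m_def by simp

lemma m_le_1: "m A \<le> 1"
  unfolding m_def by (rule le_const[OF indicator_BF]) (auto simp: indicator_def)

lemma m_Un_disjoint: "A \<inter> B = {} \<Longrightarrow> m (A \<union> B) = m A + m B"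
  unfolding m_def using Lambda_simps(1)[OF indicator_BF indicator_BF, of A B]
  by (simp add: indicator_add)

lemma m_empty: "m {} = 0"
  using m_Un_disjoint[of "{}" "{}"] by simp

lemma m_Un_le: "m (A \<union> B) \<le> m A + m B"
proof -
  have "m (B - A) \<le> m B" by (rule m_mono) auto
  then show ?thesis using m_Un_disjoint[of A "B - A"] by simp
qed

lemma m_space: "m \<Omega> = 1"
proof -
  have "m UNIV = 1" unfolding m_def using const[of 1] by simp
  then show ?thesis using m_mono[of UNIV \<Omega>] m_le_1[of \<Omega>] by simp
qed

text \<open>The function \<open>m\<close> is only finitely additive. Filling open sets by closed
  ones is what lets compactness produce countable subadditivity.\<close>

definition \<mu>\<^sub>0 :: "'b set \<Rightarrow> ennreal" where
  "\<mu>\<^sub>0 U = (SUP C\<in>{C. closedin T C \<and> C \<subseteq> U}. ennreal (m C))"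

lemma \<mu>\<^sub>0_upper: "closedin T C \<Longrightarrow> C \<subseteq> U \<Longrightarrow> ennreal (m C) \<le> \<mu>\<^sub>0 U"
  unfolding \<mu>\<^sub>0_def by (intro SUP_upper) auto

lemma \<mu>\<^sub>0_least: "(\<And>C. closedin T C \<Longrightarrow> C \<subseteq> U \<Longrightarrow> ennreal (m C) \<le> b) \<Longrightarrow> \<mu>\<^sub>0 U \<le> b"
  unfolding \<mu>\<^sub>0_def by (intro SUP_least) auto

lemma \<mu>\<^sub>0_le_m: "\<mu>\<^sub>0 U \<le> ennreal (m U)"
  by (intro \<mu>\<^sub>0_least ennreal_leI m_mono) auto

lemma \<mu>\<^sub>0_mono: "U \<subseteq> V \<Longrightarrow> \<mu>\<^sub>0 U \<le> \<mu>\<^sub>0 V"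
  by (intro \<mu>\<^sub>0_least \<mu>\<^sub>0_upper) auto

lemma \<mu>\<^sub>0_le_1: "\<mu>\<^sub>0 U \<le> 1"
  by (rule order_trans[OF \<mu>\<^sub>0_le_m]) (use m_le_1 ennreal_leI[of "m U" 1] in simp)

text \<open>Normality separates the disjoint closed sets \<open>C - U\<close> and
  \<open>C - U'\<close> by open sets \<open>V\<close> and \<open>V'\<close>. Removing each of these
  from \<open>C\<close> leaves two closed sets that together cover \<open>C\<close>, one inside
  \<open>U\<close> and the other inside \<open>U'\<close>.\<close>

lemma \<mu>\<^sub>0_Un:
  assumes U: "openin T U" "openin T U'"
  shows "\<mu>\<^sub>0 (U \<union> U') \<le> \<mu>\<^sub>0 U + \<mu>\<^sub>0 U'"
proof (rule \<mu>\<^sub>0_least)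
  fix C assume C: "closedin T C" "C \<subseteq> U \<union> U'"
  have "closedin T (C - U)" "closedin T (C - U')" "disjnt (C - U) (C - U')"
    using C U by (auto simp: disjnt_def)
  then obtain V V' where V: "openin T V" "openin T V'" "C - U \<subseteq> V" "C - U' \<subseteq> V'" "disjnt V V'"
    using normal[unfolded normal_space_def, rule_format, of "C - U" "C - U'"] by metis
  have "m C \<le> m ((C - V) \<union> (C - V'))"
    by (rule m_mono) (use V in \<open>auto simp: disjnt_def\<close>)
  also have "\<dots> \<le> m (C - V) + m (C - V')" by (rule m_Un_le)
  finally have "ennreal (m C) \<le> ennreal (m (C - V)) + ennreal (m (C - V'))"
    using m_nonneg by (metis ennreal_leI ennreal_plus)
  also have "\<dots> \<le> \<mu>\<^sub>0 U + \<mu>\<^sub>0 U'"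
    using C V by (intro add_mono \<mu>\<^sub>0_upper) auto
  finally show "ennreal (m C) \<le> \<mu>\<^sub>0 U + \<mu>\<^sub>0 U'" .
qed

lemma \<mu>\<^sub>0_UN_finite:
  assumes "\<And>i. openin T (U i)"
  shows "\<mu>\<^sub>0 (\<Union>i<n::nat. U i) \<le> (\<Sum>i<n. \<mu>\<^sub>0 (U i))"
proof (induction n)
  case 0
  have "\<mu>\<^sub>0 {} \<le> 0" using m_empty by (intro \<mu>\<^sub>0_least) auto
  then show ?case by simp
next
  case (Suc n)
  have "(\<Union>i<Suc n. U i) = (\<Union>i<n. U i) \<union> U n" by (auto simp: less_Suc_eq)
  moreover have "openin T (\<Union>i<n. U i)" using assms by auto
  then have "\<mu>\<^sub>0 ((\<Union>i<n. U i) \<union> U n) \<le> (\<Sum>i<n. \<mu>\<^sub>0 (U i)) + \<mu>\<^sub>0 (U n)"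
    by (rule order_trans[OF \<mu>\<^sub>0_Un[OF _ assms] add_right_mono[OF Suc]])
  ultimately show ?case by simp
qed

text \<open>A closed set inside the union is compact, so finitely many of the \<open>U i\<close>
  already cover it.\<close>

lemma \<mu>\<^sub>0_UN:
  assumes U: "\<And>i::nat. openin T (U i)"
  shows "\<mu>\<^sub>0 (\<Union>i. U i) \<le> (\<Sum>i. \<mu>\<^sub>0 (U i))"
proof (rule \<mu>\<^sub>0_least)
  fix C assume C: "closedin T C" "C \<subseteq> (\<Union>i. U i)"
  have "compactin T C" using closedin_compact_space[OF compact C(1)] .
  then obtain F where F: "finite F" "F \<subseteq> range U" "C \<subseteq> \<Union>F"
    using C(2) U unfolding compactin_def by (metis (no_types, lifting) imageE)
  obtain I where I: "finite I" "F = U ` I" using finite_subset_image[OF F(1,2)] by auto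
  have "C \<subseteq> (\<Union>i<Suc (Max I). U i)"
  proof
    fix x assume "x \<in> C"
    then obtain i where "i \<in> I" "x \<in> U i" using F(3) I by auto
    then show "x \<in> (\<Union>i<Suc (Max I). U i)" using Max_ge[OF I(1), of i] by (auto simp: less_Suc_eq_le)
  qed
  then have "ennreal (m C) \<le> \<mu>\<^sub>0 (\<Union>i<Suc (Max I). U i)" by (rule \<mu>\<^sub>0_upper[OF C(1)])
  also have "\<dots> \<le> (\<Sum>i<Suc (Max I). \<mu>\<^sub>0 (U i))" by (rule \<mu>\<^sub>0_UN_finite[OF U])
  also have "\<dots> \<le> (\<Sum>i. \<mu>\<^sub>0 (U i))" by (rule sum_le_suminf) auto
  finally show "ennreal (m C) \<le> (\<Sum>i. \<mu>\<^sub>0 (U i))" .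
qed

definition outer :: "'b set \<Rightarrow> ennreal" where
  "outer A = (INF U\<in>{U. openin T U \<and> A \<subseteq> U}. \<mu>\<^sub>0 U)"

lemma outer_lower: "openin T U \<Longrightarrow> A \<subseteq> U \<Longrightarrow> outer A \<le> \<mu>\<^sub>0 U"
  unfolding outer_def by (intro INF_lower) auto

lemma outer_greatest: "(\<And>U. openin T U \<Longrightarrow> A \<subseteq> U \<Longrightarrow> b \<le> \<mu>\<^sub>0 U) \<Longrightarrow> b \<le> outer A"
  unfolding outer_def by (intro INF_greatest) auto

lemma outer_open: "openin T U \<Longrightarrow> outer U = \<mu>\<^sub>0 U"
  by (intro antisym outer_lower outer_greatest \<mu>\<^sub>0_mono) auto

lemma outer_mono: "A \<subseteq> B \<Longrightarrow> outer A \<le> outer B"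
  by (intro outer_greatest outer_lower) auto

lemma outer_le_1: "A \<subseteq> \<Omega> \<Longrightarrow> outer A \<le> 1"
  using outer_lower[OF openin_topspace] \<mu>\<^sub>0_le_1 order_trans by blast

lemma outer_measure_space_outer: "outer_measure_space (Pow \<Omega>) outer"
  unfolding outer_measure_space_def
proof (intro conjI)
  show "positive (Pow \<Omega>) outer"
    using m_empty outer_open[of "{}"] \<mu>\<^sub>0_le_m[of "{}"] by (simp add: positive_def)
  show "increasing (Pow \<Omega>) outer" by (auto simp: increasing_def outer_mono)
  show "countably_subadditive (Pow \<Omega>) outer"
    unfolding countably_subadditive_def
  proof (intro allI impI)
    fix A :: "nat \<Rightarrow> 'b set" assume A: "range A \<subseteq> Pow \<Omega>"
    show "outer (\<Union>i. A i) \<le> (\<Sum>i. outer (A i))"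
    proof (rule ennreal_le_epsilon)
      fix e :: real assume e: "0 < e"
      \<comment> \<open>Almost optimal open supersets, with errors \<open>e * (1/2) ^ Suc i\<close>
        that add up to \<open>e\<close>.\<close>
      have "\<exists>U. openin T U \<and> A i \<subseteq> U \<and> \<mu>\<^sub>0 U \<le> outer (A i) + ennreal (e * (1/2) ^ Suc i)" for i
      proof -
        have "outer (A i) < outer (A i) + ennreal (e * (1/2) ^ Suc i)"
          using e outer_le_1[of "A i"] A
          by (intro less_add_ennreal) (auto simp: image_subset_iff intro: le_less_trans)
        then show ?thesis
          unfolding outer_def[of "A i"] INF_less_iff by (auto simp flip: outer_def intro: less_imp_le)
      qed
      then obtain U where U: "\<And>i. openin T (U i)" "\<And>i. A i \<subseteq> U i"
        "\<And>i. \<mu>\<^sub>0 (U i) \<le> outer (A i) + ennreal (e * (1/2) ^ Suc i)" by metis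
      have "outer (\<Union>i. A i) \<le> \<mu>\<^sub>0 (\<Union>i. U i)"
        using U by (intro outer_lower) auto
      also have "\<dots> \<le> (\<Sum>i. \<mu>\<^sub>0 (U i))" by (rule \<mu>\<^sub>0_UN[OF U(1)])
      also have "\<dots> \<le> (\<Sum>i. outer (A i) + ennreal (e * (1/2) ^ Suc i))"
        using U(3) by (intro suminf_le) auto
      also have "\<dots> = (\<Sum>i. outer (A i)) + (\<Sum>i. ennreal (e * (1/2) ^ Suc i))"
        by (rule suminf_add[symmetric]) auto
      also have "(\<Sum>i. ennreal (e * (1/2) ^ Suc i)) = ennreal e"
      proof -
        have "(\<lambda>i. e * (1/2) ^ Suc i) sums e"
          using sums_mult[OF power_half_series, of e] by simp
        then show ?thesis using e by (intro suminf_ennreal_eq) auto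
      qed
      finally show "outer (\<Union>i. A i) \<le> (\<Sum>i. outer (A i)) + ennreal e" .
    qed
  qed
qed

text \<open>The splitting is proved for open \<open>V\<close> first: exhaust
  \<open>V \<inter> U\<close> by closed sets \<open>C\<close>, and then the open set
  \<open>V - C\<close>, which contains \<open>V - U\<close>, by closed sets \<open>D\<close>. Since
  \<open>C\<close> and \<open>D\<close> are disjoint, \<open>m\<close> is additive on them and their
  union lies in \<open>V\<close>. Arbitrary sets follow by taking the infimum over open
  supersets.\<close>

lemma open_in_lambda_system:
  assumes U: "openin T U"
  shows "U \<in> lambda_system \<Omega> (Pow \<Omega>) outer"
proof -
  have split: "\<mu>\<^sub>0 (V \<inter> U) + outer (V - U) \<le> \<mu>\<^sub>0 V" if V: "openin T V" for V
  proof -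
    have *: "ennreal (m C) + outer (V - U) \<le> \<mu>\<^sub>0 V" if C: "closedin T C" "C \<subseteq> V \<inter> U" for C
    proof -
      have "ennreal (m C) + ennreal (m D) \<le> \<mu>\<^sub>0 V" if D: "closedin T D" "D \<subseteq> V - C" for D
      proof -
        have "C \<inter> D = {}" using D by auto
        then have "ennreal (m C) + ennreal (m D) = ennreal (m (C \<union> D))"
          using m_nonneg by (simp add: m_Un_disjoint ennreal_plus)
        also have "\<dots> \<le> \<mu>\<^sub>0 V" using C D by (intro \<mu>\<^sub>0_upper) auto
        finally show ?thesis .
      qed
      then have "ennreal (m C) + \<mu>\<^sub>0 (V - C) \<le> \<mu>\<^sub>0 V"
        unfolding \<mu>\<^sub>0_def[of "V - C"]
        by (subst ennreal_SUP_add_right) (auto intro!: SUP_least)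
      moreover have "outer (V - U) \<le> \<mu>\<^sub>0 (V - C)"
        using V C by (intro outer_lower) auto
      ultimately show ?thesis by (meson add_left_mono order_trans)
    qed
    then show ?thesis
      unfolding \<mu>\<^sub>0_def[of "V \<inter> U"]
      by (subst ennreal_SUP_add_left[symmetric]) (auto intro!: SUP_least)
  qed
  have "outer (A \<inter> U) + outer (A - U) = outer A" if A: "A \<subseteq> \<Omega>" for A
  proof (rule antisym)
    show "outer (A \<inter> U) + outer (A - U) \<le> outer A"
    proof (rule outer_greatest)
      fix V assume V: "openin T V" "A \<subseteq> V"
      have "outer (A \<inter> U) + outer (A - U) \<le> \<mu>\<^sub>0 (V \<inter> U) + outer (V - U)"
        using V U by (intro add_mono outer_lower outer_mono) auto
      also have "\<dots> \<le> \<mu>\<^sub>0 V" by (rule split[OF V(1)])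
      finally show "outer (A \<inter> U) + outer (A - U) \<le> \<mu>\<^sub>0 V" .
    qed
    interpret P: sigma_algebra \<Omega> "Pow \<Omega>" by (rule sigma_algebra_Pow)
    have "subadditive (Pow \<Omega>) outer"
      using outer_measure_space_outer P.countably_subadditive_subadditive
      unfolding outer_measure_space_def by blast
    from subadditiveD[OF this, of "A \<inter> U" "A - U"] A
    show "outer A \<le> outer (A \<inter> U) + outer (A - U)" by (simp add: Int_Diff_Un Int_Diff_disjoint subset_iff)
  qed
  moreover have "(\<Omega> - U) \<inter> A = A - U" "U \<inter> A = A \<inter> U" if "A \<subseteq> \<Omega>" for A using that by auto
  ultimately show ?thesis
    using openin_subset[OF U] unfolding lambda_system_def by auto
qed

section \<open>The regular Borel measure of a mean\<close>

definition \<nu> :: "'b measure" where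
  "\<nu> = measure_of \<Omega> {U. openin T U} outer"

lemma opens_Pow: "{U. openin T U} \<subseteq> Pow \<Omega>"
  using openin_subset by auto

lemma space_\<nu>: "space \<nu> = \<Omega>"
  unfolding \<nu>_def using opens_Pow by (rule space_measure_of)

lemma sets_\<nu>: "sets \<nu> = sigma_sets \<Omega> {U. openin T U}"
  unfolding \<nu>_def using opens_Pow by (rule sets_measure_of)

lemma open_sets_\<nu>: "openin T U \<Longrightarrow> U \<in> sets \<nu>"
  unfolding sets_\<nu> by auto

lemma closed_sets_\<nu>: "closedin T C \<Longrightarrow> C \<in> sets \<nu>"
  using sets.compl_sets[OF open_sets_\<nu>, of "\<Omega> - C"]
  by (auto simp: closedin_def space_\<nu> double_diff)

text \<open>By Caratheodory's theorem \<open>outer\<close> is a measure on the sets that split it.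
  These form a \<open>\<sigma>\<close>-algebra containing the open sets, hence all Borel
  sets.\<close>

lemma emeasure_\<nu>:
  assumes "A \<in> sets \<nu>"
  shows "emeasure \<nu> A = outer A"
proof -
  interpret P: sigma_algebra \<Omega> "Pow \<Omega>" by (rule sigma_algebra_Pow)
  have L: "measure_space \<Omega> (lambda_system \<Omega> (Pow \<Omega>) outer) outer"
    by (rule P.caratheodory_lemma[OF outer_measure_space_outer])
  then interpret L: sigma_algebra \<Omega> "lambda_system \<Omega> (Pow \<Omega>) outer"
    by (simp add: measure_space_def)
  have "sets \<nu> \<subseteq> lambda_system \<Omega> (Pow \<Omega>) outer"
    unfolding sets_\<nu> by (rule L.sigma_sets_subset) (use open_in_lambda_system in auto)
  then have "measure_space \<Omega> (sets \<nu>) outer"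
    using measure_down[OF L, of "sets \<nu>"] sets.sigma_algebra_axioms[of \<nu>] by (simp add: space_\<nu>)
  then show ?thesis
    using assms opens_Pow unfolding measure_space_def
    by (intro emeasure_measure_of[OF \<nu>_def]) auto
qed

lemma emeasure_\<nu>_open: "openin T U \<Longrightarrow> emeasure \<nu> U = \<mu>\<^sub>0 U"
  by (simp add: emeasure_\<nu> open_sets_\<nu> outer_open)

lemma prob_space_\<nu>: "prob_space \<nu>"
proof (rule prob_spaceI)
  have "1 \<le> \<mu>\<^sub>0 \<Omega>" using \<mu>\<^sub>0_upper[of \<Omega> \<Omega>] m_space by simp
  then show "emeasure \<nu> (space \<nu>) = 1"
    using \<mu>\<^sub>0_le_1[of \<Omega>] by (simp add: space_\<nu> emeasure_\<nu>_open)
qed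

text \<open>Outer regularity is built into \<open>outer\<close>. For inner regularity pass to
  complements: an open set close to \<open>\<Omega> - A\<close> from outside leaves a closed, hence
  compact, subset of \<open>A\<close>, and the total mass 1 transfers the error.\<close>

lemma regular_\<nu>: "regular_borel_prob T \<nu>"
  unfolding regular_borel_prob_def
proof (intro conjI ballI)
  interpret prob_space \<nu> by (rule prob_space_\<nu>)
  fix A assume A: "A \<in> sets \<nu>"
  have A_sub: "A \<subseteq> \<Omega>" using sets.sets_into_space[OF A] space_\<nu> by simp
  have outer_reg: "emeasure \<nu> B = (INF U\<in>{U. openin T U \<and> B \<subseteq> U}. emeasure \<nu> U)"
    if "B \<in> sets \<nu>" for B
    unfolding emeasure_\<nu>[OF that] outer_def by (intro INF_cong) (auto simp: emeasure_\<nu>_open)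
  then show "emeasure \<nu> A = (INF U\<in>{U. openin T U \<and> A \<subseteq> U}. emeasure \<nu> U)" using A by blast
  show "emeasure \<nu> A = (SUP K\<in>{K. compactin T K \<and> K \<in> sets \<nu> \<and> K \<subseteq> A}. emeasure \<nu> K)"
  proof (rule antisym)
    show "(SUP K\<in>{K. compactin T K \<and> K \<in> sets \<nu> \<and> K \<subseteq> A}. emeasure \<nu> K) \<le> emeasure \<nu> A"
      using A by (intro SUP_least emeasure_mono) auto
    show "emeasure \<nu> A \<le> (SUP K\<in>{K. compactin T K \<and> K \<in> sets \<nu> \<and> K \<subseteq> A}. emeasure \<nu> K)"
    proof (rule ennreal_le_epsilon)
      fix e :: real assume e: "0 < e"
      have Ac: "\<Omega> - A \<in> sets \<nu>" using sets.compl_sets[OF A] space_\<nu> by simp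
      have "emeasure \<nu> (\<Omega> - A) < emeasure \<nu> (\<Omega> - A) + ennreal e"
        using e by (intro less_add_ennreal) (simp_all add: emeasure_eq_measure ennreal_less_top)
      then have "(INF U\<in>{U. openin T U \<and> \<Omega> - A \<subseteq> U}. emeasure \<nu> U) < emeasure \<nu> (\<Omega> - A) + ennreal e"
        using outer_reg[OF Ac] by simp
      then have "\<exists>U. openin T U \<and> \<Omega> - A \<subseteq> U \<and> emeasure \<nu> U < emeasure \<nu> (\<Omega> - A) + ennreal e"
        unfolding INF_less_iff by blast
      then obtain U where U: "openin T U" "\<Omega> - A \<subseteq> U"
        "emeasure \<nu> U < emeasure \<nu> (\<Omega> - A) + ennreal e" by blast
      have K: "closedin T (\<Omega> - U)" using U(1) by auto
      have "measure \<nu> U < measure \<nu> (\<Omega> - A) + e"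
        using U(3) e unfolding emeasure_eq_measure
        by (simp add: ennreal_less_iff flip: ennreal_plus)
      moreover have "measure \<nu> (\<Omega> - A) = 1 - measure \<nu> A"
        "measure \<nu> (\<Omega> - U) = 1 - measure \<nu> U"
        using prob_compl[OF A] prob_compl[OF open_sets_\<nu>[OF U(1)]] by (simp_all add: space_\<nu>)
      ultimately have "measure \<nu> A \<le> measure \<nu> (\<Omega> - U) + e" by simp
      then have "emeasure \<nu> A \<le> emeasure \<nu> (\<Omega> - U) + ennreal e"
        using e unfolding emeasure_eq_measure by (simp add: ennreal_leI flip: ennreal_plus)
      also have "emeasure \<nu> (\<Omega> - U) \<le> (SUP K\<in>{K. compactin T K \<and> K \<in> sets \<nu> \<and> K \<subseteq> A}. emeasure \<nu> K)"
        using U(2) closedin_compact_space[OF compact K] closed_sets_\<nu>[OF K]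
        by (intro SUP_upper) auto
      finally show "emeasure \<nu> A \<le>
        (SUP K\<in>{K. compactin T K \<and> K \<in> sets \<nu> \<and> K \<subseteq> A}. emeasure \<nu> K) + ennreal e"
        by (simp add: add_right_mono)
    qed
  qed
qed (simp_all add: space_\<nu> sets_\<nu> prob_space_\<nu>)

lemma integrable_\<nu>:
  assumes "continuous_map T euclideanreal f"
  shows "integrable \<nu> f"
proof -
  interpret prob_space \<nu> by (rule prob_space_\<nu>)
  obtain B where "\<And>x. x \<in> \<Omega> \<Longrightarrow> \<bar>f x\<bar> \<le> B"
    using bounded_functions_onE[OF continuous_map_bounded_functions_on[OF compact assms]] by metis
  then show ?thesis
    using regular_borel_prob_measurable[OF regular_\<nu> assms]
    by (intro integrable_const_bound[of _ B]) (auto simp: space_\<nu>)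
qed

text \<open>Layer-cake approximation: the average of the indicators of the sets where
  \<open>f > i / n\<close> lies below \<open>f\<close> by at most \<open>1 / n\<close>. These sets
  are open, and on open sets \<open>\<nu>\<close> is bounded by \<open>m\<close>; so the integral of
  the step function is at most its value under \<open>\<Lambda>\<close>.\<close>

lemma integral_le_unit:
  assumes f: "continuous_map T euclideanreal f"
    and f01: "\<And>x. x \<in> \<Omega> \<Longrightarrow> 0 \<le> f x" "\<And>x. x \<in> \<Omega> \<Longrightarrow> f x \<le> 1"
  shows "integral\<^sup>L \<nu> f \<le> \<Lambda> f"
proof -
  interpret prob_space \<nu> by (rule prob_space_\<nu>)
  note f_BF = continuous_map_bounded_functions_on[OF compact f]
  have *: "integral\<^sup>L \<nu> f \<le> 1 / real n + \<Lambda> f" if n: "0 < n" for n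
  proof -
    define U where "U i = {x \<in> \<Omega>. real i / real n < f x}" for i :: nat
    have U: "openin T (U i)" for i
      using openin_continuous_map_preimage[OF f, of "{real i / real n<..}"] by (simp add: U_def)
    define s where "s x = (1 / real n) * (\<Sum>i\<in>{1..n}. indicator (U i) x)" for x
    have card: "(\<Sum>i\<in>{1..n}. indicator (U i) x) = real (card {i \<in> {1..n}. real i < real n * f x})"
      if "x \<in> \<Omega>" for x
    proof -
      have "(\<Sum>i\<in>{1..n}. indicator (U i) x) = (\<Sum>i\<in>{1..n}. if real i < real n * f x then 1 else (0::real))"
        using that n by (intro sum.cong) (auto simp: U_def divide_simps mult.commute split: if_splits)
      also have "\<dots> = real (card {i \<in> {1..n}. real i < real n * f x})"
        by (simp add: sum.If_cases Int_def)
      finally show ?thesis .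
    qed
    have s: "f x \<le> 1 / real n + s x" "s x \<le> f x" if x: "x \<in> \<Omega>" for x
    proof -
      have "0 \<le> real n * f x" "real n * f x \<le> real n"
        using f01[OF x] by (simp_all add: mult_left_le)
      from card_grid_below[OF this] card[OF x] n
      show "f x \<le> 1 / real n + s x" "s x \<le> f x"
        unfolding s_def by (simp_all add: field_simps)
    qed
    have s_BF: "s \<in> BF" "\<Lambda> s = (1 / real n) * (\<Sum>i\<in>{1..n}. m (U i))"
      unfolding s_def m_def
      using indicator_BF linear_functional_on_sum[OF function_subspace_bounded_functions_on linear,
          of "{1..n}" "\<lambda>i. indicator (U i)"]
        BF_subspace(3)[of "\<lambda>x. \<Sum>i\<in>{1..n}. indicator (U i) x" "1 / real n"]
        Lambda_simps(2)[of "\<lambda>x. \<Sum>i\<in>{1..n}. indicator (U i) x" "1 / real n"]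
      by auto
    have int_s: "integrable \<nu> s" "integral\<^sup>L \<nu> s = (1 / real n) * (\<Sum>i\<in>{1..n}. measure \<nu> (U i))"
    proof -
      have i: "has_bochner_integral \<nu> (\<lambda>x. indicator (U i) x :: real) (measure \<nu> (U i))" for i
        using open_sets_\<nu>[OF U]
        by (intro has_bochner_integral_real_indicator) (auto simp: emeasure_eq_measure)
      have "has_bochner_integral \<nu> s ((1 / real n) * (\<Sum>i\<in>{1..n}. measure \<nu> (U i)))"
        unfolding s_def by (intro has_bochner_integral_mult_right has_bochner_integral_sum i)
      then show "integrable \<nu> s" "integral\<^sup>L \<nu> s = (1 / real n) * (\<Sum>i\<in>{1..n}. measure \<nu> (U i))"
        by (auto simp: has_bochner_integral_iff)
    qed
    have "integral\<^sup>L \<nu> f \<le> integral\<^sup>L \<nu> (\<lambda>x. 1 / real n + s x)"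
      using s int_s integrable_\<nu>[OF f] by (intro integral_mono) (auto simp: space_\<nu>)
    also have "\<dots> = 1 / real n + integral\<^sup>L \<nu> s"
      using int_s prob_space by simp
    also have "\<dots> \<le> 1 / real n + \<Lambda> s"
    proof -
      have "measure \<nu> (U i) \<le> m (U i)" for i
        using \<mu>\<^sub>0_le_m[of "U i"] m_nonneg[of "U i"] emeasure_\<nu>_open[OF U[of i]]
        by (metis emeasure_eq_measure ennreal_le_iff)
      then show ?thesis
        unfolding int_s s_BF using n by (intro add_left_mono mult_left_mono sum_mono) auto
    qed
    also have "\<Lambda> s \<le> \<Lambda> f" by (rule mono[OF s_BF(1) f_BF s(2)])
    finally show ?thesis by simp
  qed
  show ?thesis
  proof (rule field_le_epsilon)
    fix e :: real assume "0 < e"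
    then obtain n where "0 < n" "1 / real n < e"
      using nat_approx_posE[of e] by (metis zero_less_Suc)
    then show "integral\<^sup>L \<nu> f \<le> \<Lambda> f + e" using *[of n] by linarith
  qed
qed

text \<open>One inequality is enough, because it applies to \<open>- f\<close> too. The affine
  change \<open>1 / (2 * B) * g x + 1 / 2\<close> moves values between \<open>- B\<close> and
  \<open>B\<close> into the unit interval.\<close>

lemma integral_\<nu>:
  assumes f: "continuous_map T euclideanreal f"
  shows "integral\<^sup>L \<nu> f = \<Lambda> f"
proof -
  interpret prob_space \<nu> by (rule prob_space_\<nu>)
  note f_BF = continuous_map_bounded_functions_on[OF compact f]
  obtain B where B: "0 < B" "\<And>x. x \<in> \<Omega> \<Longrightarrow> \<bar>f x\<bar> \<le> B"
    using bounded_functions_onE[OF f_BF] by metis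
  have le: "integral\<^sup>L \<nu> g \<le> \<Lambda> g"
    if g: "continuous_map T euclideanreal g" "\<And>x. x \<in> \<Omega> \<Longrightarrow> \<bar>g x\<bar> \<le> B" for g
  proof -
    note g_BF = continuous_map_bounded_functions_on[OF compact g(1)]
    have cBF: "(\<lambda>_. c) \<in> BF" for c by (rule bounded_functions_onI[of _ _ "\<bar>c\<bar>"]) simp
    have "integral\<^sup>L \<nu> (\<lambda>x. 1 / (2 * B) * g x + 1 / 2) \<le> \<Lambda> (\<lambda>x. 1 / (2 * B) * g x + 1 / 2)"
    proof (rule integral_le_unit)
      show "continuous_map T euclideanreal (\<lambda>x. 1 / (2 * B) * g x + 1 / 2)"
        by (intro continuous_intros g)
      show "0 \<le> 1 / (2 * B) * g x + 1 / 2" "1 / (2 * B) * g x + 1 / 2 \<le> 1" if "x \<in> \<Omega>" for x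
        using g(2)[OF that] B(1) by (auto simp: field_simps)
    qed
    also have "\<Lambda> (\<lambda>x. 1 / (2 * B) * g x + 1 / 2) = 1 / (2 * B) * \<Lambda> g + 1 / 2"
      using Lambda_simps(1)[OF BF_subspace(3)[OF g_BF] cBF, of "1 / (2 * B)" "1 / 2"]
        Lambda_simps(2)[OF g_BF, of "1 / (2 * B)"] const[of "1 / 2"] by simp
    also have "integral\<^sup>L \<nu> (\<lambda>x. 1 / (2 * B) * g x + 1 / 2) = 1 / (2 * B) * integral\<^sup>L \<nu> g + 1 / 2"
      using integrable_\<nu>[OF g(1)] prob_space by simp
    finally show ?thesis using B(1) by (simp add: divide_simps)
  qed
  have "integral\<^sup>L \<nu> f \<le> \<Lambda> f" using le[OF f B(2)] .
  moreover have "integral\<^sup>L \<nu> (\<lambda>x. - f x) \<le> \<Lambda> (\<lambda>x. - f x)"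
    by (rule le) (use B f in \<open>auto intro!: continuous_intros\<close>)
  ultimately show ?thesis using Lambda_simps(3)[OF f_BF] by simp
qed

end

section \<open>The positive ball of the Koethe dual\<close>

text \<open>Exhaustion. For a finite measure \<open>N\<close> with the null sets of
  \<open>M\<close>, a countable union \<open>U\<close> attains the supremum of \<open>N\<close> over
  the sets with property \<open>P\<close>; a further such set that meets the complement of
  \<open>U\<close> in positive measure would exceed the supremum. This supplies strictly positive
  elements both of a lattice and of the dual ball.\<close>

lemma (in sigma_finite_measure) ex_AE_cover:
  assumes sets: "\<And>B. P B \<Longrightarrow> B \<in> sets M" and empty: "P {}"
    and UN: "\<And>A :: nat \<Rightarrow> 'a set. (\<And>i. P (A i)) \<Longrightarrow> P (\<Union>i. A i)"
    and meets: "\<And>A. A \<in> sets M \<Longrightarrow> 0 < emeasure M A \<Longrightarrow> \<exists>B. P B \<and> 0 < emeasure M (A \<inter> B)"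
  obtains B where "P B" "AE \<omega> in M. \<omega> \<in> B"
proof -
  obtain h where h: "h \<in> borel_measurable M" "integral\<^sup>N M h \<noteq> \<infinity>"
    "\<And>x. x \<in> space M \<Longrightarrow> 0 < h x \<and> h x < \<infinity>"
    using Ex_finite_integrable_function by auto
  define N where "N = density M h"
  have N_fin: "emeasure N A \<noteq> \<infinity>" for A
  proof -
    have "emeasure N A \<le> emeasure N (space N)" by (rule emeasure_space)
    also have "\<dots> = integral\<^sup>N M h"
      using h(1) by (simp add: N_def emeasure_density cong: nn_integral_cong)
    finally show ?thesis using h(2) by (auto simp: top_unique)
  qed
  have N_pos: "0 < emeasure N A" if "A \<in> sets M" "0 < emeasure M A" for A
  proof (rule ccontr)
    assume "\<not> 0 < emeasure N A"
    then have "A \<in> null_sets N" using that by (auto simp: N_def)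
    then have "AE x in M. x \<in> A \<longrightarrow> h x = 0"
      unfolding N_def null_sets_density_iff[OF h(1)] by simp
    then have "AE x in M. x \<notin> A" using AE_space by eventually_elim (use h(3) in force)
    then have "A \<in> null_sets M" using that(1) by (simp add: AE_iff_null_sets)
    with that(2) show False by auto
  qed
  define s where "s = (SUP B\<in>Collect P. emeasure N B)"
  obtain f :: "nat \<Rightarrow> ennreal" where f: "range f \<subseteq> emeasure N ` Collect P" "s = (SUP i. f i)"
    using ennreal_SUP_countable_SUP[of "Collect P" "emeasure N"] empty unfolding s_def by auto
  then have "\<exists>B. P B \<and> f i = emeasure N B" for i by blast
  then obtain B where B: "\<And>i. P (B i)" "\<And>i. f i = emeasure N (B i)" by metis
  define U where "U = (\<Union>i. B i)"
  have U: "P U" unfolding U_def by (rule UN[OF B(1)])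
  have U_sets: "U \<in> sets M" using sets[OF U] .
  have "s \<le> emeasure N U"
    unfolding f(2) using B U_sets
    by (intro SUP_least) (auto intro!: emeasure_mono simp: U_def N_def)
  have "emeasure M (space M - U) = 0"
  proof (rule ccontr)
    assume "emeasure M (space M - U) \<noteq> 0"
    then obtain C where C: "P C" "0 < emeasure M ((space M - U) \<inter> C)"
      using meets[of "space M - U"] U_sets by (auto simp: zero_less_iff_neq_zero)
    \<comment> \<open>Closure is assumed for sequences of sets, so the union of two sets is written
      as the union of a sequence.\<close>
    define D where "D i = (if i = 0 then U else C)" for i :: nat
    have "P (\<Union>i. D i)" by (rule UN) (simp add: D_def U C(1))
    moreover have "(\<Union>i. D i) = U \<union> C" by (auto simp: D_def split: if_splits)
    ultimately have UC: "P (U \<union> C)" by simp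
    have CU: "C - U \<in> sets M" "0 < emeasure M (C - U)"
    proof -
      have "(space M - U) \<inter> C = C - U" using sets.sets_into_space[OF sets[OF C(1)]] by blast
      then show "C - U \<in> sets M" "0 < emeasure M (C - U)"
        using C sets[OF C(1)] U_sets by auto
    qed
    have "emeasure N U < emeasure N U + emeasure N (C - U)"
      using ennreal_add_left_cancel_less[of "emeasure N U" 0] N_fin N_pos[OF CU] by simp
    also have "\<dots> = emeasure N (U \<union> C)"
      using plus_emeasure[of U N "C - U"] U_sets CU(1) by (simp add: N_def)
    also have "\<dots> \<le> s" unfolding s_def using UC by (intro SUP_upper) simp
    finally show False using \<open>s \<le> emeasure N U\<close> by simp
  qed
  then have "AE \<omega> in M. \<omega> \<in> U"
    using U_sets by (intro AE_I[of _ _ "space M - U"]) auto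
  then show thesis using that U by blast
qed

text \<open>All open sets are preimages, so covers and separations can be transported to the image
  and back. The Hausdorff property could not be transported, as \<open>f\<close> may identify
  points; below it identifies functions that agree almost everywhere.\<close>

lemma pullback_topology_compact_regular:
  fixes T :: "'b topology" and f :: "'b \<Rightarrow> 'c::topological_space"
  assumes "T = pullback_topology K f euclidean" and "compact (f ` K)"
    and "regular_space (euclidean :: 'c topology)"
  shows "compact_space T" "regular_space T"
proof -
  have op: "openin T S \<longleftrightarrow> (\<exists>U :: 'c set. open U \<and> S = f -` U \<inter> K)" for S
    by (simp add: assms(1) openin_pullback_topology)
  have sp: "topspace T = K" by (simp add: assms(1) topspace_pullback_topology)
  show "compact_space T"
    unfolding compact_space_def compactin_def sp
  proof (intro conjI allI impI)
    fix \<U> assume U: "Ball \<U> (openin T) \<and> K \<subseteq> \<Union>\<U>"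
    have "\<exists>U :: 'c set. open U \<and> S = f -` U \<inter> K" if "S \<in> \<U>" for S
      using conjunct1[OF U, rule_format, OF that] op by simp
    then obtain G :: "'b set \<Rightarrow> 'c set" where G: "\<And>S. S \<in> \<U> \<Longrightarrow> open (G S)" "\<And>S. S \<in> \<U> \<Longrightarrow> S = f -` G S \<inter> K"
      by metis
    have cover: "f ` K \<subseteq> (\<Union>S\<in>\<U>. G S)"
    proof
      fix y assume "y \<in> f ` K"
      then obtain x where x: "x \<in> K" "y = f x" by blast
      then obtain S where S: "S \<in> \<U>" "x \<in> S" using U by blast
      then have "f x \<in> G S" using G(2)[OF S(1)] by auto
      then show "y \<in> (\<Union>S\<in>\<U>. G S)" using S(1) x(2) by blast
    qed
    obtain F where F: "F \<subseteq> \<U>" "finite F" "f ` K \<subseteq> (\<Union>S\<in>F. G S)"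
      by (rule compactE_image[OF assms(2) G(1) cover])
    have "K \<subseteq> \<Union>F"
    proof
      fix x assume x: "x \<in> K"
      then obtain S where S: "S \<in> F" "f x \<in> G S" using F(3) by blast
      have "x \<in> f -` G S \<inter> K" using x S(2) by simp
      then have "x \<in> S" using G(2)[of S] F(1) S(1) by blast
      then show "x \<in> \<Union>F" using S(1) by blast
    qed
    then show "\<exists>\<F>. finite \<F> \<and> \<F> \<subseteq> \<U> \<and> K \<subseteq> \<Union>\<F>" using F by blast
  qed simp
  show "regular_space T"
    unfolding regular_space_def
  proof (intro allI impI, elim conjE)
    fix C a assume C: "closedin T C" and a: "a \<in> topspace T - C"
    obtain U where U: "open U" "K - C = f -` U \<inter> K"
      using C op sp by (auto simp: closedin_def)
    have "closedin euclidean (- U) \<and> f a \<in> topspace euclidean - (- U)"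
      using a U sp by (auto simp: closed_Compl)
    then obtain V W where V: "open V" "open W" "f a \<in> V" "- U \<subseteq> W" "disjnt V W"
      using assms(3)[unfolded regular_space_def, rule_format, of "- U" "f a"]
      by (auto simp flip: open_openin)
    have CK: "C \<subseteq> K" using closedin_subset[OF C] sp by simp
    show "\<exists>U V. openin T U \<and> openin T V \<and> a \<in> U \<and> C \<subseteq> V \<and> disjnt U V"
    proof (intro exI conjI)
      show "openin T (f -` V \<inter> K)" "openin T (f -` W \<inter> K)" using V op by blast+
      show "a \<in> f -` V \<inter> K" using a V sp by auto
      show "C \<subseteq> f -` W \<inter> K" using CK U(2) V(4) by blast
      show "disjnt (f -` V \<inter> K) (f -` W \<inter> K)" using V(5) by (auto simp: disjnt_def)
    qed
  qed
qed

lemma regular_space_euclidean_fun: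
  "regular_space (euclidean :: ('i \<Rightarrow> 'c::metric_space) topology)"
  using regular_space_product_topology[of "\<lambda>_. euclidean :: 'c topology" "UNIV :: 'i set"]
  by (simp add: euclidean_product_topology regular_space_euclidean)

lemma compact_PiE_UNIV:
  fixes S :: "'i \<Rightarrow> 'c::topological_space set"
  assumes "\<And>i. compact (S i)"
  shows "compact (PiE UNIV S)"
proof -
  have "compactin (product_topology (\<lambda>i. euclidean) UNIV) (PiE UNIV S)"
    using compactin_PiE[of "\<lambda>_. euclidean" UNIV S] assms by simp
  then show ?thesis by (simp add: euclidean_product_topology)
qed

text \<open>The axioms are properties that a concavification takes over from its lattice. The
  everywhere positive element expresses full support and is the reference function for
  densities.\<close>

locale order_continuous_lattice =
  fixes M :: "'a measure" and V :: "'a function_space"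
  assumes sigma_finite: "sigma_finite_measure M"
    and normed: "normed_function_space M V"
    and ideal: "\<And>f g. f \<in> borel_measurable M \<Longrightarrow> g \<in> elems V \<Longrightarrow>
      (AE \<omega> in M. \<bar>f \<omega>\<bar> \<le> \<bar>g \<omega>\<bar>) \<Longrightarrow> f \<in> elems V \<and> fnorm V f \<le> fnorm V g"
    and oc: "order_continuous M V"
    and unit: "\<exists>g\<in>elems V. \<forall>\<omega>\<in>space M. 0 < g \<omega>"
begin

abbreviation "E \<equiv> elems V"
abbreviation "N \<equiv> fnorm V"

lemma E_measurable [measurable_dest]: "f \<in> E \<Longrightarrow> f \<in> borel_measurable M"
  using normed by (auto simp: normed_function_space_def)

lemma E_zero: "(\<lambda>_. 0) \<in> E"
  and E_add: "f \<in> E \<Longrightarrow> g \<in> E \<Longrightarrow> (\<lambda>\<omega>. f \<omega> + g \<omega>) \<in> E"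
  and N_triangle: "f \<in> E \<Longrightarrow> g \<in> E \<Longrightarrow> N (\<lambda>\<omega>. f \<omega> + g \<omega>) \<le> N f + N g"
  and E_scale: "f \<in> E \<Longrightarrow> (\<lambda>\<omega>. c * f \<omega>) \<in> E"
  and N_scale: "f \<in> E \<Longrightarrow> N (\<lambda>\<omega>. c * f \<omega>) = \<bar>c\<bar> * N f"
  and N_nonneg: "f \<in> E \<Longrightarrow> 0 \<le> N f"
  and N_eq_0: "f \<in> E \<Longrightarrow> N f = 0 \<longleftrightarrow> (AE \<omega> in M. f \<omega> = 0)"
  using normed by (auto simp: normed_function_space_def)

lemma E_subspace: "function_subspace E"
  unfolding function_subspace_def using E_zero E_add E_scale by blast

lemmas E_diff = function_subspaceD(5)[OF E_subspace]

lemma E_ideal: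
  assumes "f \<in> borel_measurable M" "g \<in> E" "AE \<omega> in M. \<bar>f \<omega>\<bar> \<le> \<bar>g \<omega>\<bar>"
  shows "f \<in> E" "N f \<le> N g"
  using ideal[OF assms] by auto

lemma E_abs: "f \<in> E \<Longrightarrow> (\<lambda>\<omega>. \<bar>f \<omega>\<bar>) \<in> E" "f \<in> E \<Longrightarrow> N (\<lambda>\<omega>. \<bar>f \<omega>\<bar>) \<le> N f"
  using E_ideal[of "\<lambda>\<omega>. \<bar>f \<omega>\<bar>" f] by auto

text \<open>A linear functional lies below \<open>\<rho>\<close> exactly when it is positive and
  bounded by the norm. A single sublinear bound thus describes the positive part of the dual
  ball.\<close>

definition "\<rho> f = N (\<lambda>\<omega>. max 0 (f \<omega>))"

lemma E_pos_part:
  assumes "f \<in> E"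
  shows "(\<lambda>\<omega>. max 0 (f \<omega>)) \<in> E" "\<rho> f \<le> N f"
  unfolding \<rho>_def using E_ideal[OF _ assms, of "\<lambda>\<omega>. max 0 (f \<omega>)"] assms by auto

lemma \<rho>_sublinear: "sublinear_on E \<rho>"
  unfolding sublinear_on_def
proof (intro conjI ballI allI impI)
  fix f assume f: "f \<in> E"
  show "\<rho> (\<lambda>x. c * f x) = c * \<rho> f" if "0 \<le> c" for c
  proof -
    have "(\<lambda>\<omega>. max 0 (c * f \<omega>)) = (\<lambda>\<omega>. c * max 0 (f \<omega>))"
      using that by (auto simp: max_def mult_le_0_iff zero_le_mult_iff intro!: ext)
    then show ?thesis
      unfolding \<rho>_def using N_scale[OF E_pos_part(1)[OF f], of c] that by simp
  qed
  fix g assume g: "g \<in> E"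
  have "\<rho> (\<lambda>x. f x + g x) \<le> N (\<lambda>\<omega>. max 0 (f \<omega>) + max 0 (g \<omega>))"
    unfolding \<rho>_def using f g
    by (intro E_ideal(2) E_add E_pos_part(1) AE_I2) (auto simp: max_def)
  also have "\<dots> \<le> \<rho> f + \<rho> g"
    unfolding \<rho>_def by (intro N_triangle E_pos_part f g)
  finally show "\<rho> (\<lambda>x. f x + g x) \<le> \<rho> f + \<rho> g" .
qed

section \<open>The positive ball and its pairings\<close>

abbreviation "\<K> \<equiv> topspace (koethe_pos_ball M V)"

lemma topspace_koethe_weak: "topspace (koethe_weak_topology M V) = elems (koethe_dual M V)"
  unfolding koethe_weak_topology_def topology_generated_by_topspace
  using E_zero by (auto intro!: exI[of _ UNIV])

text \<open>The dual norm is a supremum of reals and means something only for a bounded family; the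
  constant \<open>C\<close> in the definition of the dual provides the bound. Rescaling to norm 1
  then gives the homogeneous form, and functions of norm 0 pair to 0 because they vanish almost
  everywhere.\<close>

lemma \<K>_iff:
  "h \<in> \<K> \<longleftrightarrow> h \<in> borel_measurable M \<and> (AE \<omega> in M. 0 \<le> h \<omega>) \<and>
     (\<forall>f\<in>E. integrable M (\<lambda>\<omega>. f \<omega> * h \<omega>) \<and> \<bar>\<integral>\<omega>. f \<omega> * h \<omega> \<partial>M\<bar> \<le> N f)" (is "_ \<longleftrightarrow> ?R")
proof -
  let ?I = "\<lambda>f. \<integral>\<omega>. f \<omega> * h \<omega> \<partial>M"
  let ?B = "{f \<in> E. N f \<le> 1}"
  have K: "h \<in> \<K> \<longleftrightarrow> h \<in> elems (koethe_dual M V) \<and> (AE \<omega> in M. 0 \<le> h \<omega>) \<and> fnorm (koethe_dual M V) h \<le> 1"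
    unfolding koethe_pos_ball_def topspace_subtopology topspace_koethe_weak by blast
  have norm: "fnorm (koethe_dual M V) h = (SUP f\<in>?B. \<bar>?I f\<bar>)" by (simp add: koethe_dual_def)
  have zero: "(\<lambda>_. 0) \<in> ?B" using E_zero N_eq_0[OF E_zero] by simp
  show ?thesis
  proof
    assume h: "h \<in> \<K>"
    then have hm: "h \<in> borel_measurable M" "AE \<omega> in M. 0 \<le> h \<omega>"
      and int: "\<And>f. f \<in> E \<Longrightarrow> integrable M (\<lambda>\<omega>. f \<omega> * h \<omega>)"
      and le1: "(SUP f\<in>?B. \<bar>?I f\<bar>) \<le> 1"
      unfolding K norm by (auto simp: koethe_dual_def)
    from h obtain C where C: "\<And>f. f \<in> E \<Longrightarrow> \<bar>?I f\<bar> \<le> C * N f"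
      unfolding K by (auto simp: koethe_dual_def)
    have bdd: "bdd_above ((\<lambda>f. \<bar>?I f\<bar>) ` ?B)"
    proof (rule bdd_aboveI2)
      fix f assume f: "f \<in> ?B"
      have "\<bar>?I f\<bar> \<le> C * N f" using C f by simp
      also have "\<dots> \<le> \<bar>C\<bar> * N f" using f N_nonneg[of f] by (intro mult_right_mono) auto
      also have "\<dots> \<le> \<bar>C\<bar>" using f N_nonneg[of f] by (intro mult_left_le) auto
      finally show "\<bar>?I f\<bar> \<le> \<bar>C\<bar>" .
    qed
    have unit_ball: "\<bar>?I f\<bar> \<le> 1" if "f \<in> ?B" for f
      by (rule order_trans[OF cSUP_upper[OF that bdd] le1])
    have "\<bar>?I f\<bar> \<le> N f" if f: "f \<in> E" for f
    proof (cases "N f = 0")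
      case True
      then have "AE \<omega> in M. f \<omega> = 0" using N_eq_0[OF f] by simp
      then have "?I f = ?I (\<lambda>_. 0)" using E_measurable[OF f] hm(1)
        by (intro integral_cong_AE) auto
      then show ?thesis using True by simp
    next
      case False
      then have pos: "0 < N f" using N_nonneg[OF f] by simp
      then have "(\<lambda>\<omega>. 1 / N f * f \<omega>) \<in> ?B"
        using f N_scale[OF f, of "1 / N f"] E_scale[OF f, of "1 / N f"] by simp
      from unit_ball[OF this] have "\<bar>1 / N f * ?I f\<bar> \<le> 1" using int[OF f] by (simp add: mult.assoc)
      then show ?thesis using pos by (simp add: abs_mult divide_simps)
    qed
    then show ?R using hm int by blast
  next
    assume R: ?R
    then have "(SUP f\<in>?B. \<bar>?I f\<bar>) \<le> 1" using zero by (intro cSUP_least) force+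
    moreover have "h \<in> elems (koethe_dual M V)"
      using R by (auto simp: koethe_dual_def intro!: exI[of _ 1])
    ultimately show "h \<in> \<K>" unfolding K norm using R by blast
  qed
qed

lemma \<K>_measurable [measurable_dest]: "h \<in> \<K> \<Longrightarrow> h \<in> borel_measurable M"
  and \<K>_nonneg: "h \<in> \<K> \<Longrightarrow> AE \<omega> in M. 0 \<le> h \<omega>"
  and \<K>_integrable: "h \<in> \<K> \<Longrightarrow> f \<in> E \<Longrightarrow> integrable M (\<lambda>\<omega>. f \<omega> * h \<omega>)"
  and \<K>_le_N: "h \<in> \<K> \<Longrightarrow> f \<in> E \<Longrightarrow> \<bar>\<integral>\<omega>. f \<omega> * h \<omega> \<partial>M\<bar> \<le> N f"
  using \<K>_iff by auto

lemma \<K>_le_\<rho>: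
  assumes "h \<in> \<K>" "f \<in> E"
  shows "(\<integral>\<omega>. f \<omega> * h \<omega> \<partial>M) \<le> \<rho> f"
proof -
  have "(\<integral>\<omega>. f \<omega> * h \<omega> \<partial>M) \<le> (\<integral>\<omega>. max 0 (f \<omega>) * h \<omega> \<partial>M)"
  proof (rule integral_mono_AE)
    show "AE \<omega> in M. f \<omega> * h \<omega> \<le> max 0 (f \<omega>) * h \<omega>"
      using \<K>_nonneg[OF assms(1)] by eventually_elim (auto intro: mult_right_mono)
  qed (intro \<K>_integrable assms E_pos_part)+
  also have "\<dots> \<le> \<rho> f"
    unfolding \<rho>_def using \<K>_le_N[OF assms(1) E_pos_part(1)[OF assms(2)]] by simp
  finally show ?thesis .
qed

lemma nn_integral_\<K>:
  assumes "h \<in> \<K>" "f \<in> E" "\<And>\<omega>. \<omega> \<in> space M \<Longrightarrow> 0 \<le> f \<omega>"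
  shows "(\<integral>\<^sup>+\<omega>. ennreal (f \<omega> * h \<omega>) \<partial>M) = ennreal (\<integral>\<omega>. f \<omega> * h \<omega> \<partial>M)"
    and "0 \<le> (\<integral>\<omega>. f \<omega> * h \<omega> \<partial>M)"
proof -
  have "AE \<omega> in M. 0 \<le> f \<omega> * h \<omega>"
    using \<K>_nonneg[OF assms(1)] AE_space by eventually_elim (simp add: assms(3))
  then show "(\<integral>\<^sup>+\<omega>. ennreal (f \<omega> * h \<omega>) \<partial>M) = ennreal (\<integral>\<omega>. f \<omega> * h \<omega> \<partial>M)"
    "0 \<le> (\<integral>\<omega>. f \<omega> * h \<omega> \<partial>M)"
    by (auto intro!: nn_integral_eq_integral \<K>_integrable integral_nonneg_AE assms)
qed

lemma \<K>I_nn_integral: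
  assumes h: "h \<in> borel_measurable M" "\<And>\<omega>. 0 \<le> h \<omega>"
    and le: "\<And>f. f \<in> E \<Longrightarrow> (\<integral>\<^sup>+\<omega>. ennreal (\<bar>f \<omega>\<bar> * h \<omega>) \<partial>M) \<le> ennreal (N f)"
  shows "h \<in> \<K>"
  unfolding \<K>_iff
proof (intro conjI ballI)
  fix f assume f: "f \<in> E"
  have abs: "\<bar>f \<omega> * h \<omega>\<bar> = \<bar>f \<omega>\<bar> * h \<omega>" for \<omega> using h(2) by (simp add: abs_mult)
  have fin: "(\<integral>\<^sup>+\<omega>. ennreal (norm (f \<omega> * h \<omega>)) \<partial>M) \<le> ennreal (N f)"
    using le[OF f] by (simp add: abs)
  then show int: "integrable M (\<lambda>\<omega>. f \<omega> * h \<omega>)"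
    using h(1) E_measurable[OF f] by (intro integrableI_bounded) (auto intro: le_less_trans)
  have "ennreal \<bar>\<integral>\<omega>. f \<omega> * h \<omega> \<partial>M\<bar> \<le> ennreal (N f)"
    using order_trans[OF integral_norm_bound_ennreal[OF int] fin] by simp
  then show "\<bar>\<integral>\<omega>. f \<omega> * h \<omega> \<partial>M\<bar> \<le> N f" using N_nonneg[OF f] by simp
qed (use h in auto)

lemma continuous_map_pairing:
  assumes "f \<in> E"
  shows "continuous_map (koethe_pos_ball M V) euclideanreal (\<lambda>h. \<integral>\<omega>. f \<omega> * h \<omega> \<partial>M)"
  unfolding koethe_pos_ball_def
proof (rule continuous_map_from_subtopology)
  show "continuous_map (koethe_weak_topology M V) euclideanreal (\<lambda>h. \<integral>\<omega>. f \<omega> * h \<omega> \<partial>M)"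
    unfolding continuous_map topspace_koethe_weak
  proof (intro conjI allI impI)
    fix U :: "real set" assume "openin euclideanreal U"
    then have "open U" by simp
    then show "openin (koethe_weak_topology M V)
        {h \<in> elems (koethe_dual M V). (\<integral>\<omega>. f \<omega> * h \<omega> \<partial>M) \<in> U}"
      unfolding koethe_weak_topology_def using assms
      by (intro topology_generated_by_Basis CollectI exI[of _ f] exI[of _ U] conjI refl)
  qed simp
qed

text \<open>If \<open>f\<close> is nonnegative, the positive part of \<open>- f\<close> is null, so
  the functional is at most 0 at \<open>- f\<close>. The norm bound comes from testing both
  \<open>f\<close> and \<open>- f\<close>.\<close>

lemma positive_functional:
  assumes \<phi>: "linear_functional_on E \<phi>" "\<forall>f\<in>E. \<phi> f \<le> \<rho> f"
  shows "\<And>f. f \<in> E \<Longrightarrow> AE \<omega> in M. 0 \<le> f \<omega> \<Longrightarrow> 0 \<le> \<phi> f"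
    and "\<And>f. f \<in> E \<Longrightarrow> \<bar>\<phi> f\<bar> \<le> N f"
    and "\<And>f. f \<in> E \<Longrightarrow> AE \<omega> in M. f \<omega> = 0 \<Longrightarrow> \<phi> f = 0"
proof -
  note lin = linear_functional_onD[OF \<phi>(1)]
  have neg: "(\<lambda>\<omega>. - f \<omega>) \<in> E" if "f \<in> E" for f using function_subspaceD(4)[OF E_subspace that] .
  show "0 \<le> \<phi> f" if f: "f \<in> E" "AE \<omega> in M. 0 \<le> f \<omega>" for f
  proof -
    have "AE \<omega> in M. max 0 (- f \<omega>) = 0" using f(2) by eventually_elim simp
    then have "\<rho> (\<lambda>\<omega>. - f \<omega>) = 0"
      unfolding \<rho>_def using N_eq_0[OF E_pos_part(1)[OF neg[OF f(1)]]] by simp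
    then show ?thesis using \<phi>(2)[rule_format, OF neg[OF f(1)]] lin(3)[OF f(1)] by simp
  qed
  show le: "\<bar>\<phi> f\<bar> \<le> N f" if f: "f \<in> E" for f
  proof -
    have "\<phi> (\<lambda>\<omega>. - f \<omega>) \<le> N (\<lambda>\<omega>. - f \<omega>)"
      using \<phi>(2)[rule_format, OF neg[OF f]] E_pos_part(2)[OF neg[OF f]] by simp
    also have "\<dots> = N f" using N_scale[OF f, of "-1"] by simp
    finally show ?thesis using lin(3)[OF f] \<phi>(2)[rule_format, OF f] E_pos_part(2)[OF f] by simp
  qed
  show "\<phi> f = 0" if "f \<in> E" "AE \<omega> in M. f \<omega> = 0" for f
    using le[OF that(1)] N_eq_0[OF that(1)] that(2) by simp
qed

section \<open>Integral representation of dominated functionals\<close>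

lemma order_continuousD:
  fixes u :: "nat \<Rightarrow> 'a \<Rightarrow> real"
  assumes "\<And>n. u n \<in> E" "\<And>n \<omega>. \<omega> \<in> space M \<Longrightarrow> u (Suc n) \<omega> \<le> u n \<omega>"
    and "\<And>\<omega>. \<omega> \<in> space M \<Longrightarrow> (\<lambda>n. u n \<omega>) \<longlonglongrightarrow> 0"
  shows "(\<lambda>n. N (u n)) \<longlonglongrightarrow> 0"
  using oc assms unfolding order_continuous_def by (auto intro!: AE_I2)

text \<open>Radon-Nikodym with the strictly positive \<open>g\<close> as reference: applying
  \<open>\<phi>\<close> to \<open>g\<close> times the indicator of a set defines a finite measure,
  countably additive by order continuity. Its density divided by \<open>g\<close> is the
  representing function.\<close>

theorem representation:
  assumes \<phi>: "linear_functional_on E \<phi>" "\<forall>f\<in>E. \<phi> f \<le> \<rho> f"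
  obtains h where "h \<in> \<K>" "\<And>f. f \<in> E \<Longrightarrow> (\<integral>\<omega>. f \<omega> * h \<omega> \<partial>M) = \<phi> f"
proof -
  note lin = linear_functional_onD[OF \<phi>(1)]
  note pos = positive_functional[OF \<phi>]
  obtain g where g: "g \<in> E" "\<And>\<omega>. \<omega> \<in> space M \<Longrightarrow> 0 < g \<omega>" using unit by blast
  note [measurable] = E_measurable[OF g(1)]
  have g_ind: "(\<lambda>\<omega>. g \<omega> * indicator A \<omega>) \<in> E" if "A \<in> sets M" for A
    using that by (intro E_ideal(1)[OF _ g(1)]) (auto simp: indicator_def)
  have \<phi>_ind_nonneg: "0 \<le> \<phi> (\<lambda>\<omega>. g \<omega> * indicator A \<omega>)" if "A \<in> sets M" for A
    using g by (intro pos(1) g_ind that AE_I2) (auto simp: indicator_def less_imp_le)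
  define \<kappa> where "\<kappa> A = ennreal (\<phi> (\<lambda>\<omega>. g \<omega> * indicator A \<omega>))" for A
  define Q where "Q = measure_of (space M) (sets M) \<kappa>"
  have \<kappa>_positive: "positive (sets M) \<kappa>"
    using lin(4)[OF g(1)] by (simp add: positive_def \<kappa>_def)
  \<comment> \<open>For a finite additive set function continuity at the empty set suffices. If the
    sets decrease to the empty set, their indicators times \<open>g\<close> decrease to 0 pointwise,
    and order continuity applies.\<close>
  have "countably_additive (sets M) \<kappa>"
  proof (rule sets.empty_continuous_imp_countably_additive[OF \<kappa>_positive])
    show "additive (sets M) \<kappa>"
      unfolding additive_def
    proof (intro ballI impI)
      fix A B assume AB: "A \<in> sets M" "B \<in> sets M" "A \<inter> B = {}"
      have "(\<lambda>\<omega>. g \<omega> * indicator (A \<union> B) \<omega>) = (\<lambda>\<omega>. g \<omega> * indicator A \<omega> + g \<omega> * indicator B \<omega>)"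
        using AB(3) by (auto simp: indicator_def fun_eq_iff)
      then show "\<kappa> (A \<union> B) = \<kappa> A + \<kappa> B"
        unfolding \<kappa>_def using lin(1)[OF g_ind[OF AB(1)] g_ind[OF AB(2)]] AB \<phi>_ind_nonneg
        by simp
    qed
    show "\<forall>A\<in>sets M. \<kappa> A \<noteq> \<infinity>" by (simp add: \<kappa>_def)
    fix A :: "nat \<Rightarrow> 'a set"
    assume A: "range A \<subseteq> sets M" "decseq A" "(\<Inter>i. A i) = {}"
    have "(\<lambda>n. N (\<lambda>\<omega>. g \<omega> * indicator (A n) \<omega>)) \<longlonglongrightarrow> 0"
    proof (rule order_continuousD)
      show "(\<lambda>\<omega>. g \<omega> * indicator (A n) \<omega>) \<in> E" for n using A by (intro g_ind) auto
      fix \<omega> assume \<omega>: "\<omega> \<in> space M"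
      show "g \<omega> * indicator (A (Suc n)) \<omega> \<le> g \<omega> * indicator (A n) \<omega>" for n
        using decseq_SucD[OF A(2), of n] g(2)[OF \<omega>] by (auto simp: indicator_def)
      obtain n where n: "\<omega> \<notin> A n" using A(3) by blast
      have "\<forall>\<^sub>F i in sequentially. g \<omega> * indicator (A i) \<omega> = 0"
        using eventually_ge_at_top[of n]
      proof eventually_elim
        case (elim i)
        then have "A i \<subseteq> A n" using A(2) by (simp add: decseq_def)
        then show ?case using n by (auto simp: indicator_def)
      qed
      then show "(\<lambda>n. g \<omega> * indicator (A n) \<omega>) \<longlonglongrightarrow> 0" by (rule tendsto_eventually)
    qed
    then have "(\<lambda>n. \<phi> (\<lambda>\<omega>. g \<omega> * indicator (A n) \<omega>)) \<longlonglongrightarrow> 0"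
      by (rule Lim_null_comparison[rotated]) (use A pos(2) g_ind in auto)
    then have "(\<lambda>n. ennreal (\<phi> (\<lambda>\<omega>. g \<omega> * indicator (A n) \<omega>))) \<longlonglongrightarrow> ennreal 0"
      by (rule tendsto_ennrealI)
    then show "(\<lambda>n. \<kappa> (A n)) \<longlonglongrightarrow> 0" by (simp add: \<kappa>_def)
  qed
  then have emeasure_Q: "emeasure Q A = \<kappa> A" if "A \<in> sets M" for A
    using \<kappa>_positive that sets.space_closed
    by (intro emeasure_measure_of[OF Q_def]) (auto simp: Q_def)
  have sets_Q [measurable_cong]: "sets Q = sets M" by (simp add: Q_def)
  have space_Q: "space Q = space M" by (simp add: Q_def)
  have "absolutely_continuous M Q"
    unfolding absolutely_continuous_def
  proof
    fix A assume A: "A \<in> null_sets M"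
    then have "AE \<omega> in M. g \<omega> * indicator A \<omega> = 0"
      using AE_not_in[OF A] by (auto elim!: eventually_mono simp: indicator_def)
    then have "\<phi> (\<lambda>\<omega>. g \<omega> * indicator A \<omega>) = 0" using A by (intro pos(3) g_ind) auto
    then show "A \<in> null_sets Q" using A by (intro null_setsI) (auto simp: emeasure_Q \<kappa>_def sets_Q)
  qed
  then obtain k where k [measurable]: "k \<in> borel_measurable M" and Q_density: "density M k = Q"
    using sigma_finite_measure.Radon_Nikodym[OF sigma_finite _ sets_Q] by blast
  \<comment> \<open>Finite total mass makes the density finite almost everywhere, so the passage to
    real values in \<open>h\<close> alters it on a null set only.\<close>
  have "emeasure Q (space M) \<noteq> \<infinity>" by (simp add: emeasure_Q \<kappa>_def)
  then have "(\<integral>\<^sup>+\<omega>. k \<omega> \<partial>M) \<noteq> \<infinity>"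
    unfolding Q_density[symmetric] by (simp add: emeasure_density cong: nn_integral_cong)
  then have k_fin: "AE \<omega> in M. k \<omega> \<noteq> \<infinity>" by (intro nn_integral_noteq_infinite) auto
  \<comment> \<open>The indicator makes \<open>h\<close> nonnegative at every point:
    \<open>g\<close> is known to be positive on \<open>space M\<close> only.\<close>
  define h where "h \<omega> = enn2real (k \<omega>) / g \<omega> * indicator (space M) \<omega>" for \<omega>
  have h_nonneg: "0 \<le> h \<omega>" for \<omega>
    using g(2) by (auto simp: h_def indicator_def less_imp_le)
  have h [measurable]: "h \<in> borel_measurable M" unfolding h_def by measurable
  \<comment> \<open>The induction runs over all nonnegative measurable \<open>u\<close>, for which
    \<open>g * u\<close> need not lie in the lattice; hence the implication. The ideal property
    hands membership down to the smaller functions in each step.\<close>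
  have \<phi>_Q: "(\<lambda>\<omega>. g \<omega> * u \<omega>) \<in> E \<longrightarrow> ennreal (\<phi> (\<lambda>\<omega>. g \<omega> * u \<omega>)) = (\<integral>\<^sup>+\<omega>. ennreal (u \<omega>) \<partial>Q)"
    if "u \<in> borel_measurable M" "\<And>\<omega>. 0 \<le> u \<omega>" for u :: "'a \<Rightarrow> real"
    using that
  proof (induction u rule: borel_measurable_induct_real)
    case (set A)
    then show ?case by (simp add: ennreal_indicator emeasure_Q \<kappa>_def sets_Q)
  next
    case (mult u c)
    show ?case
    proof (cases "c = 0")
      case True
      then show ?thesis using lin(4)[OF g(1)] by simp
    next
      case False
      with mult have c: "0 < c" by simp
      show ?thesis
      proof
        assume cu: "(\<lambda>\<omega>. g \<omega> * (c * u \<omega>)) \<in> E"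
        have gu: "(\<lambda>\<omega>. g \<omega> * u \<omega>) \<in> E"
          using E_scale[OF cu, of "1 / c"] c by (simp add: field_simps)
        have "\<phi> (\<lambda>\<omega>. g \<omega> * (c * u \<omega>)) = c * \<phi> (\<lambda>\<omega>. g \<omega> * u \<omega>)"
          using lin(2)[OF gu, of c] by (simp add: mult.left_commute)
        then show "ennreal (\<phi> (\<lambda>\<omega>. g \<omega> * (c * u \<omega>))) = (\<integral>\<^sup>+\<omega>. ennreal (c * u \<omega>) \<partial>Q)"
          using mult c gu by (simp add: ennreal_mult' nn_integral_cmult)
      qed
    qed
  next
    case (add u v)
    show ?case
    proof
      assume uv: "(\<lambda>\<omega>. g \<omega> * (v \<omega> + u \<omega>)) \<in> E"
      have "(\<lambda>\<omega>. g \<omega> * w \<omega>) \<in> E"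
        if w: "w \<in> borel_measurable M" "\<And>\<omega>. \<bar>w \<omega>\<bar> \<le> \<bar>v \<omega> + u \<omega>\<bar>" for w
        using w by (intro E_ideal(1)[OF _ uv] AE_I2) (auto simp: abs_mult intro!: mult_left_mono)
      from this[of v] this[of u] have "(\<lambda>\<omega>. g \<omega> * v \<omega>) \<in> E" "(\<lambda>\<omega>. g \<omega> * u \<omega>) \<in> E"
        using add by simp_all
      moreover have "(\<lambda>\<omega>. g \<omega> * (v \<omega> + u \<omega>)) = (\<lambda>\<omega>. g \<omega> * v \<omega> + g \<omega> * u \<omega>)"
        by (simp add: algebra_simps)
      moreover have "0 \<le> \<phi> (\<lambda>\<omega>. g \<omega> * v \<omega>)" "0 \<le> \<phi> (\<lambda>\<omega>. g \<omega> * u \<omega>)"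
        using calculation add g by (auto intro!: pos(1) AE_I2 simp: less_imp_le)
      ultimately show "ennreal (\<phi> (\<lambda>\<omega>. g \<omega> * (v \<omega> + u \<omega>))) = (\<integral>\<^sup>+\<omega>. ennreal (v \<omega> + u \<omega>) \<partial>Q)"
        using add lin(1) by (simp add: nn_integral_add ennreal_plus)
    qed
  next
    case (seq U)
    show ?case
    proof
      assume u: "(\<lambda>\<omega>. g \<omega> * u \<omega>) \<in> E"
      have U_le: "U i \<omega> \<le> u \<omega>" if "\<omega> \<in> space M" for i \<omega>
        using seq(3,4) that by (intro incseq_le) (auto simp: incseq_def le_fun_def)
      have U: "(\<lambda>\<omega>. g \<omega> * U i \<omega>) \<in> E" for i
      proof (rule E_ideal(1)[OF _ u])
        show "AE \<omega> in M. \<bar>g \<omega> * U i \<omega>\<bar> \<le> \<bar>g \<omega> * u \<omega>\<bar>"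
          using U_le seq(2) order_trans[OF seq(2) U_le]
          by (intro AE_I2) (auto simp: abs_mult intro!: mult_left_mono)
      qed (use seq in auto)
      \<comment> \<open>Order continuity makes \<open>\<phi>\<close> continuous along the increasing
        sequence; the integrals over \<open>Q\<close> follow by monotone convergence.\<close>
      have "(\<lambda>n. N (\<lambda>\<omega>. g \<omega> * u \<omega> - g \<omega> * U n \<omega>)) \<longlonglongrightarrow> 0"
      proof (rule order_continuousD)
        show "(\<lambda>\<omega>. g \<omega> * u \<omega> - g \<omega> * U n \<omega>) \<in> E" for n by (rule E_diff[OF u U])
        fix \<omega> assume \<omega>: "\<omega> \<in> space M"
        show "g \<omega> * u \<omega> - g \<omega> * U (Suc n) \<omega> \<le> g \<omega> * u \<omega> - g \<omega> * U n \<omega>" for n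
          using seq(3) g(2)[OF \<omega>] by (simp add: incseq_Suc_iff le_fun_def)
        show "(\<lambda>n. g \<omega> * u \<omega> - g \<omega> * U n \<omega>) \<longlonglongrightarrow> 0"
          using seq(4)[OF \<omega>] by (auto intro!: tendsto_eq_intros)
      qed
      then have "(\<lambda>n. \<phi> (\<lambda>\<omega>. g \<omega> * u \<omega> - g \<omega> * U n \<omega>)) \<longlonglongrightarrow> 0"
        by (rule Lim_null_comparison[rotated]) (use pos(2) E_diff[OF u U] in auto)
      then have "(\<lambda>n. \<phi> (\<lambda>\<omega>. g \<omega> * u \<omega>) - \<phi> (\<lambda>\<omega>. g \<omega> * U n \<omega>)) \<longlonglongrightarrow> 0"
        using linear_functional_on_diff[OF E_subspace \<phi>(1) u U] by simp
      from tendsto_diff[OF tendsto_const[of "\<phi> (\<lambda>\<omega>. g \<omega> * u \<omega>)"] this]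
      have "(\<lambda>n. \<phi> (\<lambda>\<omega>. g \<omega> * U n \<omega>)) \<longlonglongrightarrow> \<phi> (\<lambda>\<omega>. g \<omega> * u \<omega>)" by simp
      then have lim1: "(\<lambda>n. \<integral>\<^sup>+\<omega>. ennreal (U n \<omega>) \<partial>Q) \<longlonglongrightarrow> ennreal (\<phi> (\<lambda>\<omega>. g \<omega> * u \<omega>))"
        using seq(5) U by (auto dest: tendsto_ennrealI)
      have lim2: "(\<lambda>n. \<integral>\<^sup>+\<omega>. ennreal (U n \<omega>) \<partial>Q) \<longlonglongrightarrow> (\<integral>\<^sup>+\<omega>. ennreal (u \<omega>) \<partial>Q)"
      proof -
        have inc: "incseq (\<lambda>n \<omega>. ennreal (U n \<omega>))"
          using seq(3) by (auto simp: incseq_def le_fun_def intro!: ennreal_leI)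
        have sup: "ennreal (u \<omega>) = (SUP n. ennreal (U n \<omega>))" if "\<omega> \<in> space Q" for \<omega>
        proof (rule LIMSEQ_unique)
          show "(\<lambda>n. ennreal (U n \<omega>)) \<longlonglongrightarrow> ennreal (u \<omega>)"
            using that by (intro tendsto_ennrealI seq(4)) (simp add: space_Q)
          show "(\<lambda>n. ennreal (U n \<omega>)) \<longlonglongrightarrow> (SUP n. ennreal (U n \<omega>))"
            using inc by (intro LIMSEQ_SUP) (auto simp: incseq_def le_fun_def)
        qed
        have "(\<integral>\<^sup>+\<omega>. ennreal (u \<omega>) \<partial>Q) = (\<integral>\<^sup>+\<omega>. (SUP n. ennreal (U n \<omega>)) \<partial>Q)"
          by (rule nn_integral_cong[OF sup])
        also have "\<dots> = (SUP n. \<integral>\<^sup>+\<omega>. ennreal (U n \<omega>) \<partial>Q)"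
          using seq(1) inc by (intro nn_integral_monotone_convergence_SUP) auto
        finally show ?thesis
          using inc by (auto intro!: LIMSEQ_SUP nn_integral_mono simp: incseq_def le_fun_def)
      qed
      show "ennreal (\<phi> (\<lambda>\<omega>. g \<omega> * u \<omega>)) = (\<integral>\<^sup>+\<omega>. ennreal (u \<omega>) \<partial>Q)"
        by (rule LIMSEQ_unique[OF lim1 lim2])
    qed
  qed
  have \<phi>_nn: "ennreal (\<phi> f) = (\<integral>\<^sup>+\<omega>. ennreal (f \<omega> * h \<omega>) \<partial>M)"
    if f: "f \<in> E" "\<And>\<omega>. \<omega> \<in> space M \<Longrightarrow> 0 \<le> f \<omega>" for f
  proof -
    note [measurable] = E_measurable[OF f(1)]
    \<comment> \<open>On the space \<open>g * u\<close> is \<open>f\<close>. Off the space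
      \<open>u\<close> is 0, so it is nonnegative everywhere, as \<open>\<phi>_Q\<close>
      demands.\<close>
    define u where "u \<omega> = f \<omega> / g \<omega> * indicator (space M) \<omega>" for \<omega>
    have "0 \<le> u \<omega>" for \<omega>
      using f(2) g(2) by (auto simp: u_def indicator_def less_imp_le)
    moreover have "u \<in> borel_measurable M" unfolding u_def by measurable
    ultimately have u: "u \<in> borel_measurable M" "\<And>\<omega>. 0 \<le> u \<omega>" by auto
    have gu: "g \<omega> * u \<omega> = f \<omega>" if "\<omega> \<in> space M" for \<omega>
      using that g(2)[OF that] by (simp add: u_def)
    have "(\<lambda>\<omega>. g \<omega> * u \<omega>) \<in> E" "AE \<omega> in M. f \<omega> - g \<omega> * u \<omega> = 0"
      using u(1) gu by (auto intro!: E_ideal(1)[OF _ f(1)] AE_I2)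
    then have "\<phi> f = \<phi> (\<lambda>\<omega>. g \<omega> * u \<omega>)"
      using pos(3)[OF E_diff[OF f(1)]] linear_functional_on_diff[OF E_subspace \<phi>(1) f(1)] by force
    then have "ennreal (\<phi> f) = (\<integral>\<^sup>+\<omega>. ennreal (u \<omega>) \<partial>Q)"
      using \<phi>_Q[OF u] \<open>(\<lambda>\<omega>. g \<omega> * u \<omega>) \<in> E\<close> by simp
    also have "\<dots> = (\<integral>\<^sup>+\<omega>. k \<omega> * ennreal (u \<omega>) \<partial>M)"
      unfolding Q_density[symmetric] using u(1) by (subst nn_integral_density) auto
    also have "\<dots> = (\<integral>\<^sup>+\<omega>. ennreal (f \<omega> * h \<omega>) \<partial>M)"
    proof (rule nn_integral_cong_AE)
      show "AE \<omega> in M. k \<omega> * ennreal (u \<omega>) = ennreal (f \<omega> * h \<omega>)"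
        using k_fin AE_space
      proof eventually_elim
        case (elim \<omega>)
        have "k \<omega> * ennreal (u \<omega>) = ennreal (enn2real (k \<omega>)) * ennreal (u \<omega>)"
          using elim by (simp add: less_top)
        also have "\<dots> = ennreal (enn2real (k \<omega>) * u \<omega>)" by (simp add: ennreal_mult')
        also have "enn2real (k \<omega>) * u \<omega> = f \<omega> * h \<omega>" by (simp add: u_def h_def elim)
        finally show ?case .
      qed
    qed
    finally show ?thesis .
  qed
  have hK: "h \<in> \<K>"
  proof (rule \<K>I_nn_integral[OF h h_nonneg])
    fix f assume f: "f \<in> E"
    have "(\<integral>\<^sup>+\<omega>. ennreal (\<bar>f \<omega>\<bar> * h \<omega>) \<partial>M) = ennreal (\<phi> (\<lambda>\<omega>. \<bar>f \<omega>\<bar>))"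
      using \<phi>_nn[OF E_abs(1)[OF f]] by simp
    also have "\<dots> \<le> ennreal (N f)"
      using pos(2)[OF E_abs(1)[OF f]] E_abs(2)[OF f] by (intro ennreal_leI) simp
    finally show "(\<integral>\<^sup>+\<omega>. ennreal (\<bar>f \<omega>\<bar> * h \<omega>) \<partial>M) \<le> ennreal (N f)" .
  qed
  have \<phi>_pos: "(\<integral>\<omega>. f \<omega> * h \<omega> \<partial>M) = \<phi> f" if f: "f \<in> E" "\<And>\<omega>. \<omega> \<in> space M \<Longrightarrow> 0 \<le> f \<omega>" for f
  proof -
    have "ennreal (\<phi> f) = ennreal (\<integral>\<omega>. f \<omega> * h \<omega> \<partial>M)"
      using \<phi>_nn[OF f] nn_integral_\<K>(1)[OF hK f] by simp
    moreover have "0 \<le> \<phi> f" using f by (intro pos(1) AE_I2)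
    ultimately show ?thesis using nn_integral_\<K>(2)[OF hK f] by simp
  qed
  have "(\<integral>\<omega>. f \<omega> * h \<omega> \<partial>M) = \<phi> f" if f: "f \<in> E" for f
  proof -
    have a: "(\<lambda>\<omega>. max 0 (f \<omega>)) \<in> E" by (rule E_pos_part(1)[OF f])
    have b: "(\<lambda>\<omega>. max 0 (- f \<omega>)) \<in> E"
      by (rule E_pos_part(1)[OF function_subspaceD(4)[OF E_subspace f]])
    have eq: "f = (\<lambda>\<omega>. max 0 (f \<omega>) - max 0 (- f \<omega>))" by (auto simp: max_def)
    have "\<phi> f = \<phi> (\<lambda>\<omega>. max 0 (f \<omega>)) - \<phi> (\<lambda>\<omega>. max 0 (- f \<omega>))"
      by (subst eq) (rule linear_functional_on_diff[OF E_subspace \<phi>(1) a b])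
    also have "\<dots> = (\<integral>\<omega>. max 0 (f \<omega>) * h \<omega> \<partial>M) - (\<integral>\<omega>. max 0 (- f \<omega>) * h \<omega> \<partial>M)"
      by (simp add: \<phi>_pos[OF a] \<phi>_pos[OF b])
    also have "\<dots> = (\<integral>\<omega>. max 0 (f \<omega>) * h \<omega> - max 0 (- f \<omega>) * h \<omega> \<partial>M)"
      by (rule Bochner_Integration.integral_diff[symmetric]) (intro \<K>_integrable hK a b)+
    also have "\<dots> = (\<integral>\<omega>. f \<omega> * h \<omega> \<partial>M)"
      by (rule Bochner_Integration.integral_cong) (auto simp: max_def)
    finally show ?thesis ..
  qed
  then show thesis using that hK by blast
qed

end

section \<open>Norming functionals, strict positivity and compactness of the ball\<close>

context order_continuous_lattice
begin

text \<open>Sandwich on the ray through \<open>f\<close>, with the norm as lower bound. On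
  nonnegative functions \<open>\<rho>\<close> is the norm, so the functional has the value
  \<open>N f\<close> at \<open>f\<close>, and \<open>representation\<close> turns it into a point of
  the ball.\<close>

lemma ex_norming:
  assumes f: "f \<in> E" "\<And>\<omega>. \<omega> \<in> space M \<Longrightarrow> 0 \<le> f \<omega>"
  obtains h where "h \<in> \<K>" "(\<integral>\<omega>. f \<omega> * h \<omega> \<partial>M) = N f"
proof -
  have \<rho>_N: "\<rho> u = N u" if "u \<in> E" "\<And>\<omega>. \<omega> \<in> space M \<Longrightarrow> 0 \<le> u \<omega>" for u
    unfolding \<rho>_def using that
    by (intro antisym E_ideal(2) E_pos_part(1) AE_I2) auto
  define W where "W = (\<lambda>t \<omega>. t * f \<omega>) ` {0..}"
  have N_W: "N (\<lambda>\<omega>. t * f \<omega>) = t * N f" if "0 \<le> t" for t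
    using N_scale[OF f(1), of t] that by simp
  have tf: "(\<lambda>\<omega>. t * f \<omega>) \<in> W" if "0 \<le> t" for t using that by (auto simp: W_def)
  have "\<exists>\<phi>. linear_functional_on E \<phi> \<and> (\<forall>f\<in>E. \<phi> f \<le> \<rho> f) \<and> (\<forall>w\<in>W. N w \<le> \<phi> w)"
  proof (rule mazur_orlicz[OF E_subspace \<rho>_sublinear, of W N])
    show "W \<subseteq> E" using E_scale[OF f(1)] by (auto simp: W_def)
    show "(\<lambda>_. 0) \<in> W" using tf[of 0] by simp
    fix w assume "w \<in> W"
    then obtain t where t: "0 \<le> t" "w = (\<lambda>\<omega>. t * f \<omega>)" unfolding W_def by (elim imageE) auto
    show "N w \<le> \<rho> w"
      unfolding t(2) using \<rho>_N[OF E_scale[OF f(1), of t]] f(2) t(1) by simp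
    show "(\<lambda>x. c * w x) \<in> W" "N (\<lambda>x. c * w x) = c * N w" if "0 < c" for c
      using tf[of "c * t"] N_W[of "c * t"] N_W[OF t(1)] t that by (simp_all add: mult.assoc)
    fix v assume "v \<in> W"
    then obtain s where s: "0 \<le> s" "v = (\<lambda>\<omega>. s * f \<omega>)" unfolding W_def by (elim imageE) auto
    have "(\<lambda>x. v x + w x) = (\<lambda>x. (s + t) * f x)" by (simp add: s t algebra_simps)
    then show "(\<lambda>x. v x + w x) \<in> W" "N v + N w \<le> N (\<lambda>x. v x + w x)"
      using tf[of "s + t"] N_W[of "s + t"] N_W[OF t(1)] N_W[OF s(1)] s t
      by (simp_all add: algebra_simps)
  qed
  then obtain \<phi> where \<phi>: "linear_functional_on E \<phi>" "\<And>f. f \<in> E \<Longrightarrow> \<phi> f \<le> \<rho> f"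
    "\<And>w. w \<in> W \<Longrightarrow> N w \<le> \<phi> w" by blast
  obtain h where h: "h \<in> \<K>" "\<And>f. f \<in> E \<Longrightarrow> (\<integral>\<omega>. f \<omega> * h \<omega> \<partial>M) = \<phi> f"
    using representation[OF \<phi>(1)] \<phi>(2) by blast
  have "\<phi> f = N f"
    using \<phi>(2)[OF f(1)] \<phi>(3)[OF tf[of 1]] \<rho>_N[OF f] by simp
  then show thesis using that h f(1) by simp
qed

text \<open>Exhaustion by sets on which some point of the ball is positive. For countable unions,
  the sum with weights \<open>(1/2) ^ Suc i\<close> stays in the ball. Every set \<open>A\<close> of
  positive measure is met, because a functional that norms \<open>g\<close> times the indicator of
  \<open>A\<close> cannot vanish almost everywhere on \<open>A\<close>.\<close>

lemma ex_strictly_positive: "\<exists>h\<in>\<K>. AE \<omega> in M. 0 < h \<omega>"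
proof -
  interpret sigma_finite_measure M by (rule sigma_finite)
  obtain g where g: "g \<in> E" "\<And>\<omega>. \<omega> \<in> space M \<Longrightarrow> 0 < g \<omega>" using unit by blast
  note [measurable] = E_measurable[OF g(1)]
  define P where "P B \<longleftrightarrow> B \<in> sets M \<and> (\<exists>h\<in>\<K>. AE \<omega> in M. \<omega> \<in> B \<longrightarrow> 0 < h \<omega>)" for B
  have zero: "(\<lambda>_. 0) \<in> \<K>" using N_nonneg by (auto simp: \<K>_iff)
  obtain B where B: "P B" "AE \<omega> in M. \<omega> \<in> B"
  proof (rule ex_AE_cover[of P])
    show "P {}" using zero by (auto simp: P_def)
    show "B \<in> sets M" if "P B" for B using that by (simp add: P_def)
    show "P (\<Union>i. A i)" if A: "\<And>i. P (A i)" for A :: "nat \<Rightarrow> 'a set"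
    proof -
      obtain h where h: "\<And>i. h i \<in> \<K>" "\<And>i. AE \<omega> in M. \<omega> \<in> A i \<longrightarrow> 0 < h i \<omega>"
        using A unfolding P_def by metis
      note [measurable] = \<K>_measurable[OF h(1)]
      \<comment> \<open>The series is formed in the extended reals, where it always converges.
        Pairing it with the strictly positive \<open>g\<close> shows afterwards that it is finite
        almost everywhere.\<close>
      define s where "s \<omega> = (\<Sum>i. ennreal ((1/2) ^ Suc i * h i \<omega>))" for \<omega>
      have s[measurable]: "s \<in> borel_measurable M" unfolding s_def by measurable
      have s_le: "(\<integral>\<^sup>+\<omega>. ennreal \<bar>f \<omega>\<bar> * s \<omega> \<partial>M) \<le> ennreal (N f)" if f: "f \<in> E" for f
      proof -
        note [measurable] = E_measurable[OF f]
        have "(\<integral>\<^sup>+\<omega>. ennreal \<bar>f \<omega>\<bar> * s \<omega> \<partial>M)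
            = (\<integral>\<^sup>+\<omega>. (\<Sum>i. ennreal ((1/2) ^ Suc i) * ennreal (\<bar>f \<omega>\<bar> * h i \<omega>)) \<partial>M)"
        proof (rule nn_integral_cong)
          fix \<omega>
          have "ennreal \<bar>f \<omega>\<bar> * ennreal ((1/2) ^ Suc i * h i \<omega>)
              = ennreal ((1/2) ^ Suc i) * ennreal (\<bar>f \<omega>\<bar> * h i \<omega>)" for i
          proof -
            have "\<bar>f \<omega>\<bar> * ((1/2) ^ Suc i * h i \<omega>) = (1/2) ^ Suc i * (\<bar>f \<omega>\<bar> * h i \<omega>)"
              by (rule mult.left_commute)
            then show ?thesis
              by (subst (1 2) ennreal_mult'[symmetric]) (simp_all only: abs_ge_zero, auto)
          qed
          then show "ennreal \<bar>f \<omega>\<bar> * s \<omega> = (\<Sum>i. ennreal ((1/2) ^ Suc i) * ennreal (\<bar>f \<omega>\<bar> * h i \<omega>))"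
            unfolding s_def ennreal_suminf_cmult[symmetric] by (intro suminf_cong)
        qed
        also have "\<dots> = (\<Sum>i. \<integral>\<^sup>+\<omega>. ennreal ((1/2) ^ Suc i) * ennreal (\<bar>f \<omega>\<bar> * h i \<omega>) \<partial>M)"
          by (intro nn_integral_suminf) measurable
        also have "\<dots> \<le> (\<Sum>i. ennreal ((1/2) ^ Suc i * N f))"
        proof (rule suminf_le)
          fix i
          have "(\<integral>\<^sup>+\<omega>. ennreal ((1/2) ^ Suc i) * ennreal (\<bar>f \<omega>\<bar> * h i \<omega>) \<partial>M)
              = ennreal ((1/2) ^ Suc i) * ennreal (\<integral>\<omega>. \<bar>f \<omega>\<bar> * h i \<omega> \<partial>M)"
            using nn_integral_\<K>(1)[OF h(1)[of i] E_abs(1)[OF f]] by (subst nn_integral_cmult) auto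
          also have "\<dots> \<le> ennreal ((1/2) ^ Suc i) * ennreal (N f)"
            using \<K>_le_N[OF h(1)[of i] E_abs(1)[OF f]] E_abs(2)[OF f]
            by (intro mult_left_mono ennreal_leI) auto
          also have "\<dots> = ennreal ((1/2) ^ Suc i * N f)" by (rule ennreal_mult'[symmetric]) simp
          finally show "(\<integral>\<^sup>+\<omega>. ennreal ((1/2) ^ Suc i) * ennreal (\<bar>f \<omega>\<bar> * h i \<omega>) \<partial>M)
              \<le> ennreal ((1/2) ^ Suc i * N f)" .
        qed auto
        also have "\<dots> = ennreal (N f)"
          using N_nonneg[OF f] sums_mult2[OF power_half_series, of "N f"]
          by (intro suminf_ennreal_eq) auto
        finally show ?thesis .
      qed
      have "(\<integral>\<^sup>+\<omega>. ennreal \<bar>g \<omega>\<bar> * s \<omega> \<partial>M) \<noteq> \<infinity>"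
        using s_le[OF g(1)] by (auto simp: top_unique)
      then have "AE \<omega> in M. ennreal \<bar>g \<omega>\<bar> * s \<omega> \<noteq> \<infinity>" by (intro nn_integral_noteq_infinite) auto
      then have s_fin: "AE \<omega> in M. s \<omega> \<noteq> \<infinity>"
        using AE_space
      proof eventually_elim
        case (elim \<omega>)
        then show ?case using g(2)[of \<omega>] by (auto simp: ennreal_mult_top)
      qed
      have "(\<lambda>\<omega>. enn2real (s \<omega>)) \<in> \<K>"
      proof (rule \<K>I_nn_integral)
        fix f assume f: "f \<in> E"
        have "(\<integral>\<^sup>+\<omega>. ennreal (\<bar>f \<omega>\<bar> * enn2real (s \<omega>)) \<partial>M) = (\<integral>\<^sup>+\<omega>. ennreal \<bar>f \<omega>\<bar> * s \<omega> \<partial>M)"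
          by (rule nn_integral_cong_AE)
            (use s_fin in eventually_elim, simp add: ennreal_mult' less_top)
        then show "(\<integral>\<^sup>+\<omega>. ennreal (\<bar>f \<omega>\<bar> * enn2real (s \<omega>)) \<partial>M) \<le> ennreal (N f)"
          using s_le[OF f] by simp
      qed auto
      moreover have "AE \<omega> in M. \<omega> \<in> (\<Union>i. A i) \<longrightarrow> 0 < enn2real (s \<omega>)"
      proof -
        have "AE \<omega> in M. \<forall>i. \<omega> \<in> A i \<longrightarrow> 0 < h i \<omega>" using h(2) by (simp add: AE_all_countable)
        then show ?thesis using s_fin
        proof eventually_elim
          case (elim \<omega>)
          show ?case
          proof
            assume "\<omega> \<in> (\<Union>i. A i)"
            then obtain i where "\<omega> \<in> A i" by blast
            then have "0 < ennreal ((1/2) ^ Suc i * h i \<omega>)" using elim(1) by simp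
            also have "\<dots> \<le> s \<omega>"
              unfolding s_def using sum_le_suminf[of "\<lambda>i. ennreal ((1/2) ^ Suc i * h i \<omega>)" "{i}"] by simp
            finally show "0 < enn2real (s \<omega>)" using elim(2) by (simp add: enn2real_positive_iff less_top)
          qed
        qed
      qed
      moreover have "(\<Union>i. A i) \<in> sets M" using A by (auto simp: P_def)
      ultimately show ?thesis
        unfolding P_def by (intro conjI bexI[of _ "\<lambda>\<omega>. enn2real (s \<omega>)"])
    qed
    show "\<exists>B. P B \<and> 0 < emeasure M (A \<inter> B)" if A: "A \<in> sets M" "0 < emeasure M A" for A
    proof -
      define f where "f \<omega> = g \<omega> * indicator A \<omega>" for \<omega>
      have f: "f \<in> E" "\<And>\<omega>. \<omega> \<in> space M \<Longrightarrow> 0 \<le> f \<omega>"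
        unfolding f_def using A(1) g by (auto intro!: E_ideal(1)[OF _ g(1)] simp: indicator_def less_imp_le)
      have "N f \<noteq> 0"
      proof
        assume "N f = 0"
        then have "AE \<omega> in M. f \<omega> = 0" using N_eq_0[OF f(1)] by simp
        then have "AE \<omega> in M. \<omega> \<notin> A"
          using AE_space
        proof eventually_elim
          case (elim \<omega>)
          then show ?case using g(2)[of \<omega>] by (auto simp: f_def)
        qed
        then have "A \<in> null_sets M" using A(1) by (simp add: AE_iff_null_sets)
        then show False using A(2) by auto
      qed
      obtain h where h: "h \<in> \<K>" "(\<integral>\<omega>. f \<omega> * h \<omega> \<partial>M) = N f" using ex_norming[OF f] by blast
      note [measurable] = \<K>_measurable[OF h(1)]
      define B where "B = {\<omega> \<in> space M. 0 < h \<omega>}"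
      have B[measurable]: "B \<in> sets M" unfolding B_def by measurable
      have "P B" unfolding P_def using B h(1) by (auto simp: B_def intro!: bexI[of _ h])
      moreover have "emeasure M (A \<inter> B) \<noteq> 0"
      proof
        assume "emeasure M (A \<inter> B) = 0"
        then have "A \<inter> B \<in> null_sets M" using A(1) B by (intro null_setsI) auto
        then have "AE \<omega> in M. f \<omega> * h \<omega> = 0"
          using AE_not_in[of "A \<inter> B"] \<K>_nonneg[OF h(1)] AE_space
        proof -
          assume ab: "A \<inter> B \<in> null_sets M"
          show ?thesis using AE_not_in[OF ab] \<K>_nonneg[OF h(1)] AE_space
            by eventually_elim (auto simp: f_def B_def indicator_def)
        qed
        then have "(\<integral>\<omega>. f \<omega> * h \<omega> \<partial>M) = 0" by (rule integral_eq_zero_AE)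
        then show False using h(2) \<open>N f \<noteq> 0\<close> by simp
      qed
      ultimately show ?thesis by (auto simp: zero_less_iff_neq_zero)
    qed
  qed
  obtain h where h: "h \<in> \<K>" "AE \<omega> in M. \<omega> \<in> B \<longrightarrow> 0 < h \<omega>" using B(1) by (auto simp: P_def)
  have "AE \<omega> in M. 0 < h \<omega>" using B(2) h(2) by eventually_elim simp
  then show ?thesis using h(1) by blast
qed

text \<open>The weak topology is pointwise convergence of these functionals. The value 0 off
  \<open>E\<close> lets them live in the full product over all functions, with a constant coordinate
  at each function outside the lattice.\<close>

definition pairing :: "('a \<Rightarrow> real) \<Rightarrow> (('a \<Rightarrow> real) \<Rightarrow> real)" where
  "pairing h = (\<lambda>f. if f \<in> E then \<integral>\<omega>. f \<omega> * h \<omega> \<partial>M else 0)"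

text \<open>Both topologies are the initial one for the evaluations at members of \<open>E\<close>:
  subbasic open sets of the ball are preimages of open cylinders, and \<open>pairing\<close> is
  continuous in every coordinate.\<close>

lemma koethe_pos_ball_eq_pullback: "koethe_pos_ball M V = pullback_topology \<K> pairing euclidean"
proof (rule topology_eq[THEN iffD2], intro allI iffI)
  define P where "P = pullback_topology \<K> pairing euclidean"
  have top_P: "topspace P = \<K>" by (simp add: P_def topspace_pullback_topology)
  fix S assume S: "openin (koethe_pos_ball M V) S"
  have "continuous_map P (koethe_pos_ball M V) id"
    unfolding koethe_pos_ball_def continuous_map_in_subtopology
  proof
    show "continuous_map P (koethe_weak_topology M V) id"
      unfolding koethe_weak_topology_def
    proof (rule continuous_on_generated_topo)
      show "id ` topspace P
        \<subseteq> \<Union>{{h \<in> elems (koethe_dual M V). (\<integral>\<omega>. f \<omega> * h \<omega> \<partial>M) \<in> U} |f U. f \<in> E \<and> open U}"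
        using topspace_koethe_weak
        unfolding koethe_weak_topology_def topology_generated_by_topspace
        by (simp add: top_P koethe_pos_ball_def topspace_subtopology
            koethe_weak_topology_def)
      fix U assume "U \<in> {{h \<in> elems (koethe_dual M V). (\<integral>\<omega>. f \<omega> * h \<omega> \<partial>M) \<in> U} |f U. f \<in> E \<and> open U}"
      then obtain f O' where O': "f \<in> E" "open O'"
        "U = {h \<in> elems (koethe_dual M V). (\<integral>\<omega>. f \<omega> * h \<omega> \<partial>M) \<in> O'}" by blast
      have K: "\<K> \<subseteq> elems (koethe_dual M V)"
        unfolding koethe_pos_ball_def topspace_subtopology topspace_koethe_weak by blast
      have "open {\<phi> :: ('a \<Rightarrow> real) \<Rightarrow> real. \<phi> f \<in> O'}"
        using O'(2) by (intro open_vimage[of O' "\<lambda>\<phi>. \<phi> f", unfolded vimage_def]) (auto intro!: continuous_intros)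
      moreover have "id -` U \<inter> topspace P
          = pairing -` {\<phi>. \<phi> f \<in> O'} \<inter> \<K>"
        using K O'(1) by (auto simp: O'(3) top_P pairing_def)
      ultimately show "openin P
          (id -` U \<inter> topspace P)"
        unfolding P_def openin_pullback_topology by auto
    qed
    show "id \<in> topspace P \<rightarrow>
      {h \<in> elems (koethe_dual M V). (AE \<omega> in M. 0 \<le> h \<omega>) \<and> fnorm (koethe_dual M V) h \<le> 1}"
      by (auto simp: top_P koethe_pos_ball_def)
  qed
  from openin_continuous_map_preimage[OF this S]
  have "openin P {x \<in> \<K>. x \<in> S}"
    by (simp add: top_P)
  moreover have "{x \<in> \<K>. x \<in> S} = S" using openin_subset[OF S] by auto
  ultimately show "openin (pullback_topology \<K> pairing euclidean) S" by (simp add: P_def)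
next
  fix S assume "openin (pullback_topology \<K> pairing euclidean) S"
  then obtain U where U: "open U" "S = pairing -` U \<inter> \<K>"
    unfolding openin_pullback_topology by auto
  have "continuous_map (koethe_pos_ball M V) (product_topology (\<lambda>_. euclideanreal) UNIV) pairing"
    unfolding continuous_map_componentwise_UNIV
    by (auto simp: pairing_def intro: continuous_map_pairing)
  then have "continuous_map (koethe_pos_ball M V) euclidean pairing"
    by (simp add: euclidean_product_topology)
  from openin_continuous_map_preimage[OF this, of U] U
  have "openin (koethe_pos_ball M V) {x \<in> \<K>. pairing x \<in> U}" by simp
  moreover have "{x \<in> \<K>. pairing x \<in> U} = S" unfolding U(2) by auto
  ultimately show "openin (koethe_pos_ball M V) S" by simp
qed

text \<open>Order continuity enters the topology here: each linear functional below
  \<open>\<rho>\<close> comes from a function. The image is thus cut out by pointwise conditions,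
  and no limit of pairings is lost.\<close>

lemma pairing_image:
  "pairing ` \<K> = {\<phi>. linear_functional_on E \<phi> \<and> (\<forall>f\<in>E. \<phi> f \<le> \<rho> f) \<and> (\<forall>f. f \<notin> E \<longrightarrow> \<phi> f = 0)}"
proof (intro set_eqI iffI)
  fix \<phi> assume "\<phi> \<in> pairing ` \<K>"
  then obtain h where h: "h \<in> \<K>" "\<phi> = pairing h" by blast
  have "linear_functional_on E \<phi>"
    unfolding linear_functional_on_def h(2) pairing_def
    using h(1) by (auto simp: E_add E_scale distrib_right mult.assoc \<K>_integrable)
  then show "\<phi> \<in> {\<phi>. linear_functional_on E \<phi> \<and> (\<forall>f\<in>E. \<phi> f \<le> \<rho> f) \<and> (\<forall>f. f \<notin> E \<longrightarrow> \<phi> f = 0)}"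
    using \<K>_le_\<rho>[OF h(1)] by (auto simp: h(2) pairing_def)
next
  fix \<phi> assume "\<phi> \<in> {\<phi>. linear_functional_on E \<phi> \<and> (\<forall>f\<in>E. \<phi> f \<le> \<rho> f) \<and> (\<forall>f. f \<notin> E \<longrightarrow> \<phi> f = 0)}"
  then have \<phi>: "linear_functional_on E \<phi>" "\<And>f. f \<in> E \<Longrightarrow> \<phi> f \<le> \<rho> f" "\<And>f. f \<notin> E \<Longrightarrow> \<phi> f = 0"
    by auto
  obtain h where "h \<in> \<K>" "\<And>f. f \<in> E \<Longrightarrow> (\<integral>\<omega>. f \<omega> * h \<omega> \<partial>M) = \<phi> f"
    using representation[OF \<phi>(1)] \<phi>(2) by blast
  then have "\<phi> = pairing h" using \<phi>(3) by (auto simp: pairing_def fun_eq_iff)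
  then show "\<phi> \<in> pairing ` \<K>" using \<open>h \<in> \<K>\<close> by blast
qed

text \<open>Alaoglu's argument: linearity and the bound by \<open>\<rho>\<close> are closed
  conditions on the coordinates, and every coordinate is confined to a compact interval by the
  norm.\<close>

lemma compact_pairing_image: "compact (pairing ` \<K>)"
proof -
  let ?B = "\<lambda>f. if f \<in> E then {- N f..N f} else {0}"
  have "closed (pairing ` \<K>)"
    unfolding pairing_image linear_functional_on_def Ball_def
    by (intro closed_Collect_conj closed_Collect_all closed_Collect_imp open_Collect_const
        closed_Collect_eq closed_Collect_le continuous_intros continuous_on_product_coordinates)
  moreover have "pairing ` \<K> \<subseteq> PiE UNIV ?B"
  proof
    fix \<phi> assume "\<phi> \<in> pairing ` \<K>"
    then show "\<phi> \<in> PiE UNIV ?B"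
      using \<K>_le_N by (fastforce simp: pairing_def abs_le_iff)
  qed
  moreover have "compact (PiE UNIV ?B)" by (rule compact_PiE_UNIV) simp
  ultimately show ?thesis using compact_Int_closed[of "PiE UNIV ?B" "pairing ` \<K>"]
    by (simp add: Int_absorb1)
qed

text \<open>Representatives that agree almost everywhere cannot be separated, so compactness is
  combined with regularity, which holds in the product space, to obtain normality.\<close>

lemma compact_space_koethe_pos_ball: "compact_space (koethe_pos_ball M V)"
  and normal_space_koethe_pos_ball: "normal_space (koethe_pos_ball M V)"
proof -
  note * = pullback_topology_compact_regular[OF koethe_pos_ball_eq_pullback compact_pairing_image
      regular_space_euclidean_fun]
  show "compact_space (koethe_pos_ball M V)" by (rule *(1))
  then show "normal_space (koethe_pos_ball M V)"
    using compact_Hausdorff_or_regular_imp_normal_space *(2) by blast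
qed

lemma \<K>_nonempty: "\<K> \<noteq> {}"
  using ex_strictly_positive by blast

end

section \<open>Minkowski and Hoelder inequalities\<close>

lemma ennreal_power_ennreal [simp]: "0 \<le> x \<Longrightarrow> ennreal_power (ennreal x) a = ennreal (x powr a)"
  by (simp add: ennreal_power_def)

lemma ennreal_power_top [simp]: "ennreal_power \<top> a = \<top>"
  by (simp add: ennreal_power_def)

lemma ennreal_power_zero [simp]: "ennreal_power 0 a = 0"
  by (simp add: ennreal_power_def)

lemma ennreal_power_one [simp]: "ennreal_power x 1 = x"
  by (cases x) auto

lemma ennreal_power_eq_top_iff [simp]: "ennreal_power x a = \<top> \<longleftrightarrow> x = \<top>"
  by (cases x) auto

lemma ennreal_power_less_top_iff [simp]: "ennreal_power x a < \<top> \<longleftrightarrow> x < \<top>"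
  by (simp add: less_top[symmetric])

lemma ennreal_power_eq_0_iff [simp]: "ennreal_power x a = 0 \<longleftrightarrow> x = 0"
  by (cases x) auto

lemma ennreal_power_mono: "x \<le> y \<Longrightarrow> 0 \<le> a \<Longrightarrow> ennreal_power x a \<le> ennreal_power y a"
  by (cases x; cases y) (auto intro!: ennreal_leI powr_mono2 simp: top_unique)

lemma ennreal_power_power:
  assumes "0 < a" "0 < b"
  shows "ennreal_power (ennreal_power x a) b = ennreal_power x (a * b)"
  by (cases x) (auto simp: powr_powr)

lemma ennreal_power_le_iff:
  assumes "0 < a"
  shows "ennreal_power x a \<le> y \<longleftrightarrow> x \<le> ennreal_power y (1 / a)"
proof
  assume "ennreal_power x a \<le> y"
  then have "ennreal_power (ennreal_power x a) (1 / a) \<le> ennreal_power y (1 / a)"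
    by (rule ennreal_power_mono) (use assms in auto)
  then show "x \<le> ennreal_power y (1 / a)" using assms by (simp add: ennreal_power_power)
next
  assume "x \<le> ennreal_power y (1 / a)"
  then have "ennreal_power x a \<le> ennreal_power (ennreal_power y (1 / a)) a"
    by (rule ennreal_power_mono) (use assms in auto)
  then show "ennreal_power x a \<le> y" using assms by (simp add: ennreal_power_power)
qed

lemma ennreal_power_mult:
  "ennreal_power (ennreal c * x) a = ennreal (c powr a) * ennreal_power x a" if "0 \<le> c"
proof (cases x)
  case (real r)
  then show ?thesis using that by (simp add: powr_mult flip: ennreal_mult')
next
  case top
  then show ?thesis using that by (cases "c = 0") (auto simp: ennreal_mult_top)
qed

lemma borel_measurable_ennreal_power [measurable (raw)]:
  assumes [measurable]: "f \<in> borel_measurable M"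
  shows "(\<lambda>x. ennreal_power (f x) a) \<in> borel_measurable M"
  unfolding ennreal_power_def by measurable

lemma ennreal_power_tendsto_0:
  assumes "0 < a" "(f \<longlongrightarrow> 0) F"
  shows "((\<lambda>x. ennreal_power (f x) a) \<longlongrightarrow> 0) F"
proof (rule order_tendstoI)
  fix y :: ennreal assume y: "0 < y"
  obtain z where z: "0 < z" "z < y" using dense[OF y] by blast
  then obtain r where "z = ennreal r" "0 \<le> r" by (cases z) (auto simp: top.extremum_strict)
  with z have r: "0 < r" "ennreal r < y" by auto
  have "0 < ennreal (r powr (1 / a))" using r by simp
  then have "\<forall>\<^sub>F x in F. f x < ennreal (r powr (1 / a))" by (rule order_tendstoD(2)[OF assms(2)])
  then show "\<forall>\<^sub>F x in F. ennreal_power (f x) a < y"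
  proof eventually_elim
    case (elim x)
    then have "f x \<le> ennreal_power (ennreal r) (1 / a)" using r by simp
    then have "ennreal_power (f x) a \<le> ennreal r" using assms(1) by (simp add: ennreal_power_le_iff)
    then show ?case using r(2) by simp
  qed
qed simp

lemma powr_convex_combination:
  fixes u v t s p :: real
  assumes "1 \<le> p" "0 \<le> u" "0 \<le> v" "0 \<le> t" "0 \<le> s" "t + s = 1"
  shows "(t * u + s * v) powr p \<le> t * u powr p + s * v powr p"
proof (cases "u = 0 \<or> v = 0")
  case True
  have *: "(t * u) powr p \<le> t * u powr p" if "0 \<le> t" "t \<le> 1" "0 \<le> u" for t u
  proof -
    have "t powr p \<le> t" using powr_mono'[of 1 p t] assms(1) that by simp
    then show ?thesis using that by (simp add: powr_mult mult_right_mono)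
  qed
  show ?thesis using True *[of t u] *[of s v] assms by auto
next
  case False
  have t: "t = 1 - s" using assms(6) by simp
  show ?thesis
    using convex_onD[OF powr_convex[OF assms(1)], of s u v] assms(2-5) False by (simp add: t)
qed

text \<open>Convexity of the power with weights \<open>a / (a + b)\<close> and
  \<open>b / (a + b)\<close> at the points \<open>x / a\<close> and \<open>y / b\<close>. With
  \<open>a\<close> and \<open>b\<close> bounds for the norms of two functions, it integrates to
  Minkowski's inequality.\<close>

lemma powr_add_le_weighted:
  fixes x y a b p :: real
  assumes "1 \<le> p" "0 \<le> x" "0 \<le> y" "0 < a" "0 < b"
  shows "(x + y) powr p \<le> (a + b) powr (p - 1) * (a powr (1 - p) * x powr p + b powr (1 - p) * y powr p)"
proof -
  have "((a / (a + b)) * (x / a) + (b / (a + b)) * (y / b)) powr p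
      \<le> (a / (a + b)) * (x / a) powr p + (b / (a + b)) * (y / b) powr p"
    using assms by (intro powr_convex_combination) (auto simp: add_divide_distrib[symmetric])
  also have "(a / (a + b)) * (x / a) + (b / (a + b)) * (y / b) = (x + y) / (a + b)"
    using assms by (simp add: add_divide_distrib)
  finally have "(x + y) powr p / (a + b) powr p
      \<le> (a / (a + b)) * (x powr p / a powr p) + (b / (a + b)) * (y powr p / b powr p)"
    using assms by (simp add: powr_divide)
  then have "(x + y) powr p \<le> (a + b) powr p *
      ((a / (a + b)) * (x powr p / a powr p) + (b / (a + b)) * (y powr p / b powr p))"
    using assms by (simp add: pos_divide_le_eq mult.commute)
  also have "\<dots> = (a + b) powr (p - 1) * (a powr (1 - p) * x powr p + b powr (1 - p) * y powr p)"
  proof -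
    have "S * ((a / c) * (U / A) + (b / c) * (W / B)) = S / c * (a / A * U + b / B * W)"
      for S c U W A B :: real
      by (simp add: algebra_simps)
    then show ?thesis using assms by (simp add: powr_diff)
  qed
  finally show ?thesis .
qed

lemma nn_integral_power_add_le:
  assumes [measurable]: "F \<in> borel_measurable M" "G \<in> borel_measurable M"
    and p: "1 \<le> p" and ab: "0 < a" "0 < b"
    and F: "(\<integral>\<^sup>+x. ennreal_power (F x) p \<partial>M) \<le> ennreal (a powr p)"
    and G: "(\<integral>\<^sup>+x. ennreal_power (G x) p \<partial>M) \<le> ennreal (b powr p)"
  shows "(\<integral>\<^sup>+x. ennreal_power (F x + G x) p \<partial>M) \<le> ennreal ((a + b) powr p)"
proof -
  define c where "c = (a + b) powr (p - 1)"
  \<comment> \<open>These coefficients are such that \<open>d * a powr p + e * b powr p\<close> is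
    exactly \<open>(a + b) powr p\<close>.\<close>
  define d e where "d = c * a powr (1 - p)" and "e = c * b powr (1 - p)"
  have de: "0 < d" "0 < e" using ab by (auto simp: d_def e_def c_def)
  have "ennreal_power (F x + G x) p \<le> ennreal d * ennreal_power (F x) p + ennreal e * ennreal_power (G x) p"
    for x
  proof (cases "F x = \<top> \<or> G x = \<top>")
    case True
    then show ?thesis using de by (auto simp: ennreal_mult_top)
  next
    case False
    then obtain u v where uv: "0 \<le> u" "0 \<le> v" "F x = ennreal u" "G x = ennreal v"
      by (metis ennreal_cases)
    have "(u + v) powr p \<le> d * u powr p + e * v powr p"
      using powr_add_le_weighted[OF p uv(1,2) ab] by (simp add: d_def e_def c_def algebra_simps)
    then show ?thesis
      using uv de by (simp add: ennreal_leI flip: ennreal_plus ennreal_mult')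
  qed
  then have "(\<integral>\<^sup>+x. ennreal_power (F x + G x) p \<partial>M)
      \<le> (\<integral>\<^sup>+x. ennreal d * ennreal_power (F x) p + ennreal e * ennreal_power (G x) p \<partial>M)"
    by (intro nn_integral_mono)
  also have "\<dots> = ennreal d * (\<integral>\<^sup>+x. ennreal_power (F x) p \<partial>M) + ennreal e * (\<integral>\<^sup>+x. ennreal_power (G x) p \<partial>M)"
    by (simp add: nn_integral_add nn_integral_cmult)
  also have "\<dots> \<le> ennreal d * ennreal (a powr p) + ennreal e * ennreal (b powr p)"
    using F G by (intro add_mono mult_left_mono) auto
  also have "\<dots> = ennreal (d * a powr p + e * b powr p)"
    using de by (simp flip: ennreal_mult' ennreal_plus)
  also have "d * a powr p + e * b powr p = (a + b) powr p"
  proof -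
    have "d * a powr p + e * b powr p = c * (a powr (1 - p + p) + b powr (1 - p + p))"
      by (simp only: d_def e_def powr_add) (simp add: algebra_simps)
    also have "\<dots> = (a + b) powr (p - 1) * (a + b) powr 1" using ab by (simp add: c_def)
    also have "\<dots> = (a + b) powr p" by (simp only: powr_add[symmetric]) simp
    finally show ?thesis .
  qed
  finally show ?thesis .
qed

theorem minkowski_nn_integral:
  assumes [measurable]: "F \<in> borel_measurable M" "G \<in> borel_measurable M" and p: "1 \<le> p"
  shows "ennreal_power (\<integral>\<^sup>+x. ennreal_power (F x + G x) p \<partial>M) (1 / p)
    \<le> ennreal_power (\<integral>\<^sup>+x. ennreal_power (F x) p \<partial>M) (1 / p)
      + ennreal_power (\<integral>\<^sup>+x. ennreal_power (G x) p \<partial>M) (1 / p)" (is "_ \<le> ?A + ?B")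
proof (cases "?A = \<top> \<or> ?B = \<top>")
  case True
  then show ?thesis by auto
next
  case False
  then obtain a b where ab: "0 \<le> a" "0 \<le> b" "?A = ennreal a" "?B = ennreal b"
    by (metis ennreal_cases)
  show ?thesis
  proof (rule ennreal_le_epsilon)
    fix e :: real assume e: "0 < e"
    \<comment> \<open>A norm may be 0, while the weighted inequality divides by its parameters;
      adding \<open>e / 2\<close> to each norm keeps them positive.\<close>
    have *: "I \<le> ennreal ((c + e / 2) powr p)" if "ennreal_power I (1 / p) = ennreal c" "0 \<le> c" for I c
    proof -
      have "ennreal_power I (1 / p) \<le> ennreal (c + e / 2)"
        using that e by (simp add: ennreal_leI)
      then have "I \<le> ennreal_power (ennreal (c + e / 2)) p"
        using p by (subst (asm) ennreal_power_le_iff) simp_all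
      then show ?thesis using that(2) e by (subst (asm) ennreal_power_ennreal) simp_all
    qed
    have "(\<integral>\<^sup>+x. ennreal_power (F x + G x) p \<partial>M) \<le> ennreal (((a + e / 2) + (b + e / 2)) powr p)"
      using ab e by (intro nn_integral_power_add_le p * ) auto
    also have "\<dots> = ennreal_power (ennreal (a + b + e)) p"
      using ab e by (subst ennreal_power_ennreal) (simp_all add: add_ac)
    finally have "ennreal_power (\<integral>\<^sup>+x. ennreal_power (F x + G x) p \<partial>M) (1 / p) \<le> ennreal (a + b + e)"
      using p by (subst ennreal_power_le_iff) auto
    then show "ennreal_power (\<integral>\<^sup>+x. ennreal_power (F x + G x) p \<partial>M) (1 / p) \<le> ?A + ?B + ennreal e"
      using ab e by (simp flip: ennreal_plus)
  qed
qed

text \<open>Needed between the two applications of Fatou's lemma in \<open>Sn_fatou\<close>. Taking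
  the inverse power reduces it to a bound for each tail infimum.\<close>

lemma liminf_ennreal_power_ge:
  assumes "0 < a"
  shows "ennreal_power (liminf f) a \<le> liminf (\<lambda>n. ennreal_power (f n) a)"
proof -
  have "(INF m\<in>{n..}. f m) \<le> ennreal_power (liminf (\<lambda>n. ennreal_power (f n) a)) (1 / a)" for n
  proof -
    have "ennreal_power (INF m\<in>{n..}. f m) a \<le> (INF m\<in>{n..}. ennreal_power (f m) a)"
      using assms by (intro INF_greatest ennreal_power_mono INF_lower) auto
    also have "\<dots> \<le> liminf (\<lambda>n. ennreal_power (f n) a)"
      unfolding liminf_SUP_INF by (rule SUP_upper) simp
    finally show ?thesis using assms by (simp add: ennreal_power_le_iff)
  qed
  then show ?thesis
    unfolding ennreal_power_le_iff[OF assms] unfolding liminf_SUP_INF[of f] by (intro SUP_least)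
qed

text \<open>Convexity of the exponential at the logarithms. When some \<open>x j\<close> is 0 there
  is no logarithm, but then the product vanishes.\<close>

lemma weighted_am_gm:
  fixes x w :: "'j \<Rightarrow> real"
  assumes J: "finite J" "J \<noteq> {}" and w: "\<And>j. j \<in> J \<Longrightarrow> 0 < w j" "sum w J = 1"
    and x: "\<And>j. j \<in> J \<Longrightarrow> 0 \<le> x j"
  shows "(\<Prod>j\<in>J. x j powr w j) \<le> (\<Sum>j\<in>J. w j * x j)"
proof (cases "\<exists>j\<in>J. x j = 0")
  case True
  then have "(\<Prod>j\<in>J. x j powr w j) = 0" using J(1) by (auto intro!: prod_zero)
  then show ?thesis using w x by (auto intro!: sum_nonneg simp: less_imp_le)
next
  case False
  then have pos: "0 < x j" if "j \<in> J" for j using x[OF that] that by force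
  have "(\<Prod>j\<in>J. x j powr w j) = exp (\<Sum>j\<in>J. w j *\<^sub>R ln (x j))"
    unfolding exp_sum[OF J(1)]
  proof (rule prod.cong[OF refl])
    fix j assume "j \<in> J"
    then show "x j powr w j = exp (w j *\<^sub>R ln (x j))" using pos[of j] by (simp add: powr_def)
  qed
  also have "\<dots> \<le> (\<Sum>j\<in>J. w j * exp (ln (x j)))"
    using w by (intro convex_on_sum[OF J exp_convex]) (auto simp: less_imp_le)
  also have "\<dots> = (\<Sum>j\<in>J. w j * x j)" using pos by (intro sum.cong) auto
  finally show ?thesis .
qed

text \<open>After division by the sums \<open>A j\<close>, the weighted AM-GM inequality for each
  \<open>k\<close>, summed over \<open>k\<close>, gives the bound 1, the total weight. If some
  \<open>A j\<close> is 0, all its terms vanish and so does the left side.\<close>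

lemma generalized_holder_sum:
  fixes a :: "'j \<Rightarrow> 'k \<Rightarrow> real"
  assumes J: "finite J" "J \<noteq> {}" and w: "\<And>j. j \<in> J \<Longrightarrow> 0 < w j" "sum w J = 1"
    and a: "\<And>j k. j \<in> J \<Longrightarrow> k \<in> K \<Longrightarrow> 0 \<le> a j k" and K: "finite K"
  shows "(\<Sum>k\<in>K. \<Prod>j\<in>J. a j k powr w j) \<le> (\<Prod>j\<in>J. (\<Sum>k\<in>K. a j k) powr w j)"
proof -
  define A where "A j = (\<Sum>k\<in>K. a j k)" for j
  have A: "0 \<le> A j" if "j \<in> J" for j unfolding A_def using a that by (intro sum_nonneg) auto
  show ?thesis
  proof (cases "\<exists>j\<in>J. A j = 0")
    case True
    then obtain j where j: "j \<in> J" "A j = 0" by blast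
    then have "a j k = 0" if "k \<in> K" for k
      using that a[OF j(1)] K unfolding A_def by (simp add: sum_nonneg_eq_0_iff)
    then have "(\<Prod>j\<in>J. a j k powr w j) = 0" if "k \<in> K" for k
      using that j(1) J(1) by (auto intro!: prod_zero bexI[of _ j])
    then show ?thesis by (simp add: prod_nonneg)
  next
    case False
    then have pos: "0 < A j" if "j \<in> J" for j using A[OF that] that by force
    have "(\<Sum>k\<in>K. \<Prod>j\<in>J. a j k powr w j) = (\<Sum>k\<in>K. (\<Prod>j\<in>J. A j powr w j) * (\<Prod>j\<in>J. (a j k / A j) powr w j))"
    proof (rule sum.cong[OF refl])
      fix k assume k: "k \<in> K"
      show "(\<Prod>j\<in>J. a j k powr w j) = (\<Prod>j\<in>J. A j powr w j) * (\<Prod>j\<in>J. (a j k / A j) powr w j)"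
        unfolding prod.distrib[symmetric]
      proof (rule prod.cong[OF refl])
        fix j assume j: "j \<in> J"
        show "a j k powr w j = A j powr w j * (a j k / A j) powr w j"
          using pos[OF j] a[OF j k] by (simp add: powr_divide)
      qed
    qed
    also have "\<dots> = (\<Prod>j\<in>J. A j powr w j) * (\<Sum>k\<in>K. \<Prod>j\<in>J. (a j k / A j) powr w j)"
      by (rule sum_distrib_left[symmetric])
    also have "\<dots> \<le> (\<Prod>j\<in>J. A j powr w j) * 1"
    proof (rule mult_left_mono)
      have "(\<Sum>k\<in>K. \<Prod>j\<in>J. (a j k / A j) powr w j) \<le> (\<Sum>k\<in>K. \<Sum>j\<in>J. w j * (a j k / A j))"
        using a pos by (intro sum_mono weighted_am_gm J w) (auto simp: less_imp_le)
      also have "\<dots> = (\<Sum>j\<in>J. \<Sum>k\<in>K. w j * (a j k / A j))" by (rule sum.swap)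
      also have "\<dots> = (\<Sum>j\<in>J. w j)"
      proof (rule sum.cong[OF refl])
        fix j assume j: "j \<in> J"
        have "(\<Sum>k\<in>K. w j * (a j k / A j)) = w j * (A j / A j)"
          by (simp add: A_def[of j] flip: sum_distrib_left sum_divide_distrib)
        then show "(\<Sum>k\<in>K. w j * (a j k / A j)) = w j" using pos[OF j] by simp
      qed
      finally show "(\<Sum>k\<in>K. \<Prod>j\<in>J. (a j k / A j) powr w j) \<le> 1" using w(2) by simp
    qed (simp add: prod_nonneg)
    finally show ?thesis by (simp add: A_def)
  qed
qed

lemma prod_powr_distrib_nonneg:
  fixes a :: "'j \<Rightarrow> real"
  assumes "\<And>j. j \<in> J \<Longrightarrow> 0 \<le> a j"
  shows "(\<Prod>j\<in>J. a j powr s) = (\<Prod>j\<in>J. a j) powr s"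
  using assms by (induction J rule: infinite_finite_induct) (auto simp: powr_mult prod_nonneg)

section \<open>Duality for the sequence balls\<close>

lemma lr_ball_gap:
  fixes p q :: real
  assumes "1 \<le> p" "p < q"
  defines "r \<equiv> 1 / (1 / p - 1 / q)"
  shows "0 < r" "p / r = 1 - p / q"
    "\<beta> \<in> lr_ball (gap_exponent p q) n \<longleftrightarrow> (\<Sum>k<n. \<bar>\<beta> k\<bar> powr r) \<le> 1"
proof -
  have d: "1 / q < 1 / p" using assms by (intro divide_strict_left_mono) auto
  then show r: "0 < r" by (simp add: r_def)
  have "p / r = p * (1 / p - 1 / q)" unfolding r_def by (simp del: right_diff_distrib)
  also have "\<dots> = 1 - p / q" using assms by (simp add: right_diff_distrib)
  finally show "p / r = 1 - p / q" .
  have s: "0 \<le> (\<Sum>k<n. \<bar>\<beta> k\<bar> powr r)" by (intro sum_nonneg) auto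
  have "\<beta> \<in> lr_ball (gap_exponent p q) n \<longleftrightarrow> (\<Sum>k<n. \<bar>\<beta> k\<bar> powr r) powr (1 / r) \<le> 1"
    using assms(2) by (simp add: lr_ball_def gap_exponent_def r_def)
  also have "\<dots> \<longleftrightarrow> (\<Sum>k<n. \<bar>\<beta> k\<bar> powr r) \<le> 1"
  proof
    assume "(\<Sum>k<n. \<bar>\<beta> k\<bar> powr r) powr (1 / r) \<le> 1"
    then have "((\<Sum>k<n. \<bar>\<beta> k\<bar> powr r) powr (1 / r)) powr r \<le> 1 powr r"
      using r by (intro powr_mono2) auto
    then show "(\<Sum>k<n. \<bar>\<beta> k\<bar> powr r) \<le> 1" using r s by (simp add: powr_powr)
  next
    assume "(\<Sum>k<n. \<bar>\<beta> k\<bar> powr r) \<le> 1"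
    then have "(\<Sum>k<n. \<bar>\<beta> k\<bar> powr r) powr (1 / r) \<le> 1 powr (1 / r)"
      using r s by (intro powr_mono2) auto
    then show "(\<Sum>k<n. \<bar>\<beta> k\<bar> powr r) powr (1 / r) \<le> 1" by simp
  qed
  finally show "\<beta> \<in> lr_ball (gap_exponent p q) n \<longleftrightarrow> (\<Sum>k<n. \<bar>\<beta> k\<bar> powr r) \<le> 1" .
qed

lemma zero_in_lr_ball: "(\<lambda>_. 0) \<in> lr_ball r n"
  by (simp add: lr_ball_def)

lemma lr_ball_sum_le:
  fixes p q :: real
  assumes pq: "1 \<le> p" "p \<le> q" and a: "\<And>k. k < n \<Longrightarrow> 0 \<le> a k"
    and \<beta>: "\<beta> \<in> lr_ball (gap_exponent p q) n"
  shows "(\<Sum>k<n. \<bar>\<beta> k\<bar> powr p * a k) \<le> (\<Sum>k<n. a k powr (q / p)) powr (p / q)"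
proof (cases "p = q")
  case True
  have "\<bar>\<beta> k\<bar> powr p \<le> 1" if "k < n" for k
    using \<beta> True that pq powr_mono2[of p "\<bar>\<beta> k\<bar>" 1] by (simp add: lr_ball_def gap_exponent_def)
  then have "(\<Sum>k<n. \<bar>\<beta> k\<bar> powr p * a k) \<le> (\<Sum>k<n. 1 * a k)"
    using a by (intro sum_mono mult_right_mono) auto
  then show ?thesis using True pq a sum_nonneg[of "{..<n}" a] by simp
next
  case False
  then have lt: "p < q" using pq by simp
  define r where "r = 1 / (1 / p - 1 / q)"
  note r = lr_ball_gap[OF pq(1) lt, folded r_def]
  \<comment> \<open>The two factors are indexed by the booleans, with weights \<open>p / q\<close>
    and \<open>p / r\<close>, to fit the inequality for families.\<close>
  define c where "c j k = (if j then a k powr (q / p) else \<bar>\<beta> k\<bar> powr r)" for j :: bool and k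
  define w where "w j = (if j then p / q else p / r)" for j :: bool
  have w: "0 < w j" "sum w UNIV = 1" for j
    using pq lt r(1,2) by (auto simp: w_def UNIV_bool)
  have "(\<Sum>k<n. \<bar>\<beta> k\<bar> powr p * a k) = (\<Sum>k<n. \<Prod>j\<in>UNIV. c j k powr w j)"
    using pq a r(1) by (intro sum.cong) (auto simp: UNIV_bool c_def w_def powr_powr)
  also have "\<dots> \<le> (\<Prod>j\<in>UNIV. (\<Sum>k<n. c j k) powr w j)"
    by (rule generalized_holder_sum) (use w in \<open>auto simp: c_def\<close>)
  also have "\<dots> = (\<Sum>k<n. \<bar>\<beta> k\<bar> powr r) powr (p / r) * (\<Sum>k<n. a k powr (q / p)) powr (p / q)"
    by (simp add: UNIV_bool c_def w_def)
  also have "\<dots> \<le> 1 * (\<Sum>k<n. a k powr (q / p)) powr (p / q)"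
  proof (rule mult_right_mono)
    have "(\<Sum>k<n. \<bar>\<beta> k\<bar> powr r) powr (p / r) \<le> 1 powr (p / r)"
      using \<beta> r(3) r(1) pq by (intro powr_mono2) (auto intro: sum_nonneg)
    then show "(\<Sum>k<n. \<bar>\<beta> k\<bar> powr r) powr (p / r) \<le> 1" by simp
  qed simp
  finally show ?thesis by simp
qed

text \<open>Equality in Hoelder: \<open>\<bar>\<beta> k\<bar> powr r\<close> is taken proportional
  to \<open>a k powr (q / p)\<close>, with the factor fixed by norm 1. If the sum of these powers is
  0, the zero sequence will do.\<close>

lemma lr_ball_sum_attained:
  fixes p q :: real
  assumes pq: "1 \<le> p" "p \<le> q" and a: "\<And>k. k < n \<Longrightarrow> 0 \<le> a k"
  shows "\<exists>\<beta>\<in>lr_ball (gap_exponent p q) n.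
    (\<Sum>k<n. a k powr (q / p)) powr (p / q) \<le> (\<Sum>k<n. \<bar>\<beta> k\<bar> powr p * a k)"
proof (cases "p = q")
  case True
  have "(\<lambda>_. 1) \<in> lr_ball (gap_exponent p q) n" using True by (simp add: lr_ball_def gap_exponent_def)
  moreover have "(\<Sum>k<n. a k powr (q / p)) powr (p / q) = (\<Sum>k<n. a k)"
    using True pq a sum_nonneg[of "{..<n}" a] by simp
  ultimately show ?thesis by (intro bexI[of _ "\<lambda>_. 1"]) auto
next
  case False
  then have lt: "p < q" using pq by simp
  define r where "r = 1 / (1 / p - 1 / q)"
  note r = lr_ball_gap[OF pq(1) lt, folded r_def]
  define A where "A = (\<Sum>k<n. a k powr (q / p))"
  show ?thesis
  proof (cases "A = 0")
    case True
    then show ?thesis using zero_in_lr_ball pq by (intro bexI[of _ "\<lambda>_. 0"]) (auto simp: A_def)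
  next
    case False
    then have A: "0 < A" using sum_nonneg[of "{..<n}" "\<lambda>k. a k powr (q / p)"] by (simp add: A_def)
    define \<beta> where "\<beta> k = (a k powr (q / p) / A) powr (1 / r)" for k
    have "(\<Sum>k<n. \<bar>\<beta> k\<bar> powr r) = (\<Sum>k<n. a k powr (q / p) / A)"
      using r(1) A by (simp add: \<beta>_def powr_powr)
    also have "\<dots> = 1" using A by (simp add: A_def flip: sum_divide_distrib)
    finally have \<beta>: "\<beta> \<in> lr_ball (gap_exponent p q) n" using r(3) by simp
    have summand: "\<bar>\<beta> k\<bar> powr p * a k = a k powr (q / p) / A powr (1 - p / q)" if "k < n" for k
    proof -
      have "\<bar>\<beta> k\<bar> powr p = (a k powr (q / p) / A) powr (p / r)"
        using r(1) by (simp add: \<beta>_def powr_powr)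
      also have "\<dots> = a k powr ((q / p) * (1 - p / q)) / A powr (1 - p / q)"
        unfolding r(2) using A by (simp add: powr_divide powr_powr)
      also have "(q / p) * (1 - p / q) = q / p - 1" using pq by (simp add: right_diff_distrib)
      finally have "\<bar>\<beta> k\<bar> powr p * a k = (a k powr (q / p - 1) * a k powr 1) / A powr (1 - p / q)"
        using a[OF that] by simp
      also have "a k powr (q / p - 1) * a k powr 1 = a k powr (q / p)"
        by (simp only: powr_add[symmetric]) simp
      finally show ?thesis .
    qed
    have "(\<Sum>k<n. \<bar>\<beta> k\<bar> powr p * a k) = A / A powr (1 - p / q)"
      unfolding A_def sum_divide_distrib using summand by (intro sum.cong) (auto simp: A_def)
    also have "\<dots> = A powr (1 - (1 - p / q))" using A by (simp only: powr_diff) simp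
    finally have "(\<Sum>k<n. \<bar>\<beta> k\<bar> powr p * a k) = A powr (p / q)" by simp
    then show ?thesis using \<beta> unfolding A_def by (intro bexI[of _ \<beta>]) auto
  qed
qed

section \<open>The concavification\<close>

locale convex_lattice =
  fixes M :: "'a measure" and X :: "'a function_space" and p :: real
  assumes p: "1 \<le> p"
    and lattice: "banach_function_lattice M X"
    and order_cont: "order_continuous M X"
    and convex: "p_convex p X"
begin

abbreviation "V \<equiv> concavification M p X"

lemma sf: "sigma_finite_measure M"
  using lattice by (simp add: banach_function_lattice_def)

lemma X_measurable [measurable_dest]: "f \<in> elems X \<Longrightarrow> f \<in> borel_measurable M"
  and X_zero: "(\<lambda>_. 0) \<in> elems X"
  and X_add: "f \<in> elems X \<Longrightarrow> g \<in> elems X \<Longrightarrow> (\<lambda>\<omega>. f \<omega> + g \<omega>) \<in> elems X"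
  and X_triangle: "f \<in> elems X \<Longrightarrow> g \<in> elems X \<Longrightarrow> fnorm X (\<lambda>\<omega>. f \<omega> + g \<omega>) \<le> fnorm X f + fnorm X g"
  and X_scale: "f \<in> elems X \<Longrightarrow> (\<lambda>\<omega>. c * f \<omega>) \<in> elems X"
  and X_norm_scale: "f \<in> elems X \<Longrightarrow> fnorm X (\<lambda>\<omega>. c * f \<omega>) = \<bar>c\<bar> * fnorm X f"
  and X_nonneg: "f \<in> elems X \<Longrightarrow> 0 \<le> fnorm X f"
  and X_eq_0: "f \<in> elems X \<Longrightarrow> fnorm X f = 0 \<longleftrightarrow> (AE \<omega> in M. f \<omega> = 0)"
  using lattice by (auto simp: banach_function_lattice_def normed_function_space_def)

lemma X_ideal:
  assumes "f \<in> borel_measurable M" "g \<in> elems X" "AE \<omega> in M. \<bar>f \<omega>\<bar> \<le> \<bar>g \<omega>\<bar>"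
  shows "f \<in> elems X" "fnorm X f \<le> fnorm X g"
  using lattice assms by (auto simp: banach_function_lattice_def)

lemma X_subspace: "function_subspace (elems X)"
  unfolding function_subspace_def using X_zero X_add X_scale by blast

lemma X_abs: "f \<in> elems X \<Longrightarrow> (\<lambda>\<omega>. \<bar>f \<omega>\<bar>) \<in> elems X" "f \<in> elems X \<Longrightarrow> fnorm X (\<lambda>\<omega>. \<bar>f \<omega>\<bar>) = fnorm X f"
proof -
  assume f: "f \<in> elems X"
  note [measurable] = X_measurable[OF f]
  show a: "(\<lambda>\<omega>. \<bar>f \<omega>\<bar>) \<in> elems X" by (rule X_ideal(1)[OF _ f]) auto
  show "fnorm X (\<lambda>\<omega>. \<bar>f \<omega>\<bar>) = fnorm X f"
    using X_ideal(2)[OF _ f, of "\<lambda>\<omega>. \<bar>f \<omega>\<bar>"] X_ideal(2)[OF _ a, of f] by auto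
qed

lemma X_sum:
  assumes "finite I" "\<And>i. i \<in> I \<Longrightarrow> f i \<in> elems X"
  shows "(\<lambda>\<omega>. \<Sum>i\<in>I. f i \<omega>) \<in> elems X \<and> fnorm X (\<lambda>\<omega>. \<Sum>i\<in>I. f i \<omega>) \<le> (\<Sum>i\<in>I. fnorm X (f i))"
  using assms
proof (induction I rule: finite_induct)
  case empty
  then show ?case using X_zero X_eq_0[OF X_zero] by simp
next
  case (insert i I)
  then show ?case
    using X_add[of "f i" "\<lambda>\<omega>. \<Sum>i\<in>I. f i \<omega>"] X_triangle[of "f i" "\<lambda>\<omega>. \<Sum>i\<in>I. f i \<omega>"]
    by force
qed

lemma X_complete:
  fixes u :: "nat \<Rightarrow> 'a \<Rightarrow> real"
  assumes "\<And>n. u n \<in> elems X" "\<And>e. 0 < e \<Longrightarrow> \<exists>K. \<forall>m\<ge>K. \<forall>n\<ge>K. fnorm X (\<lambda>\<omega>. u m \<omega> - u n \<omega>) < e"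
  shows "\<exists>f\<in>elems X. (\<lambda>n. fnorm X (\<lambda>\<omega>. u n \<omega> - f \<omega>)) \<longlonglongrightarrow> 0"
  using lattice assms unfolding banach_function_lattice_def complete_function_space_def by blast

text \<open>Exhaustion by the sets on which some member of \<open>X\<close> has no zeros; full
  support makes every set of positive measure meet one. For countable unions a weighted series of
  absolute values is summed by completeness.\<close>

lemma X_ex_unit: "\<exists>g\<in>elems X. \<forall>\<omega>\<in>space M. 0 < g \<omega>"
proof -
  interpret sigma_finite_measure M by (rule sf)
  define P where "P B \<longleftrightarrow> B \<in> sets M \<and> (\<exists>f\<in>elems X. AE \<omega> in M. \<omega> \<in> B \<longrightarrow> f \<omega> \<noteq> 0)" for B
  obtain B where B: "P B" "AE \<omega> in M. \<omega> \<in> B"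
  proof (rule ex_AE_cover[of P])
    show "P {}" using X_zero by (auto simp: P_def)
    show "B \<in> sets M" if "P B" for B using that by (simp add: P_def)
    show "\<exists>B. P B \<and> 0 < emeasure M (A \<inter> B)" if A: "A \<in> sets M" "0 < emeasure M A" for A
    proof -
      obtain f where f: "f \<in> elems X" "\<not> (AE \<omega> in M. \<omega> \<in> A \<longrightarrow> f \<omega> = 0)"
        using lattice A unfolding banach_function_lattice_def by blast
      note [measurable] = X_measurable[OF f(1)]
      define B where "B = {\<omega> \<in> space M. f \<omega> \<noteq> 0}"
      have B: "B \<in> sets M" unfolding B_def by measurable
      then have "P B" unfolding P_def using f(1) by (auto simp: B_def intro!: bexI[of _ f])
      moreover have "emeasure M (A \<inter> B) \<noteq> 0"
      proof
        assume "emeasure M (A \<inter> B) = 0"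
        then have "A \<inter> B \<in> null_sets M" using A(1) B by (intro null_setsI) auto
        from AE_not_in[OF this] have "AE \<omega> in M. \<omega> \<in> A \<longrightarrow> f \<omega> = 0"
          using AE_space by eventually_elim (auto simp: B_def)
        with f(2) show False by simp
      qed
      ultimately show ?thesis by (auto simp: zero_less_iff_neq_zero)
    qed
    show "P (\<Union>i. A i)" if A: "\<And>i. P (A i)" for A :: "nat \<Rightarrow> 'a set"
    proof -
      obtain f where f: "\<And>i. f i \<in> elems X" "\<And>i. AE \<omega> in M. \<omega> \<in> A i \<longrightarrow> f i \<omega> \<noteq> 0"
        using A unfolding P_def by metis
      \<comment> \<open>These weights give the terms norm at most \<open>(1/2) ^ i\<close>; the 1 in
        the denominator avoids division by 0.\<close>
      define a where "a i = (1/2) ^ i / (1 + fnorm X (f i))" for i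
      have a: "0 < a i" "a i * fnorm X (f i) \<le> (1/2) ^ i" for i
        using X_nonneg[OF f(1)[of i]] by (auto simp: a_def divide_simps add_pos_nonneg)
      define t where "t i = (\<lambda>\<omega>. a i * \<bar>f i \<omega>\<bar>)" for i
      have t: "t i \<in> elems X" "fnorm X (t i) \<le> (1/2) ^ i" "0 \<le> t i \<omega>" for i \<omega>
        using X_scale[OF X_abs(1)[OF f(1)]] X_norm_scale[OF X_abs(1)[OF f(1)], of "a i" i]
          X_abs(2)[OF f(1)] a[of i] by (auto simp: t_def)
      define s where "s n = (\<lambda>\<omega>. \<Sum>i<n. t i \<omega>)" for n
      have s: "s n \<in> elems X" for n using X_sum[of "{..<n}" t] t(1) by (simp add: s_def)
      have s_diff: "fnorm X (\<lambda>\<omega>. s m \<omega> - s n \<omega>) \<le> 2 * (1/2) ^ n" if "n \<le> m" for m n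
      proof -
        have "(\<lambda>\<omega>. s m \<omega> - s n \<omega>) = (\<lambda>\<omega>. \<Sum>i\<in>{n..<m}. t i \<omega>)"
          using that by (simp add: s_def sum_diff_nat_ivl atLeast0LessThan[symmetric])
        then have "fnorm X (\<lambda>\<omega>. s m \<omega> - s n \<omega>) \<le> (\<Sum>i\<in>{n..<m}. fnorm X (t i))"
          using X_sum[of "{n..<m}" t] t(1) by simp
        also have "\<dots> \<le> (\<Sum>i\<in>{n..<m}. (1/2) ^ i)" by (intro sum_mono t)
        also have "\<dots> \<le> 2 * (1/2) ^ n"
        proof -
          have "(\<Sum>i\<in>{n..<m}. (1/2::real) ^ i) = 2 * (1/2) ^ n - 2 * (1/2) ^ m"
            using that by (induction m rule: dec_induct) (simp_all add: algebra_simps)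
          then show ?thesis by simp
        qed
        finally show ?thesis .
      qed
      have X_uminus: "fnorm X (\<lambda>\<omega>. u \<omega> - v \<omega>) = fnorm X (\<lambda>\<omega>. v \<omega> - u \<omega>)"
        if "u \<in> elems X" "v \<in> elems X" for u v
        using X_norm_scale[OF function_subspaceD(5)[OF X_subspace that], of "-1"] by simp
      have "\<exists>g\<in>elems X. (\<lambda>n. fnorm X (\<lambda>\<omega>. s n \<omega> - g \<omega>)) \<longlonglongrightarrow> 0"
      proof (rule X_complete[OF s])
        fix e :: real assume "0 < e"
        then obtain K where K: "(1/2) ^ K < e / 2"
          using real_arch_pow_inv[of "e / 2" "1 / 2"] by auto
        have "fnorm X (\<lambda>\<omega>. s m \<omega> - s n \<omega>) < e" if "K \<le> m" "K \<le> n" for m n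
        proof -
          have *: "fnorm X (\<lambda>\<omega>. s m \<omega> - s n \<omega>) < e" if "K \<le> n" "n \<le> m" for m n
          proof -
            have "(1/2::real) ^ n \<le> (1/2) ^ K" using that by (intro power_decreasing) auto
            then show ?thesis using s_diff[OF that(2)] K by linarith
          qed
          show ?thesis
            using *[of n m] *[of m n] that X_uminus[OF s s, of m n] by (cases "n \<le> m") auto
        qed
        then show "\<exists>K. \<forall>m\<ge>K. \<forall>n\<ge>K. fnorm X (\<lambda>\<omega>. s m \<omega> - s n \<omega>) < e" by blast
      qed
      then obtain g where g: "g \<in> elems X" "(\<lambda>n. fnorm X (\<lambda>\<omega>. s n \<omega> - g \<omega>)) \<longlonglongrightarrow> 0" by blast
      note [measurable] = X_measurable[OF g(1)] X_measurable[OF s]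
      \<comment> \<open>Norm convergence gives domination directly: for each
        \<open>m \<ge> n\<close> the positive part of \<open>s n - g\<close> is below the absolute
        value of \<open>s m - g\<close>, whose norm tends to 0.\<close>
      have "AE \<omega> in M. s n \<omega> \<le> g \<omega>" for n
      proof -
        let ?d = "\<lambda>\<omega>. max 0 (s n \<omega> - g \<omega>)"
        have d: "?d \<in> elems X \<and> fnorm X ?d \<le> fnorm X (\<lambda>\<omega>. s m \<omega> - g \<omega>)" if "n \<le> m" for m
        proof -
          have "s n \<omega> \<le> s m \<omega>" for \<omega>
            unfolding s_def using that t(3) by (intro sum_mono2) auto
          then have "AE \<omega> in M. \<bar>?d \<omega>\<bar> \<le> \<bar>s m \<omega> - g \<omega>\<bar>" by (intro AE_I2) (smt (verit))
          then show ?thesis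
            using X_ideal[OF _ function_subspaceD(5)[OF X_subspace s g(1)], of ?d m] by auto
        qed
        then have "fnorm X ?d \<le> 0"
          using g(2) by (intro LIMSEQ_le_const[OF g(2)]) auto
        then have "AE \<omega> in M. ?d \<omega> = 0" using d[of n] X_nonneg[of ?d] X_eq_0[of ?d] by simp
        then show ?thesis by eventually_elim (auto simp: max_def split: if_splits)
      qed
      then have "AE \<omega> in M. \<forall>n. s n \<omega> \<le> g \<omega>" by (simp add: AE_all_countable)
      moreover have "AE \<omega> in M. \<forall>i. \<omega> \<in> A i \<longrightarrow> f i \<omega> \<noteq> 0" using f(2) by (simp add: AE_all_countable)
      ultimately have "AE \<omega> in M. \<omega> \<in> (\<Union>i. A i) \<longrightarrow> g \<omega> \<noteq> 0"
      proof eventually_elim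
        case (elim \<omega>)
        show ?case
        proof
          assume "\<omega> \<in> (\<Union>i. A i)"
          then obtain i where "\<omega> \<in> A i" by blast
          then have "0 < t i \<omega>" using elim(2) a(1) by (simp add: t_def)
          also have "t i \<omega> \<le> s (Suc i) \<omega>" unfolding s_def using t(3) by (intro member_le_sum) auto
          also have "\<dots> \<le> g \<omega>" using elim(1) by blast
          finally show "g \<omega> \<noteq> 0" by simp
        qed
      qed
      moreover have "(\<Union>i. A i) \<in> sets M" using A by (auto simp: P_def)
      ultimately show ?thesis unfolding P_def using g(1) by (intro conjI bexI[of _ g])
    qed
  qed
  obtain f where f: "f \<in> elems X" "AE \<omega> in M. \<omega> \<in> B \<longrightarrow> f \<omega> \<noteq> 0" using B(1) by (auto simp: P_def)
  note [measurable] = X_measurable[OF f(1)]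
  \<comment> \<open>A change on a null set makes the function positive at every point.\<close>
  define g where "g \<omega> = (if f \<omega> = 0 then 1 else \<bar>f \<omega>\<bar>)" for \<omega>
  have "AE \<omega> in M. \<bar>g \<omega>\<bar> \<le> \<bar>f \<omega>\<bar>" using f(2) B(2) by eventually_elim (simp add: g_def)
  then have "g \<in> elems X" by (intro X_ideal(1)[OF _ f(1)]) (simp_all add: g_def[abs_def])
  moreover have "0 < g \<omega>" for \<omega> by (simp add: g_def)
  ultimately show ?thesis by blast
qed

section \<open>The concavification as a normed ideal\<close>

lemma V_iff: "f \<in> elems V \<longleftrightarrow> f \<in> borel_measurable M \<and> (\<lambda>\<omega>. \<bar>f \<omega>\<bar> powr (1 / p)) \<in> elems X"
  by (simp add: concavification_def)

lemma V_norm: "fnorm V f = fnorm X (\<lambda>\<omega>. \<bar>f \<omega>\<bar> powr (1 / p)) powr p"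
  by (simp add: concavification_def)

lemma powr_in_V:
  assumes "x \<in> elems X"
  shows "(\<lambda>\<omega>. \<bar>x \<omega>\<bar> powr p) \<in> elems V" "fnorm V (\<lambda>\<omega>. \<bar>x \<omega>\<bar> powr p) = fnorm X x powr p"
  using X_abs[OF assms] X_measurable[OF assms] p by (simp_all add: V_iff V_norm powr_powr)

lemma V_ideal:
  assumes f: "f \<in> borel_measurable M" and g: "g \<in> elems V" and le: "AE \<omega> in M. \<bar>f \<omega>\<bar> \<le> \<bar>g \<omega>\<bar>"
  shows "f \<in> elems V \<and> fnorm V f \<le> fnorm V g"
proof -
  have "AE \<omega> in M. \<bar>\<bar>f \<omega>\<bar> powr (1 / p)\<bar> \<le> \<bar>\<bar>g \<omega>\<bar> powr (1 / p)\<bar>"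
    using le by eventually_elim (use p in \<open>auto intro: powr_mono2\<close>)
  from X_ideal[OF _ _ this] f g have x: "(\<lambda>\<omega>. \<bar>f \<omega>\<bar> powr (1 / p)) \<in> elems X"
    "fnorm X (\<lambda>\<omega>. \<bar>f \<omega>\<bar> powr (1 / p)) \<le> fnorm X (\<lambda>\<omega>. \<bar>g \<omega>\<bar> powr (1 / p))"
    by (auto simp: V_iff)
  then show ?thesis using f p X_nonneg[OF x(1)] by (auto simp: V_iff V_norm intro!: powr_mono2)
qed

text \<open>The triangle inequality is \<open>p\<close>-convexity with constant 1, applied to the
  two functions \<open>\<bar>f \<omega>\<bar> powr (1 / p)\<close> and
  \<open>\<bar>g \<omega>\<bar> powr (1 / p)\<close> and raised to the power
  \<open>p\<close>.\<close>

lemma V_normed: "normed_function_space M V"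
  unfolding normed_function_space_def
proof (intro conjI ballI allI)
  show "elems V \<subseteq> borel_measurable M" by (auto simp: V_iff)
  show "(\<lambda>_. 0) \<in> elems V" using X_zero by (simp add: V_iff)
  fix f assume f: "f \<in> elems V"
  let ?x = "\<lambda>\<omega>. \<bar>f \<omega>\<bar> powr (1 / p)"
  have x: "?x \<in> elems X" and fm[measurable]: "f \<in> borel_measurable M" using f by (auto simp: V_iff)
  show "(\<lambda>\<omega>. c * f \<omega>) \<in> elems V" "fnorm V (\<lambda>\<omega>. c * f \<omega>) = \<bar>c\<bar> * fnorm V f" for c
    using X_scale[OF x, of "\<bar>c\<bar> powr (1 / p)"] X_norm_scale[OF x, of "\<bar>c\<bar> powr (1 / p)"] p X_nonneg[OF x]
    by (simp_all add: V_iff V_norm abs_mult powr_mult powr_powr)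
  show "0 \<le> fnorm V f" by (simp add: V_norm)
  show "fnorm V f = 0 \<longleftrightarrow> (AE \<omega> in M. f \<omega> = 0)" using X_eq_0[OF x] by (simp add: V_norm)
  fix g assume g: "g \<in> elems V"
  let ?y = "\<lambda>\<omega>. \<bar>g \<omega>\<bar> powr (1 / p)"
  have y: "?y \<in> elems X" and gm[measurable]: "g \<in> borel_measurable M" using g by (auto simp: V_iff)
  let ?z = "\<lambda>\<omega>. (\<bar>f \<omega>\<bar> + \<bar>g \<omega>\<bar>) powr (1 / p)"
  have "fnorm X (\<lambda>\<omega>. (\<Sum>k<2::nat. \<bar>(if k = 0 then ?x else ?y) \<omega>\<bar> powr p) powr (1 / p))
      \<le> (\<Sum>k<2::nat. fnorm X (if k = 0 then ?x else ?y) powr p) powr (1 / p)"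
    using convex[unfolded p_convex_def, rule_format, of 2 "\<lambda>k. if k = 0 then ?x else ?y"] x y by simp
  then have z_le: "fnorm X ?z \<le> (fnorm X ?x powr p + fnorm X ?y powr p) powr (1 / p)"
    using p by (simp add: numeral_2_eq_2 powr_powr)
  \<comment> \<open>Convexity bounds a norm but does not assert membership, so a crude pointwise
    majorant in \<open>X\<close> is supplied.\<close>
  have z: "?z \<in> elems X"
  proof (rule X_ideal(1))
    show "(\<lambda>\<omega>. 2 * (?x \<omega> + ?y \<omega>)) \<in> elems X" by (rule X_scale[OF X_add[OF x y]])
    show "AE \<omega> in M. \<bar>?z \<omega>\<bar> \<le> \<bar>2 * (?x \<omega> + ?y \<omega>)\<bar>"
    proof (rule AE_I2)
      fix \<omega>
      let ?m = "max \<bar>f \<omega>\<bar> \<bar>g \<omega>\<bar>"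
      have "?z \<omega> \<le> (2 * ?m) powr (1 / p)" using p by (intro powr_mono2) auto
      also have "\<dots> = 2 powr (1 / p) * ?m powr (1 / p)" by (simp add: powr_mult)
      also have "\<dots> \<le> 2 powr 1 * ?m powr (1 / p)" using p by (intro mult_right_mono powr_mono) auto
      also have "\<dots> \<le> 2 * (?x \<omega> + ?y \<omega>)" by (auto simp: max_def)
      finally show "\<bar>?z \<omega>\<bar> \<le> \<bar>2 * (?x \<omega> + ?y \<omega>)\<bar>" by simp
    qed
  qed measurable
  have "AE \<omega> in M. \<bar>\<bar>f \<omega> + g \<omega>\<bar> powr (1 / p)\<bar> \<le> \<bar>?z \<omega>\<bar>"
    using p by (intro AE_I2) (auto intro!: powr_mono2)
  from X_ideal[OF _ z this]
  have fg: "(\<lambda>\<omega>. \<bar>f \<omega> + g \<omega>\<bar> powr (1 / p)) \<in> elems X"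
    "fnorm X (\<lambda>\<omega>. \<bar>f \<omega> + g \<omega>\<bar> powr (1 / p)) \<le> fnorm X ?z" by auto
  then show "(\<lambda>\<omega>. f \<omega> + g \<omega>) \<in> elems V" by (simp add: V_iff)
  have "fnorm V (\<lambda>\<omega>. f \<omega> + g \<omega>) \<le> ((fnorm X ?x powr p + fnorm X ?y powr p) powr (1 / p)) powr p"
    unfolding V_norm using p fg z_le X_nonneg[OF fg(1)] by (intro powr_mono2) auto
  also have "\<dots> = fnorm V f + fnorm V g" using p by (simp add: powr_powr V_norm)
  finally show "fnorm V (\<lambda>\<omega>. f \<omega> + g \<omega>) \<le> fnorm V f + fnorm V g" .
qed

text \<open>A sequence that decreases to 0 almost everywhere is nonnegative, so taking absolute
  values and roots leaves it decreasing to 0.\<close>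

lemma V_order_continuous: "order_continuous M V"
  unfolding order_continuous_def
proof (intro allI impI, elim conjE)
  fix u :: "nat \<Rightarrow> 'a \<Rightarrow> real"
  assume u: "\<forall>n. u n \<in> elems V" and dec: "\<forall>n. AE \<omega> in M. u (Suc n) \<omega> \<le> u n \<omega>"
    and lim: "AE \<omega> in M. (\<lambda>n. u n \<omega>) \<longlonglongrightarrow> 0"
  have dec': "AE \<omega> in M. \<forall>n. u (Suc n) \<omega> \<le> u n \<omega>" using dec by (simp add: AE_all_countable)
  have nn: "AE \<omega> in M. \<forall>n. 0 \<le> u n \<omega>"
    using dec' lim
  proof eventually_elim
    case (elim \<omega>)
    have "decseq (\<lambda>n. u n \<omega>)" using elim(1) by (simp add: decseq_Suc_iff)
    then show ?case using decseq_ge[OF _ elim(2)] by blast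
  qed
  have "(\<lambda>n. fnorm X (\<lambda>\<omega>. \<bar>u n \<omega>\<bar> powr (1 / p))) \<longlonglongrightarrow> 0"
  proof (rule order_cont[unfolded order_continuous_def, rule_format], intro conjI allI)
    show "(\<lambda>\<omega>. \<bar>u n \<omega>\<bar> powr (1 / p)) \<in> elems X" for n using u by (simp add: V_iff)
    show "AE \<omega> in M. \<bar>u (Suc n) \<omega>\<bar> powr (1 / p) \<le> \<bar>u n \<omega>\<bar> powr (1 / p)" for n
      using dec' nn by eventually_elim (use p in \<open>auto intro!: powr_mono2\<close>)
    show "AE \<omega> in M. (\<lambda>n. \<bar>u n \<omega>\<bar> powr (1 / p)) \<longlonglongrightarrow> 0"
      using lim
    proof eventually_elim
      case (elim \<omega>)
      have "(\<lambda>n. \<bar>u n \<omega>\<bar> powr (1 / p)) \<longlonglongrightarrow> \<bar>0\<bar> powr (1 / p)"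
        using p by (intro tendsto_powr' tendsto_rabs elim tendsto_const) auto
      then show ?case by simp
    qed
  qed
  then have "(\<lambda>n. fnorm X (\<lambda>\<omega>. \<bar>u n \<omega>\<bar> powr (1 / p)) powr p) \<longlonglongrightarrow> 0 powr p"
    using p u X_nonneg by (intro tendsto_powr' tendsto_const) (auto simp: V_iff)
  then show "(\<lambda>n. fnorm V (u n)) \<longlonglongrightarrow> 0" by (simp add: V_norm)
qed

sublocale order_continuous_lattice M V
proof (rule order_continuous_lattice.intro)
  show "sigma_finite_measure M" by (rule sf)
  show "normed_function_space M V" by (rule V_normed)
  show "\<And>f g. f \<in> borel_measurable M \<Longrightarrow> g \<in> elems V \<Longrightarrow>
      (AE \<omega> in M. \<bar>f \<omega>\<bar> \<le> \<bar>g \<omega>\<bar>) \<Longrightarrow> f \<in> elems V \<and> fnorm V f \<le> fnorm V g" by (rule V_ideal)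
  show "order_continuous M V" by (rule V_order_continuous)
  obtain g where "g \<in> elems X" "\<forall>\<omega>\<in>space M. 0 < g \<omega>" using X_ex_unit by blast
  then show "\<exists>g\<in>elems V. \<forall>\<omega>\<in>space M. 0 < g \<omega>"
    using powr_in_V(1) by (intro bexI[of _ "\<lambda>\<omega>. \<bar>g \<omega>\<bar> powr p"]) auto
qed

end

section \<open>Suprema over sequence balls as suprema over the Koethe ball\<close>

context convex_lattice
begin

lemma sum_powr_in_V:
  fixes n :: nat
  assumes x: "\<And>k. k < n \<Longrightarrow> x k \<in> elems X"
  shows "(\<lambda>\<omega>. \<Sum>k<n. \<bar>\<beta> k * x k \<omega>\<bar> powr p) \<in> E"
    and "fnorm X (\<lambda>\<omega>. (\<Sum>k<n. \<bar>\<beta> k * x k \<omega>\<bar> powr p) powr (1 / p)) powr p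
      = N (\<lambda>\<omega>. \<Sum>k<n. \<bar>\<beta> k * x k \<omega>\<bar> powr p)"
    and "h \<in> \<K> \<Longrightarrow> (\<integral>\<omega>. (\<Sum>k<n. \<bar>\<beta> k * x k \<omega>\<bar> powr p) * h \<omega> \<partial>M)
      = (\<Sum>k<n. \<bar>\<beta> k\<bar> powr p * (\<integral>\<omega>. \<bar>x k \<omega>\<bar> powr p * h \<omega> \<partial>M))"
    and "0 \<le> fnorm X (\<lambda>\<omega>. (\<Sum>k<n. \<bar>\<beta> k * x k \<omega>\<bar> powr p) powr (1 / p))"
proof -
  have b: "(\<lambda>\<omega>. \<bar>\<beta> k * x k \<omega>\<bar> powr p) \<in> E" if "k < n" for k
    by (rule powr_in_V(1)[OF X_scale[OF x[OF that]]])
  have sum_E: "(\<lambda>\<omega>. \<Sum>k\<in>A. \<bar>\<beta> k * x k \<omega>\<bar> powr p) \<in> E" if "finite A" "A \<subseteq> {..<n}" for A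
    using that
  proof (induction A rule: finite_induct)
    case (insert k A)
    then show ?case using E_add[OF b[of k], of "\<lambda>\<omega>. \<Sum>k\<in>A. \<bar>\<beta> k * x k \<omega>\<bar> powr p"] by simp
  qed (simp add: E_zero)
  show E: "(\<lambda>\<omega>. \<Sum>k<n. \<bar>\<beta> k * x k \<omega>\<bar> powr p) \<in> E" by (rule sum_E) auto
  have abs: "\<bar>\<Sum>k<n. \<bar>\<beta> k * x k \<omega>\<bar> powr p\<bar> = (\<Sum>k<n. \<bar>\<beta> k * x k \<omega>\<bar> powr p)" for \<omega>
    by (simp add: sum_nonneg)
  show "fnorm X (\<lambda>\<omega>. (\<Sum>k<n. \<bar>\<beta> k * x k \<omega>\<bar> powr p) powr (1 / p)) powr p
      = N (\<lambda>\<omega>. \<Sum>k<n. \<bar>\<beta> k * x k \<omega>\<bar> powr p)"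
    by (simp add: V_norm abs)
  show "0 \<le> fnorm X (\<lambda>\<omega>. (\<Sum>k<n. \<bar>\<beta> k * x k \<omega>\<bar> powr p) powr (1 / p))"
    using E X_nonneg by (simp add: V_iff abs)
  assume h: "h \<in> \<K>"
  have "(\<integral>\<omega>. (\<Sum>k<n. \<bar>\<beta> k * x k \<omega>\<bar> powr p) * h \<omega> \<partial>M)
      = (\<Sum>k<n. \<integral>\<omega>. \<bar>\<beta> k * x k \<omega>\<bar> powr p * h \<omega> \<partial>M)"
    unfolding sum_distrib_right using \<K>_integrable[OF h b] by (intro Bochner_Integration.integral_sum) auto
  also have "\<dots> = (\<Sum>k<n. \<bar>\<beta> k\<bar> powr p * (\<integral>\<omega>. \<bar>x k \<omega>\<bar> powr p * h \<omega> \<partial>M))"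
    by (simp add: abs_mult powr_mult mult.assoc)
  finally show "(\<integral>\<omega>. (\<Sum>k<n. \<bar>\<beta> k * x k \<omega>\<bar> powr p) * h \<omega> \<partial>M)
      = (\<Sum>k<n. \<bar>\<beta> k\<bar> powr p * (\<integral>\<omega>. \<bar>x k \<omega>\<bar> powr p * h \<omega> \<partial>M))" .
qed

text \<open>Its supremum over the ball, to the power \<open>1 / q\<close>, is the supremum over the
  \<open>lr_ball\<close> in the concavity condition. The exchange is what turns concavity into a
  statement about functions on the ball; its two directions are \<open>lr_ball_norm_le\<close> and
  \<open>weak_sum_le_SUP_lr_ball\<close>.\<close>

definition weak_sum :: "real \<Rightarrow> nat \<Rightarrow> (nat \<Rightarrow> 'a \<Rightarrow> real) \<Rightarrow> ('a \<Rightarrow> real) \<Rightarrow> real" where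
  "weak_sum q n x h = (\<Sum>k<n. (\<integral>\<omega>. \<bar>x k \<omega>\<bar> powr p * h \<omega> \<partial>M) powr (q / p))"

lemma weak_sum_nonneg: "0 \<le> weak_sum q n x h"
  by (simp add: weak_sum_def sum_nonneg)

lemma powr_pairing_nonneg: "x \<in> elems X \<Longrightarrow> h \<in> \<K> \<Longrightarrow> 0 \<le> (\<integral>\<omega>. \<bar>x \<omega>\<bar> powr p * h \<omega> \<partial>M)"
  and powr_pairing_le: "x \<in> elems X \<Longrightarrow> h \<in> \<K> \<Longrightarrow> (\<integral>\<omega>. \<bar>x \<omega>\<bar> powr p * h \<omega> \<partial>M) \<le> fnorm X x powr p"
  using nn_integral_\<K>(2)[OF _ powr_in_V(1)] \<K>_le_N[OF _ powr_in_V(1)] powr_in_V(2) by force+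

lemma bdd_above_weak_sum:
  assumes "p \<le> q" "\<And>k. k < n \<Longrightarrow> x k \<in> elems X"
  shows "bdd_above (weak_sum q n x ` \<K>)"
proof (rule bdd_aboveI2)
  fix h assume "h \<in> \<K>"
  then show "weak_sum q n x h \<le> (\<Sum>k<n. (fnorm X (x k) powr p) powr (q / p))"
    unfolding weak_sum_def using assms p
    by (intro sum_mono powr_mono2 powr_pairing_nonneg powr_pairing_le) auto
qed

text \<open>A point \<open>h\<close> that norms the sum turns the norm into a linear expression in
  \<open>\<bar>\<beta> k\<bar> powr p\<close>, and Hoelder's inequality for the sequence ball bounds
  that.\<close>

lemma lr_ball_norm_le:
  assumes q: "p \<le> q" and x: "\<And>k. k < n \<Longrightarrow> x k \<in> elems X"
    and \<beta>: "\<beta> \<in> lr_ball (gap_exponent p q) n"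
  shows "fnorm X (\<lambda>\<omega>. (\<Sum>k<n. \<bar>\<beta> k * x k \<omega>\<bar> powr p) powr (1 / p))
    \<le> (SUP h\<in>\<K>. weak_sum q n x h) powr (1 / q)" (is "?G \<le> _")
proof -
  note s = sum_powr_in_V[where n=n and x=x and \<beta>=\<beta>, OF x]
  have nn: "0 \<le> (\<Sum>k<n. \<bar>\<beta> k * x k \<omega>\<bar> powr p)" for \<omega> by (simp add: sum_nonneg)
  obtain h where h: "h \<in> \<K>" "(\<integral>\<omega>. (\<Sum>k<n. \<bar>\<beta> k * x k \<omega>\<bar> powr p) * h \<omega> \<partial>M)
      = N (\<lambda>\<omega>. \<Sum>k<n. \<bar>\<beta> k * x k \<omega>\<bar> powr p)"
    using ex_norming[OF s(1) nn] by blast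
  have "?G powr p = (\<Sum>k<n. \<bar>\<beta> k\<bar> powr p * (\<integral>\<omega>. \<bar>x k \<omega>\<bar> powr p * h \<omega> \<partial>M))"
    using s(2) s(3)[of h] h by simp
  also have "\<dots> \<le> weak_sum q n x h powr (p / q)"
    unfolding weak_sum_def using x h(1) by (intro lr_ball_sum_le p q \<beta> powr_pairing_nonneg)
  also have "\<dots> \<le> (SUP h\<in>\<K>. weak_sum q n x h) powr (p / q)"
    using p q bdd_above_weak_sum[OF q x] h(1) weak_sum_nonneg
    by (intro powr_mono2 cSUP_upper) auto
  finally have "(?G powr p) powr (1 / p) \<le> ((SUP h\<in>\<K>. weak_sum q n x h) powr (p / q)) powr (1 / p)"
    using p by (intro powr_mono2) auto
  then show ?thesis using p s(4) by (simp add: powr_powr)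
qed

lemma bdd_above_lr_ball_norm:
  assumes q: "p \<le> q" and x: "\<And>k. k < n \<Longrightarrow> x k \<in> elems X"
  shows "bdd_above ((\<lambda>\<beta>. fnorm X (\<lambda>\<omega>. (\<Sum>k<n. \<bar>\<beta> k * x k \<omega>\<bar> powr p) powr (1 / p)))
    ` lr_ball (gap_exponent p q) n)"
  using lr_ball_norm_le[OF q x] by (rule bdd_aboveI2)

lemma SUP_lr_ball_le:
  assumes q: "p \<le> q" and x: "\<And>k. k < n \<Longrightarrow> x k \<in> elems X"
  shows "(SUP \<beta>\<in>lr_ball (gap_exponent p q) n.
      fnorm X (\<lambda>\<omega>. (\<Sum>k<n. \<bar>\<beta> k * x k \<omega>\<bar> powr p) powr (1 / p)))
    \<le> (SUP h\<in>\<K>. weak_sum q n x h) powr (1 / q)"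
  using zero_in_lr_ball by (intro cSUP_least lr_ball_norm_le[OF q x]) auto

lemma SUP_lr_ball_nonneg:
  assumes q: "p \<le> q" and x: "\<And>k. k < n \<Longrightarrow> x k \<in> elems X"
  shows "0 \<le> (SUP \<beta>\<in>lr_ball (gap_exponent p q) n.
      fnorm X (\<lambda>\<omega>. (\<Sum>k<n. \<bar>\<beta> k * x k \<omega>\<bar> powr p) powr (1 / p)))"
  by (rule order_trans[OF sum_powr_in_V(4)[where n=n and x=x and \<beta>="\<lambda>_. 0", OF x]
        cSUP_upper[OF zero_in_lr_ball bdd_above_lr_ball_norm[OF q x]]])

text \<open>For fixed \<open>h\<close>, choose the extremal \<open>\<beta>\<close> for its pairings;
  the resulting sum is the pairing of \<open>h\<close> with one function, hence at most its
  norm.\<close>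

lemma weak_sum_le_SUP_lr_ball:
  assumes q: "p \<le> q" and x: "\<And>k. k < n \<Longrightarrow> x k \<in> elems X" and h: "h \<in> \<K>"
  shows "weak_sum q n x h \<le> (SUP \<beta>\<in>lr_ball (gap_exponent p q) n.
      fnorm X (\<lambda>\<omega>. (\<Sum>k<n. \<bar>\<beta> k * x k \<omega>\<bar> powr p) powr (1 / p))) powr q" (is "_ \<le> ?U powr q")
proof -
  obtain \<beta> where \<beta>: "\<beta> \<in> lr_ball (gap_exponent p q) n"
    "weak_sum q n x h powr (p / q) \<le> (\<Sum>k<n. \<bar>\<beta> k\<bar> powr p * (\<integral>\<omega>. \<bar>x k \<omega>\<bar> powr p * h \<omega> \<partial>M))"
    using lr_ball_sum_attained[OF p q, of n "\<lambda>k. \<integral>\<omega>. \<bar>x k \<omega>\<bar> powr p * h \<omega> \<partial>M"]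
      powr_pairing_nonneg[OF x h] unfolding weak_sum_def by blast
  let ?G = "fnorm X (\<lambda>\<omega>. (\<Sum>k<n. \<bar>\<beta> k * x k \<omega>\<bar> powr p) powr (1 / p))"
  note s = sum_powr_in_V[where n=n and x=x and \<beta>=\<beta>, OF x]
  have "weak_sum q n x h powr (p / q) \<le> ?G powr p"
    using \<beta>(2) s(2) s(3)[of h] \<K>_le_N[OF h s(1)] h by simp
  also have "\<dots> \<le> ?U powr p"
    using p s(4) cSUP_upper[OF \<beta>(1) bdd_above_lr_ball_norm[OF q x]] by (intro powr_mono2) auto
  finally have "(weak_sum q n x h powr (p / q)) powr (q / p) \<le> (?U powr p) powr (q / p)"
    using p q by (intro powr_mono2) auto
  then show ?thesis using p q weak_sum_nonneg by (simp add: powr_powr)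
qed

end

section \<open>The space of mixed norms\<close>

locale S_lattice = convex_lattice M X p
  for M :: "'a measure" and X :: "'a function_space" and p :: real +
  fixes q :: real and \<nu> :: "('a \<Rightarrow> real) measure"
  assumes q: "p \<le> q" and \<nu>: "regular_borel_prob (koethe_pos_ball M V) \<nu>"
begin

lemma pq_pos: "0 < p" "0 < q" "1 \<le> q" "0 < q / p" "0 < p / q"
  using p q by auto

lemma space_\<nu>: "space \<nu> = \<K>" and prob_\<nu>: "prob_space \<nu>"
  using \<nu> by (auto simp: regular_borel_prob_def)

lemma pairing_measurable:
  assumes "f \<in> E"
  shows "(\<lambda>h. \<integral>\<omega>. f \<omega> * h \<omega> \<partial>M) \<in> borel_measurable \<nu>"
  by (rule regular_borel_prob_measurable[OF \<nu> continuous_map_pairing[OF assms]])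

section \<open>Inner and outer integrals of the mixed norm\<close>

definition I :: "('a \<Rightarrow> real) \<Rightarrow> ('a \<Rightarrow> real) \<Rightarrow> ennreal" where
  "I f h = (\<integral>\<^sup>+\<omega>. ennreal (\<bar>f \<omega>\<bar> powr p * h \<omega>) \<partial>M)"

definition J :: "('a \<Rightarrow> real) \<Rightarrow> ennreal" where
  "J f = (\<integral>\<^sup>+h. ennreal_power (I f h) (q / p) \<partial>\<nu>)"

abbreviation "Sn \<equiv> S_enorm M p q \<nu>"
abbreviation "\<S> \<equiv> S_space M p q \<nu>"

lemma Sn_eq: "Sn f = ennreal_power (J f) (1 / q)"
  by (simp add: S_enorm_def J_def I_def)

lemma Sn_le_iff: "0 \<le> e \<Longrightarrow> Sn f \<le> ennreal e \<longleftrightarrow> J f \<le> ennreal (e powr q)"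
  unfolding Sn_eq using pq_pos by (subst ennreal_power_le_iff) auto

lemma \<S>_iff: "f \<in> elems \<S> \<longleftrightarrow> f \<in> borel_measurable M \<and> Sn f < \<top>"
  by (simp add: S_space_def)

lemma \<S>_norm: "fnorm \<S> f = enn2real (Sn f)"
  by (simp add: S_space_def)

lemma \<S>_ennreal_norm: "f \<in> elems \<S> \<Longrightarrow> ennreal (fnorm \<S> f) = Sn f"
  by (simp add: \<S>_iff \<S>_norm)

lemma J_eq_norm: "f \<in> elems \<S> \<Longrightarrow> J f = ennreal (fnorm \<S> f powr q)"
proof -
  assume "f \<in> elems \<S>"
  then have "ennreal_power (ennreal (fnorm \<S> f)) q = ennreal_power (Sn f) q"
    by (simp add: \<S>_ennreal_norm)
  also have "\<dots> = J f" unfolding Sn_eq using pq_pos by (simp add: ennreal_power_power)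
  finally show ?thesis by (simp add: \<S>_norm)
qed

lemma I_mono_AE:
  assumes "AE \<omega> in M. \<bar>f \<omega>\<bar> \<le> \<bar>g \<omega>\<bar>"
  shows "I f h \<le> I g h"
  unfolding I_def
proof (rule nn_integral_mono_AE)
  show "AE \<omega> in M. ennreal (\<bar>f \<omega>\<bar> powr p * h \<omega>) \<le> ennreal (\<bar>g \<omega>\<bar> powr p * h \<omega>)"
    using assms
  proof eventually_elim
    case (elim \<omega>)
    then have "\<bar>f \<omega>\<bar> powr p \<le> \<bar>g \<omega>\<bar> powr p" using p by (intro powr_mono2) auto
    then show ?case by (simp add: ennreal_mult' mult_right_mono ennreal_leI)
  qed
qed

lemma J_mono_AE: "AE \<omega> in M. \<bar>f \<omega>\<bar> \<le> \<bar>g \<omega>\<bar> \<Longrightarrow> J f \<le> J g"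
  unfolding J_def using pq_pos by (intro nn_integral_mono ennreal_power_mono I_mono_AE) auto

lemma Sn_mono_AE: "AE \<omega> in M. \<bar>f \<omega>\<bar> \<le> \<bar>g \<omega>\<bar> \<Longrightarrow> Sn f \<le> Sn g"
  unfolding Sn_eq using pq_pos by (intro ennreal_power_mono J_mono_AE) auto

text \<open>For \<open>f\<close> outside \<open>X\<close> the pairing of
  \<open>\<bar>f \<omega>\<bar> powr p\<close> with \<open>h\<close> may be infinite and need not be
  continuous in \<open>h\<close>. The minima with \<open>real n * g \<omega>\<close> lie in
  \<open>E\<close> and increase to it, so \<open>I f\<close> is a countable supremum of continuous
  functions.\<close>

lemma ex_truncation:
  assumes [measurable]: "f \<in> borel_measurable M"
  shows "\<exists>F. (\<forall>n::nat. F n \<in> E) \<and> (\<forall>n. \<forall>\<omega>\<in>space M. 0 \<le> F n \<omega>) \<and>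
    (\<forall>h\<in>\<K>. I f h = (SUP n. ennreal (\<integral>\<omega>. F n \<omega> * h \<omega> \<partial>M)))"
proof -
  obtain g where g: "g \<in> E" "\<And>\<omega>. \<omega> \<in> space M \<Longrightarrow> 0 < g \<omega>" using unit by blast
  note [measurable] = E_measurable[OF g(1)]
  define F where "F n \<omega> = min (\<bar>f \<omega>\<bar> powr p) (real n * g \<omega>)" for n \<omega>
  have F_nonneg: "0 \<le> F n \<omega>" if "\<omega> \<in> space M" for n \<omega>
    using g(2)[OF that] by (simp add: F_def)
  have F_E: "F n \<in> E" for n
  proof (rule E_ideal(1)[OF _ E_scale[OF g(1), of "real n"]])
    show "F n \<in> borel_measurable M" unfolding F_def by measurable
    show "AE \<omega> in M. \<bar>F n \<omega>\<bar> \<le> \<bar>real n * g \<omega>\<bar>"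
    proof (rule AE_I2)
      fix \<omega> assume "\<omega> \<in> space M"
      then show "\<bar>F n \<omega>\<bar> \<le> \<bar>real n * g \<omega>\<bar>" using F_nonneg[of \<omega> n] by (simp add: F_def)
    qed
  qed
  have "I f h = (SUP n. ennreal (\<integral>\<omega>. F n \<omega> * h \<omega> \<partial>M))" if h: "h \<in> \<K>" for h
  proof -
    note [measurable] = \<K>_measurable[OF h] E_measurable[OF F_E]
    have mono: "F n \<omega> \<le> F m \<omega>" if "\<omega> \<in> space M" "n \<le> m" for n m \<omega>
      unfolding F_def using that g(2)[OF that(1)] by (intro min.mono mult_right_mono) auto
    have "I f h = (\<integral>\<^sup>+\<omega>. (SUP n. ennreal (F n \<omega> * h \<omega>)) \<partial>M)"
      unfolding I_def
    proof (rule nn_integral_cong)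
      fix \<omega> assume \<omega>: "\<omega> \<in> space M"
      show "ennreal (\<bar>f \<omega>\<bar> powr p * h \<omega>) = (SUP n. ennreal (F n \<omega> * h \<omega>))"
      proof (rule antisym)
        obtain n where "\<bar>f \<omega>\<bar> powr p / g \<omega> \<le> real n" using real_arch_simple by blast
        then have "F n \<omega> = \<bar>f \<omega>\<bar> powr p" using g(2)[OF \<omega>] by (simp add: F_def divide_le_eq)
        then show "ennreal (\<bar>f \<omega>\<bar> powr p * h \<omega>) \<le> (SUP n. ennreal (F n \<omega> * h \<omega>))"
          by (intro SUP_upper2[of n]) auto
        show "(SUP n. ennreal (F n \<omega> * h \<omega>)) \<le> ennreal (\<bar>f \<omega>\<bar> powr p * h \<omega>)"
        proof (rule SUP_least)
          fix n
          have "F n \<omega> \<le> \<bar>f \<omega>\<bar> powr p" by (simp add: F_def)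
          then show "ennreal (F n \<omega> * h \<omega>) \<le> ennreal (\<bar>f \<omega>\<bar> powr p * h \<omega>)"
            using F_nonneg[OF \<omega>] by (simp add: ennreal_mult' mult_right_mono ennreal_leI)
        qed
      qed
    qed
    also have "\<dots> = (SUP n. \<integral>\<^sup>+\<omega>. ennreal (F n \<omega> * h \<omega>) \<partial>M)"
    proof (rule nn_integral_monotone_convergence_SUP_AE)
      show "AE \<omega> in M. ennreal (F n \<omega> * h \<omega>) \<le> ennreal (F (Suc n) \<omega> * h \<omega>)" for n
        using F_nonneg mono[of _ n "Suc n"]
        by (intro AE_I2) (simp add: ennreal_mult' mult_right_mono ennreal_leI)
    qed simp
    also have "\<dots> = (SUP n. ennreal (\<integral>\<omega>. F n \<omega> * h \<omega> \<partial>M))"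
      using nn_integral_\<K>(1)[OF h F_E F_nonneg] by simp
    finally show ?thesis .
  qed
  then show ?thesis using F_E F_nonneg by (intro exI[of _ F]) simp
qed

lemma I_measurable [measurable]:
  assumes "f \<in> borel_measurable M"
  shows "I f \<in> borel_measurable \<nu>"
proof -
  obtain F where F: "\<And>n::nat. F n \<in> E" "\<And>n \<omega>. \<omega> \<in> space M \<Longrightarrow> 0 \<le> F n \<omega>"
    "\<And>h. h \<in> \<K> \<Longrightarrow> I f h = (SUP n. ennreal (\<integral>\<omega>. F n \<omega> * h \<omega> \<partial>M))"
    using ex_truncation[OF assms] by blast
  note [measurable] = pairing_measurable[OF F(1)]
  have "(\<lambda>h. SUP n. ennreal (\<integral>\<omega>. F n \<omega> * h \<omega> \<partial>M)) \<in> borel_measurable \<nu>" by measurable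
  then show ?thesis
    by (subst measurable_cong[of \<nu>, OF F(3)]) (simp_all add: space_\<nu>)
qed

text \<open>Minkowski's inequality with exponent \<open>p\<close> for the measure with density
  \<open>h\<close>.\<close>

lemma I_add:
  assumes [measurable]: "f \<in> borel_measurable M" "g \<in> borel_measurable M" "h \<in> borel_measurable M"
  shows "ennreal_power (I (\<lambda>\<omega>. f \<omega> + g \<omega>) h) (1 / p)
    \<le> ennreal_power (I f h) (1 / p) + ennreal_power (I g h) (1 / p)"
proof -
  have I_density: "I u h = (\<integral>\<^sup>+\<omega>. ennreal_power (ennreal \<bar>u \<omega>\<bar>) p \<partial>density M (\<lambda>\<omega>. ennreal (h \<omega>)))"
    if [measurable]: "u \<in> borel_measurable M" for u
  proof -
    have "ennreal (\<bar>u \<omega>\<bar> powr p * h \<omega>) = ennreal (h \<omega>) * ennreal_power (ennreal \<bar>u \<omega>\<bar>) p" for \<omega>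
      using ennreal_mult'[of "\<bar>u \<omega>\<bar> powr p" "h \<omega>"] by (simp add: mult.commute)
    then show ?thesis unfolding I_def by (subst nn_integral_density) simp_all
  qed
  have "I (\<lambda>\<omega>. f \<omega> + g \<omega>) h
      \<le> (\<integral>\<^sup>+\<omega>. ennreal_power (ennreal \<bar>f \<omega>\<bar> + ennreal \<bar>g \<omega>\<bar>) p \<partial>density M (\<lambda>\<omega>. ennreal (h \<omega>)))"
    unfolding I_density[of "\<lambda>\<omega>. f \<omega> + g \<omega>", OF borel_measurable_add[OF assms(1,2)]] using p
    by (intro nn_integral_mono ennreal_power_mono) (auto intro!: ennreal_leI simp flip: ennreal_plus)
  then have "ennreal_power (I (\<lambda>\<omega>. f \<omega> + g \<omega>) h) (1 / p) \<le> ennreal_power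
      (\<integral>\<^sup>+\<omega>. ennreal_power (ennreal \<bar>f \<omega>\<bar> + ennreal \<bar>g \<omega>\<bar>) p \<partial>density M (\<lambda>\<omega>. ennreal (h \<omega>))) (1 / p)"
    using p by (intro ennreal_power_mono) auto
  also have "\<dots> \<le> ennreal_power (I f h) (1 / p) + ennreal_power (I g h) (1 / p)"
    unfolding I_density[OF assms(1)] I_density[OF assms(2)]
    by (rule minkowski_nn_integral[OF _ _ p]) auto
  finally show ?thesis .
qed

lemma J_eq: "J f = (\<integral>\<^sup>+h. ennreal_power (ennreal_power (I f h) (1 / p)) q \<partial>\<nu>)"
  unfolding J_def using pq_pos by (simp add: ennreal_power_power)

text \<open>Minkowski's inequality once more, with exponent \<open>q\<close> over
  \<open>\<nu>\<close>, on top of \<open>I_add\<close>; \<open>J_eq\<close> splits the exponent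
  \<open>q / p\<close> for this purpose.\<close>

lemma Sn_triangle:
  assumes [measurable]: "f \<in> borel_measurable M" "g \<in> borel_measurable M"
  shows "Sn (\<lambda>\<omega>. f \<omega> + g \<omega>) \<le> Sn f + Sn g"
proof -
  have "J (\<lambda>\<omega>. f \<omega> + g \<omega>)
      \<le> (\<integral>\<^sup>+h. ennreal_power (ennreal_power (I f h) (1 / p) + ennreal_power (I g h) (1 / p)) q \<partial>\<nu>)"
    unfolding J_eq using pq_pos
    by (intro nn_integral_mono ennreal_power_mono I_add assms) (auto simp: space_\<nu> \<K>_measurable)
  then have "Sn (\<lambda>\<omega>. f \<omega> + g \<omega>) \<le> ennreal_power
      (\<integral>\<^sup>+h. ennreal_power (ennreal_power (I f h) (1 / p) + ennreal_power (I g h) (1 / p)) q \<partial>\<nu>) (1 / q)"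
    unfolding Sn_eq using pq_pos by (intro ennreal_power_mono) auto
  also have "\<dots> \<le> Sn f + Sn g"
    unfolding Sn_eq J_eq by (rule minkowski_nn_integral[OF _ _ pq_pos(3)]) measurable
  finally show ?thesis .
qed

lemma Sn_scale:
  assumes [measurable]: "f \<in> borel_measurable M"
  shows "Sn (\<lambda>\<omega>. c * f \<omega>) = ennreal \<bar>c\<bar> * Sn f"
proof -
  have I: "I (\<lambda>\<omega>. c * f \<omega>) h = ennreal (\<bar>c\<bar> powr p) * I f h" if "h \<in> space \<nu>" for h
  proof -
    have [measurable]: "h \<in> borel_measurable M" using that by (simp add: space_\<nu> \<K>_measurable)
    show ?thesis unfolding I_def
      by (subst nn_integral_cmult[symmetric]) (auto simp: abs_mult powr_mult ennreal_mult' mult.assoc)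
  qed
  have "J (\<lambda>\<omega>. c * f \<omega>) = (\<integral>\<^sup>+h. ennreal (\<bar>c\<bar> powr q) * ennreal_power (I f h) (q / p) \<partial>\<nu>)"
    unfolding J_def using pq_pos
    by (intro nn_integral_cong) (simp add: I ennreal_power_mult powr_powr)
  also have "\<dots> = ennreal (\<bar>c\<bar> powr q) * J f"
    unfolding J_def by (rule nn_integral_cmult) measurable
  finally show ?thesis
    unfolding Sn_eq using pq_pos by (simp add: ennreal_power_mult powr_powr)
qed

lemma I_X:
  assumes x: "x \<in> elems X" and h: "h \<in> \<K>"
  shows "I x h = ennreal (\<integral>\<omega>. \<bar>x \<omega>\<bar> powr p * h \<omega> \<partial>M)"
    and "I x h \<le> ennreal (fnorm X x powr p)"
proof -
  show I: "I x h = ennreal (\<integral>\<omega>. \<bar>x \<omega>\<bar> powr p * h \<omega> \<partial>M)"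
    unfolding I_def by (rule nn_integral_\<K>(1)[OF h powr_in_V(1)[OF x]]) simp
  show "I x h \<le> ennreal (fnorm X x powr p)"
    unfolding I using \<K>_le_N[OF h powr_in_V(1)[OF x]] powr_in_V(2)[OF x] by (intro ennreal_leI) simp
qed

lemma J_X:
  assumes x: "x \<in> elems X"
  shows "J x = (\<integral>\<^sup>+h. ennreal ((\<integral>\<omega>. \<bar>x \<omega>\<bar> powr p * h \<omega> \<partial>M) powr (q / p)) \<partial>\<nu>)"
  unfolding J_def
  by (intro nn_integral_cong)
    (simp add: I_X(1)[OF x] space_\<nu> nn_integral_\<K>(2)[OF _ powr_in_V(1)[OF x]])

text \<open>Points of the ball pair with \<open>\<bar>x \<omega>\<bar> powr p\<close> to at most
  \<open>fnorm X x powr p\<close>, and a probability does not increase this bound.\<close>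

lemma X_in_\<S>:
  assumes x: "x \<in> elems X"
  shows "x \<in> elems \<S>" "fnorm \<S> x \<le> fnorm X x"
proof -
  interpret prob_space \<nu> by (rule prob_\<nu>)
  have "J x \<le> (\<integral>\<^sup>+h. ennreal (fnorm X x powr q) \<partial>\<nu>)"
    unfolding J_def
  proof (rule nn_integral_mono)
    fix h assume "h \<in> space \<nu>"
    then have "ennreal_power (I x h) (q / p) \<le> ennreal_power (ennreal (fnorm X x powr p)) (q / p)"
      using I_X(2)[OF x] pq_pos by (intro ennreal_power_mono) (auto simp: space_\<nu>)
    also have "\<dots> = ennreal (fnorm X x powr q)" using pq_pos by (simp add: powr_powr)
    finally show "ennreal_power (I x h) (q / p) \<le> ennreal (fnorm X x powr q)" .
  qed
  also have "\<dots> = ennreal (fnorm X x powr q)" by (simp add: emeasure_space_1)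
  finally have *: "Sn x \<le> ennreal (fnorm X x)" using Sn_le_iff[OF X_nonneg[OF x]] by simp
  then show "x \<in> elems \<S>"
    using X_measurable[OF x] by (auto simp: \<S>_iff intro: le_less_trans)
  show "fnorm \<S> x \<le> fnorm X x"
    unfolding \<S>_norm using enn2real_mono[OF *] X_nonneg[OF x] by simp
qed

text \<open>Fatou's lemma for the inner integral and then for the outer one. The completeness proof
  relies on it, having only almost everywhere convergence at hand.\<close>

lemma Sn_fatou:
  fixes u :: "nat \<Rightarrow> 'a \<Rightarrow> real"
  assumes [measurable]: "\<And>i. u i \<in> borel_measurable M" "f \<in> borel_measurable M"
    and lim: "AE \<omega> in M. (\<lambda>i. u i \<omega>) \<longlonglongrightarrow> f \<omega>"
    and le: "\<And>i. Sn (u i) \<le> ennreal e" and e: "0 \<le> e"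
  shows "Sn f \<le> ennreal e"
proof -
  have "I f h \<le> liminf (\<lambda>i. I (u i) h)" if h: "h \<in> \<K>" for h
  proof -
    note [measurable] = \<K>_measurable[OF h]
    have "I f h = (\<integral>\<^sup>+\<omega>. liminf (\<lambda>i. ennreal (\<bar>u i \<omega>\<bar> powr p * h \<omega>)) \<partial>M)"
      unfolding I_def
    proof (rule nn_integral_cong_AE)
      show "AE \<omega> in M. ennreal (\<bar>f \<omega>\<bar> powr p * h \<omega>) = liminf (\<lambda>i. ennreal (\<bar>u i \<omega>\<bar> powr p * h \<omega>))"
        using lim
      proof eventually_elim
        case (elim \<omega>)
        have "(\<lambda>i. \<bar>u i \<omega>\<bar> powr p) \<longlonglongrightarrow> \<bar>f \<omega>\<bar> powr p"
          using p by (intro tendsto_powr' tendsto_rabs elim tendsto_const) auto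
        then have "(\<lambda>i. ennreal (\<bar>u i \<omega>\<bar> powr p * h \<omega>)) \<longlonglongrightarrow> ennreal (\<bar>f \<omega>\<bar> powr p * h \<omega>)"
          by (intro tendsto_ennrealI tendsto_mult tendsto_const)
        then show ?case by (intro lim_imp_Liminf[symmetric]) auto
      qed
    qed
    also have "\<dots> \<le> liminf (\<lambda>i. I (u i) h)"
      unfolding I_def by (rule nn_integral_liminf) measurable
    finally show ?thesis .
  qed
  then have "J f \<le> (\<integral>\<^sup>+h. ennreal_power (liminf (\<lambda>i. I (u i) h)) (q / p) \<partial>\<nu>)"
    unfolding J_def using pq_pos by (intro nn_integral_mono ennreal_power_mono) (auto simp: space_\<nu>)
  also have "\<dots> \<le> (\<integral>\<^sup>+h. liminf (\<lambda>i. ennreal_power (I (u i) h) (q / p)) \<partial>\<nu>)"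
    using pq_pos by (intro nn_integral_mono liminf_ennreal_power_ge) auto
  also have "\<dots> \<le> liminf (\<lambda>i. J (u i))"
    unfolding J_def by (rule nn_integral_liminf) measurable
  also have "\<dots> \<le> ennreal (e powr q)"
    using le Sn_le_iff[OF e] by (intro Liminf_le) auto
  finally show ?thesis using Sn_le_iff[OF e] by simp
qed

text \<open>Setting \<open>f\<close> to 0 where it exceeds \<open>real n * g \<omega>\<close>,
  instead of clamping it, keeps both \<open>u n\<close> and \<open>f - u n\<close> dominated by
  \<open>f\<close>. At each point the remainder is eventually 0, so dominated convergence applies
  inside and outside.\<close>

lemma ex_X_approximation:
  assumes f: "f \<in> elems \<S>"
  obtains u where "\<And>n::nat. u n \<in> elems X" "\<And>n. fnorm \<S> (u n) \<le> fnorm \<S> f"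
    "(\<lambda>n. fnorm \<S> (\<lambda>\<omega>. f \<omega> - u n \<omega>)) \<longlonglongrightarrow> 0"
proof -
  have fm[measurable]: "f \<in> borel_measurable M" and f_fin: "Sn f < \<top>" using f by (auto simp: \<S>_iff)
  obtain g where g: "g \<in> elems X" "\<And>\<omega>. \<omega> \<in> space M \<Longrightarrow> 0 < g \<omega>" using X_ex_unit by blast
  note [measurable] = X_measurable[OF g(1)]
  define u where "u n \<omega> = (if \<bar>f \<omega>\<bar> \<le> real n * g \<omega> then f \<omega> else 0)" for n \<omega>
  have um[measurable]: "u n \<in> borel_measurable M" for n unfolding u_def by measurable
  have u_X: "u n \<in> elems X" for n
    by (rule X_ideal(1)[OF um X_scale[OF g(1), of "real n"]]) (auto simp: u_def intro!: AE_I2)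
  have u_le: "\<bar>u n \<omega>\<bar> \<le> \<bar>f \<omega>\<bar>" "\<bar>f \<omega> - u n \<omega>\<bar> \<le> \<bar>f \<omega>\<bar>" for n \<omega> by (auto simp: u_def)
  have ev: "\<forall>\<^sub>F n in sequentially. f \<omega> - u n \<omega> = 0" if \<omega>: "\<omega> \<in> space M" for \<omega>
  proof -
    obtain N where N: "\<bar>f \<omega>\<bar> / g \<omega> \<le> real N" using real_arch_simple by blast
    show ?thesis
      using eventually_ge_at_top[of N]
    proof eventually_elim
      case (elim n)
      then have "\<bar>f \<omega>\<bar> / g \<omega> \<le> real n" using N by linarith
      then show ?case using g(2)[OF \<omega>] by (simp add: u_def divide_le_eq)
    qed
  qed
  have I_lim: "(\<lambda>n. I (\<lambda>\<omega>. f \<omega> - u n \<omega>) h) \<longlonglongrightarrow> 0" if h: "h \<in> \<K>" "I f h < \<top>" for h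
  proof -
    note [measurable] = \<K>_measurable[OF h(1)]
    have "(\<lambda>n. \<integral>\<^sup>+\<omega>. ennreal (\<bar>f \<omega> - u n \<omega>\<bar> powr p * h \<omega>) \<partial>M) \<longlonglongrightarrow> (\<integral>\<^sup>+\<omega>. 0 \<partial>M)"
    proof (rule nn_integral_dominated_convergence)
      show "(\<integral>\<^sup>+\<omega>. ennreal (\<bar>f \<omega>\<bar> powr p * h \<omega>) \<partial>M) < \<infinity>" using h(2) by (simp add: I_def)
      show "AE \<omega> in M. ennreal (\<bar>f \<omega> - u n \<omega>\<bar> powr p * h \<omega>) \<le> ennreal (\<bar>f \<omega>\<bar> powr p * h \<omega>)" for n
        using u_le(2) p
        by (intro AE_I2) (auto simp: ennreal_mult' intro!: mult_right_mono ennreal_leI powr_mono2)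
      show "AE \<omega> in M. (\<lambda>n. ennreal (\<bar>f \<omega> - u n \<omega>\<bar> powr p * h \<omega>)) \<longlonglongrightarrow> 0"
      proof (rule AE_I2)
        fix \<omega> assume "\<omega> \<in> space M"
        from ev[OF this] have "\<forall>\<^sub>F n in sequentially. ennreal (\<bar>f \<omega> - u n \<omega>\<bar> powr p * h \<omega>) = 0"
          by eventually_elim simp
        then show "(\<lambda>n. ennreal (\<bar>f \<omega> - u n \<omega>\<bar> powr p * h \<omega>)) \<longlonglongrightarrow> 0" by (rule tendsto_eventually)
      qed
    qed measurable
    then show ?thesis by (simp add: I_def)
  qed
  have J_fin: "J f < \<top>" using f_fin by (simp add: Sn_eq)
  have "(\<lambda>n. J (\<lambda>\<omega>. f \<omega> - u n \<omega>)) \<longlonglongrightarrow> (\<integral>\<^sup>+h. 0 \<partial>\<nu>)"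
    unfolding J_def
  proof (rule nn_integral_dominated_convergence)
    show fin: "(\<integral>\<^sup>+h. ennreal_power (I f h) (q / p) \<partial>\<nu>) < \<infinity>" using J_fin by (simp add: J_def)
    show "AE h in \<nu>. ennreal_power (I (\<lambda>\<omega>. f \<omega> - u n \<omega>) h) (q / p) \<le> ennreal_power (I f h) (q / p)" for n
      using u_le(2) pq_pos by (intro AE_I2 ennreal_power_mono I_mono_AE) auto
    have "AE h in \<nu>. ennreal_power (I f h) (q / p) \<noteq> \<infinity>"
      using fin by (intro nn_integral_noteq_infinite) auto
    then show "AE h in \<nu>. (\<lambda>n. ennreal_power (I (\<lambda>\<omega>. f \<omega> - u n \<omega>) h) (q / p)) \<longlonglongrightarrow> 0"
      using AE_space
    proof eventually_elim
      case (elim h)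
      then show ?case using pq_pos
        by (intro ennreal_power_tendsto_0 I_lim) (auto simp: space_\<nu> less_top)
    qed
  qed measurable
  then have J_lim: "(\<lambda>n. J (\<lambda>\<omega>. f \<omega> - u n \<omega>)) \<longlonglongrightarrow> 0" by simp
  have "(\<lambda>n. Sn (\<lambda>\<omega>. f \<omega> - u n \<omega>)) \<longlonglongrightarrow> 0"
    unfolding Sn_eq using pq_pos by (intro ennreal_power_tendsto_0 J_lim) auto
  then have "(\<lambda>n. fnorm \<S> (\<lambda>\<omega>. f \<omega> - u n \<omega>)) \<longlonglongrightarrow> 0"
    unfolding \<S>_norm by (intro tendsto_enn2real) simp_all
  moreover have "fnorm \<S> (u n) \<le> fnorm \<S> f" for n
    unfolding \<S>_norm using Sn_mono_AE[of "u n" f] u_le(1) f_fin by (intro enn2real_mono) auto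
  ultimately show thesis using that u_X by blast
qed

end

text \<open>
  The lower bound by a single strictly positive functional makes the seminorm of the space
  definite and yields almost everywhere convergence of subsequences.
\<close>

locale S_lattice_definite = S_lattice +
  fixes h0 :: "'a \<Rightarrow> real" and C :: real
  assumes h0: "h0 \<in> \<K>" "AE \<omega> in M. 0 < h0 \<omega>"
    and C: "0 \<le> C"
    and lower_bound: "\<And>F. F \<in> E \<Longrightarrow> (\<And>\<omega>. \<omega> \<in> space M \<Longrightarrow> 0 \<le> F \<omega>) \<Longrightarrow>
      ennreal ((\<integral>\<omega>. F \<omega> * h0 \<omega> \<partial>M) powr (q / p))
        \<le> ennreal C * (\<integral>\<^sup>+h. ennreal ((\<integral>\<omega>. F \<omega> * h \<omega> \<partial>M) powr (q / p)) \<partial>\<nu>)"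
begin

text \<open>The hypothesis \<open>lower_bound\<close> concerns members of \<open>E\<close>; the
  truncations carry it over to all measurable functions, infinite values included.\<close>

lemma I_h0_le:
  assumes f: "f \<in> borel_measurable M"
  shows "ennreal_power (I f h0) (q / p) \<le> ennreal C * J f"
proof -
  obtain F where F: "\<And>n::nat. F n \<in> E" "\<And>n \<omega>. \<omega> \<in> space M \<Longrightarrow> 0 \<le> F n \<omega>"
    "\<And>h. h \<in> \<K> \<Longrightarrow> I f h = (SUP n. ennreal (\<integral>\<omega>. F n \<omega> * h \<omega> \<partial>M))"
    using ex_truncation[OF f] by blast
  have "ennreal (\<integral>\<omega>. F n \<omega> * h0 \<omega> \<partial>M) \<le> ennreal_power (ennreal C * J f) (1 / (q / p))" for n
  proof -
    have "ennreal_power (ennreal (\<integral>\<omega>. F n \<omega> * h0 \<omega> \<partial>M)) (q / p)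
        = ennreal ((\<integral>\<omega>. F n \<omega> * h0 \<omega> \<partial>M) powr (q / p))"
      using nn_integral_\<K>(2)[OF h0(1) F(1,2)] by simp
    also have "\<dots> \<le> ennreal C * (\<integral>\<^sup>+h. ennreal ((\<integral>\<omega>. F n \<omega> * h \<omega> \<partial>M) powr (q / p)) \<partial>\<nu>)"
      by (rule lower_bound[OF F(1,2)])
    also have "\<dots> \<le> ennreal C * J f"
      unfolding J_def
    proof (intro mult_left_mono nn_integral_mono)
      fix h assume "h \<in> space \<nu>"
      then have h: "h \<in> \<K>" by (simp add: space_\<nu>)
      have "ennreal (\<integral>\<omega>. F n \<omega> * h \<omega> \<partial>M) \<le> I f h" unfolding F(3)[OF h] by (rule SUP_upper) simp
      then have "ennreal_power (ennreal (\<integral>\<omega>. F n \<omega> * h \<omega> \<partial>M)) (q / p) \<le> ennreal_power (I f h) (q / p)"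
        using pq_pos by (intro ennreal_power_mono) auto
      then show "ennreal ((\<integral>\<omega>. F n \<omega> * h \<omega> \<partial>M) powr (q / p)) \<le> ennreal_power (I f h) (q / p)"
        using nn_integral_\<K>(2)[OF h F(1,2)] by simp
    qed simp
    finally show ?thesis using pq_pos(4) by (simp add: ennreal_power_le_iff)
  qed
  then have "I f h0 \<le> ennreal_power (ennreal C * J f) (1 / (q / p))"
    unfolding F(3)[OF h0(1)] by (intro SUP_least)
  then show ?thesis using pq_pos(4) by (simp add: ennreal_power_le_iff)
qed

text \<open>Norm 0 forces the pairing with \<open>h0\<close> to be 0, and \<open>h0\<close> is
  positive almost everywhere.\<close>

lemma Sn_eq_0_iff:
  assumes [measurable]: "f \<in> borel_measurable M"
  shows "Sn f = 0 \<longleftrightarrow> (AE \<omega> in M. f \<omega> = 0)"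
proof
  assume "Sn f = 0"
  then have "J f = 0" by (simp add: Sn_eq)
  then have "I f h0 = 0" using I_h0_le[OF assms] by simp
  then have "AE \<omega> in M. ennreal (\<bar>f \<omega>\<bar> powr p * h0 \<omega>) = 0"
    unfolding I_def using \<K>_measurable[OF h0(1)] by (subst (asm) nn_integral_0_iff_AE) auto
  then show "AE \<omega> in M. f \<omega> = 0"
    using h0(2)
  proof eventually_elim
    case (elim \<omega>)
    show ?case
    proof (rule ccontr)
      assume "f \<omega> \<noteq> 0"
      then have "0 < \<bar>f \<omega>\<bar> powr p * h0 \<omega>" using elim(2) by simp
      then show False using elim(1) by (simp add: ennreal_eq_0_iff)
    qed
  qed
next
  assume "AE \<omega> in M. f \<omega> = 0"
  then have "Sn f \<le> Sn (\<lambda>_. 0)" by (intro Sn_mono_AE) (auto elim: eventually_mono)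
  also have "Sn (\<lambda>_. 0) = 0" using Sn_scale[of "\<lambda>_. 0" 0] by simp
  finally show "Sn f = 0" by simp
qed

lemma \<S>_normed: "normed_function_space M \<S>"
proof -
  have add: "(\<lambda>\<omega>. f \<omega> + g \<omega>) \<in> elems \<S> \<and> fnorm \<S> (\<lambda>\<omega>. f \<omega> + g \<omega>) \<le> fnorm \<S> f + fnorm \<S> g"
    if f: "f \<in> elems \<S>" and g: "g \<in> elems \<S>" for f g
  proof -
    have *: "Sn (\<lambda>\<omega>. f \<omega> + g \<omega>) \<le> Sn f + Sn g" using f g by (intro Sn_triangle) (auto simp: \<S>_iff)
    moreover have "Sn f + Sn g < \<top>" using f g by (auto simp: \<S>_iff)
    ultimately have fin: "Sn (\<lambda>\<omega>. f \<omega> + g \<omega>) < \<top>" by (rule le_less_trans)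
    have "fnorm \<S> (\<lambda>\<omega>. f \<omega> + g \<omega>) \<le> enn2real (Sn f + Sn g)"
      unfolding \<S>_norm using * \<open>Sn f + Sn g < \<top>\<close> by (rule enn2real_mono)
    also have "\<dots> = fnorm \<S> f + fnorm \<S> g"
      using f g by (simp add: \<S>_norm \<S>_iff enn2real_plus)
    finally show ?thesis using fin f g by (auto simp: \<S>_iff)
  qed
  have scale: "(\<lambda>\<omega>. c * f \<omega>) \<in> elems \<S> \<and> fnorm \<S> (\<lambda>\<omega>. c * f \<omega>) = \<bar>c\<bar> * fnorm \<S> f"
    if f: "f \<in> elems \<S>" for f c
    using f by (auto simp: \<S>_iff \<S>_norm Sn_scale ennreal_mult_less_top enn2real_mult)
  have zero: "fnorm \<S> f = 0 \<longleftrightarrow> (AE \<omega> in M. f \<omega> = 0)" if f: "f \<in> elems \<S>" for f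
    using f Sn_eq_0_iff[of f] by (auto simp: \<S>_iff \<S>_norm enn2real_eq_0_iff)
  show ?thesis
    unfolding normed_function_space_def
    using add scale zero X_in_\<S>(1)[OF X_zero] by (auto simp: \<S>_iff \<S>_norm)
qed

text \<open>Riesz-Fischer. The norm controls the inner integral at \<open>h0\<close>, so a fast
  subsequence converges almost everywhere, as \<open>h0\<close> is positive; the Fatou property then
  yields convergence in norm.\<close>

lemma \<S>_complete: "complete_function_space \<S>"
  unfolding complete_function_space_def
proof (intro allI impI, elim conjE)
  fix u :: "nat \<Rightarrow> 'a \<Rightarrow> real"
  assume u: "\<forall>n. u n \<in> elems \<S>"
    and cauchy: "\<forall>e>0. \<exists>K. \<forall>m\<ge>K. \<forall>n\<ge>K. fnorm \<S> (\<lambda>\<omega>. u m \<omega> - u n \<omega>) < e"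
  have S_sub: "function_subspace (elems \<S>)"
    using \<S>_normed unfolding normed_function_space_def function_subspace_def by blast
  note S_diff = function_subspaceD(5)[OF S_sub]
  have um [measurable]: "u n \<in> borel_measurable M" for n using u by (simp add: \<S>_iff)
  have "\<forall>i. \<exists>K. \<forall>m\<ge>K. \<forall>n\<ge>K. fnorm \<S> (\<lambda>\<omega>. u m \<omega> - u n \<omega>) < (1/4) ^ i"
    using cauchy by simp
  then obtain K where K: "\<And>i m n. K i \<le> m \<Longrightarrow> K i \<le> n \<Longrightarrow> fnorm \<S> (\<lambda>\<omega>. u m \<omega> - u n \<omega>) < (1/4) ^ i"
    by metis
  \<comment> \<open>Summing makes \<open>k j\<close> at least \<open>K i\<close> for all
    \<open>i \<le> j\<close>, whether or not \<open>K\<close> is monotone.\<close>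
  define k where "k i = (\<Sum>j\<le>i. K j)" for i :: nat
  have k_ge: "K i \<le> k j" if "i \<le> j" for i j
    unfolding k_def using that by (intro member_le_sum) auto
  have Sn_diff: "Sn (\<lambda>\<omega>. u m \<omega> - u n \<omega>) \<le> ennreal ((1/4) ^ i)" if "K i \<le> m" "K i \<le> n" for m n i
    using K[OF that] \<S>_ennreal_norm[OF S_diff, of "u m" "u n"] u by (metis ennreal_leI less_imp_le)
  define d where "d i \<omega> = u (k (Suc i)) \<omega> - u (k i) \<omega>" for i \<omega>
  have dm [measurable]: "d i \<in> borel_measurable M" for i unfolding d_def by measurable
  note [measurable] = \<K>_measurable[OF h0(1)]
  have I_d: "I (d i) h0 \<le> ennreal (C powr (p / q) * ((1/4) ^ i) powr p)" for i
  proof -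
    have "Sn (d i) \<le> ennreal ((1/4) ^ i)"
      unfolding d_def by (rule Sn_diff) (auto intro: k_ge)
    then have "J (d i) \<le> ennreal (((1/4) ^ i) powr q)" by (subst (asm) Sn_le_iff) auto
    then have "ennreal_power (I (d i) h0) (q / p) \<le> ennreal C * ennreal (((1/4) ^ i) powr q)"
      using I_h0_le[OF dm, of i] by (meson mult_left_mono order_trans zero_le)
    then have "I (d i) h0 \<le> ennreal_power (ennreal C * ennreal (((1/4) ^ i) powr q)) (1 / (q / p))"
      using pq_pos(4) by (simp add: ennreal_power_le_iff)
    also have "\<dots> = ennreal (C powr (p / q) * ((1/4) ^ i) powr p)"
      using C pq_pos by (simp add: powr_powr ennreal_power_mult ennreal_mult')
    finally show ?thesis .
  qed
  \<comment> \<open>Gaps of size \<open>(1/4) ^ i\<close> leave room for the factor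
    \<open>2 ^ i\<close>. The series stays integrable, so almost everywhere
    \<open>\<bar>d i \<omega>\<bar>\<close> is at most a constant times
    \<open>(1/2) ^ i\<close>.\<close>
  have "(\<integral>\<^sup>+\<omega>. (\<Sum>i. ennreal ((2 ^ i * \<bar>d i \<omega>\<bar>) powr p * h0 \<omega>)) \<partial>M)
      = (\<Sum>i. \<integral>\<^sup>+\<omega>. ennreal ((2 ^ i * \<bar>d i \<omega>\<bar>) powr p * h0 \<omega>) \<partial>M)"
    by (rule nn_integral_suminf) measurable
  also have "\<dots> \<le> (\<Sum>i. ennreal (C powr (p / q) * (1/2) ^ i))"
  proof (rule suminf_le)
    fix i
    have "(\<integral>\<^sup>+\<omega>. ennreal ((2 ^ i * \<bar>d i \<omega>\<bar>) powr p * h0 \<omega>) \<partial>M) = ennreal ((2 ^ i) powr p) * I (d i) h0"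
      unfolding I_def by (subst nn_integral_cmult[symmetric]) (auto simp: powr_mult ennreal_mult' mult.assoc)
    also have "\<dots> \<le> ennreal ((2 ^ i) powr p) * ennreal (C powr (p / q) * ((1/4) ^ i) powr p)"
      by (rule mult_left_mono[OF I_d]) simp
    also have "\<dots> = ennreal (C powr (p / q) * ((1/2) ^ i) powr p)"
    proof -
      have "(2::real) ^ i * (1/4) ^ i = (1/2) ^ i" by (simp flip: power_mult_distrib)
      then have "(2 ^ i) powr p * ((1/4) ^ i) powr p = ((1/2::real) ^ i) powr p" by (simp flip: powr_mult)
      then show ?thesis by (simp add: mult.left_commute flip: ennreal_mult')
    qed
    also have "\<dots> \<le> ennreal (C powr (p / q) * (1/2) ^ i)"
    proof (intro ennreal_leI mult_left_mono)
      show "((1/2::real) ^ i) powr p \<le> (1/2) ^ i"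
        using powr_mono'[of 1 p "(1/2) ^ i"] p by (simp add: power_le_one)
    qed simp
    finally show "(\<integral>\<^sup>+\<omega>. ennreal ((2 ^ i * \<bar>d i \<omega>\<bar>) powr p * h0 \<omega>) \<partial>M) \<le> ennreal (C powr (p / q) * (1/2) ^ i)" .
  qed auto
  also have "\<dots> < \<infinity>"
    by (subst suminf_ennreal2) (auto intro!: summable_mult summable_geometric)
  finally have "AE \<omega> in M. (\<Sum>i. ennreal ((2 ^ i * \<bar>d i \<omega>\<bar>) powr p * h0 \<omega>)) \<noteq> \<infinity>"
    by (intro nn_integral_noteq_infinite) auto
  then have conv: "AE \<omega> in M. convergent (\<lambda>i. u (k i) \<omega>)"
    using h0(2)
  proof eventually_elim
    case (elim \<omega>)
    let ?s = "\<Sum>i. ennreal ((2 ^ i * \<bar>d i \<omega>\<bar>) powr p * h0 \<omega>)"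
    obtain B where B: "0 \<le> B" "?s = ennreal B" using elim(1) by (cases ?s) auto
    have "\<bar>d i \<omega>\<bar> \<le> (B / h0 \<omega>) powr (1 / p) * (1/2) ^ i" for i
    proof -
      have "ennreal ((2 ^ i * \<bar>d i \<omega>\<bar>) powr p * h0 \<omega>) \<le> ?s"
        using sum_le_suminf[of "\<lambda>i. ennreal ((2 ^ i * \<bar>d i \<omega>\<bar>) powr p * h0 \<omega>)" "{i}"] by simp
      then have "(2 ^ i * \<bar>d i \<omega>\<bar>) powr p * h0 \<omega> \<le> B" using B by simp
      then have "(2 ^ i * \<bar>d i \<omega>\<bar>) powr p \<le> B / h0 \<omega>" using elim(2) by (simp add: le_divide_eq)
      then have "((2 ^ i * \<bar>d i \<omega>\<bar>) powr p) powr (1 / p) \<le> (B / h0 \<omega>) powr (1 / p)"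
        using p by (intro powr_mono2) auto
      then have "2 ^ i * \<bar>d i \<omega>\<bar> \<le> (B / h0 \<omega>) powr (1 / p)" using p by (simp add: powr_powr)
      then show ?thesis by (simp add: field_simps power_one_over)
    qed
    then have "\<exists>N. \<forall>i\<ge>N. norm (d i \<omega>) \<le> (B / h0 \<omega>) powr (1 / p) * (1/2) ^ i" by simp
    then have "summable (\<lambda>i. d i \<omega>)"
      by (rule summable_comparison_test) (intro summable_mult summable_geometric, simp)
    then have "(\<lambda>n. \<Sum>i<n. d i \<omega>) \<longlonglongrightarrow> (\<Sum>i. d i \<omega>)" by (rule summable_LIMSEQ)
    then have "(\<lambda>n. (\<Sum>i<n. d i \<omega>) + u (k 0) \<omega>) \<longlonglongrightarrow> (\<Sum>i. d i \<omega>) + u (k 0) \<omega>"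
      by (intro tendsto_add tendsto_const)
    moreover have "(\<Sum>i<n. d i \<omega>) + u (k 0) \<omega> = u (k n) \<omega>" for n
      unfolding d_def by (induction n) auto
    ultimately show ?case by (auto simp: convergent_def)
  qed
  define f where "f \<omega> = lim (\<lambda>i. u (k i) \<omega>)" for \<omega>
  have fm [measurable]: "f \<in> borel_measurable M"
    unfolding f_def[abs_def] by (rule borel_measurable_lim_metric) measurable
  have lim: "AE \<omega> in M. (\<lambda>i. u (k i) \<omega>) \<longlonglongrightarrow> f \<omega>"
    using conv by eventually_elim (simp add: f_def convergent_LIMSEQ_iff)
  \<comment> \<open>From index \<open>j\<close> on the subsequence stays within
    \<open>(1/4) ^ j\<close> of \<open>u n\<close>, and the Fatou property passes this on to its
    limit.\<close>
  have close: "Sn (\<lambda>\<omega>. u n \<omega> - f \<omega>) \<le> ennreal ((1/4) ^ j)" if "K j \<le> n" for n j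
  proof (rule Sn_fatou)
    show "AE \<omega> in M. (\<lambda>i. u n \<omega> - u (k (i + j)) \<omega>) \<longlonglongrightarrow> u n \<omega> - f \<omega>"
      using lim
    proof eventually_elim
      case (elim \<omega>)
      show ?case by (intro tendsto_diff tendsto_const LIMSEQ_ignore_initial_segment[OF elim])
    qed
    show "Sn (\<lambda>\<omega>. u n \<omega> - u (k (i + j)) \<omega>) \<le> ennreal ((1/4) ^ j)" for i
      by (rule Sn_diff[OF that k_ge]) simp
  qed auto
  have uf: "(\<lambda>\<omega>. u n \<omega> - f \<omega>) \<in> elems \<S>" if "K 0 \<le> n" for n
    using close[OF that] by (auto simp: \<S>_iff intro: le_less_trans)
  have f: "f \<in> elems \<S>"
    using S_diff[OF u[rule_format, of "K 0"] uf[of "K 0"]] by simp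
  have "(\<lambda>n. fnorm \<S> (\<lambda>\<omega>. u n \<omega> - f \<omega>)) \<longlonglongrightarrow> 0"
  proof (rule LIMSEQ_I)
    fix e :: real assume "0 < e"
    then obtain j where j: "(1/4) ^ j < e" using real_arch_pow_inv[of e "1/4"] by auto
    have "norm (fnorm \<S> (\<lambda>\<omega>. u n \<omega> - f \<omega>) - 0) < e" if "K j \<le> n" for n
    proof -
      have "fnorm \<S> (\<lambda>\<omega>. u n \<omega> - f \<omega>) \<le> (1/4) ^ j"
        unfolding \<S>_norm using enn2real_mono[OF close[OF that]] by simp
      then show ?thesis using j by (simp add: \<S>_norm)
    qed
    then show "\<exists>no. \<forall>n\<ge>no. norm (fnorm \<S> (\<lambda>\<omega>. u n \<omega> - f \<omega>) - 0) < e" by blast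
  qed
  then show "\<exists>f\<in>elems \<S>. (\<lambda>n. fnorm \<S> (\<lambda>\<omega>. u n \<omega> - f \<omega>)) \<longlonglongrightarrow> 0" using f by blast
qed

theorem banach_function_lattice_\<S>: "banach_function_lattice M \<S>"
  unfolding banach_function_lattice_def
proof (intro conjI ballI impI)
  fix f g assume f: "f \<in> borel_measurable M" and g: "g \<in> elems \<S>"
    and le: "AE \<omega> in M. \<bar>f \<omega>\<bar> \<le> \<bar>g \<omega>\<bar>"
  have *: "Sn f \<le> Sn g" "Sn g < \<top>" using Sn_mono_AE[OF le] g by (auto simp: \<S>_iff)
  then show "f \<in> elems \<S>" using f by (auto simp: \<S>_iff)
  show "fnorm \<S> f \<le> fnorm \<S> g" unfolding \<S>_norm by (rule enn2real_mono[OF *])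
next
  fix A assume "A \<in> sets M" "0 < emeasure M A"
  then show "\<exists>f\<in>elems \<S>. \<not> (AE \<omega> in M. \<omega> \<in> A \<longrightarrow> f \<omega> = 0)"
    using lattice X_in_\<S>(1) unfolding banach_function_lattice_def by blast
qed (rule sf \<S>_normed \<S>_complete)+

end

lemma (in S_lattice) continuous_inclusion_\<S>: "continuous_inclusion X \<S>"
  unfolding continuous_inclusion_def using X_in_\<S> by (auto intro!: exI[of _ 1])

section \<open>Multilinear extension\<close>

lemma multilinear_operator_scale:
  assumes T: "multilinear_operator M X T" and x: "\<And>j. x j \<in> elems (X j)" and f: "f \<in> elems (X j)"
  shows "T (x(j := (\<lambda>\<omega>. c * f \<omega>))) = c *\<^sub>R T (x(j := f))"
  by (rule T[unfolded multilinear_operator_def, THEN conjunct2, THEN conjunct1, rule_format])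
    (intro conjI allI x f)

lemma multilinear_scale_all:
  fixes T :: "('m::finite \<Rightarrow> 'a \<Rightarrow> real) \<Rightarrow> 'y::real_vector"
  assumes T: "multilinear_operator M X T" and x: "\<And>j. x j \<in> elems (X j)"
    and X: "\<And>j. function_subspace (elems (X j))"
  shows "T (\<lambda>j \<omega>. c j * x j \<omega>) = (\<Prod>j\<in>UNIV. c j) *\<^sub>R T x"
proof -
  have "T (\<lambda>j. if j \<in> A then (\<lambda>\<omega>. c j * x j \<omega>) else x j) = (\<Prod>j\<in>A. c j) *\<^sub>R T x" if "finite A" for A
    using that
  proof (induction A rule: finite_induct)
    case (insert a A)
    let ?y = "\<lambda>j. if j \<in> A then (\<lambda>\<omega>. c j * x j \<omega>) else x j"
    have y: "?y j \<in> elems (X j)" for j using x function_subspaceD(3)[OF X x] by auto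
    have "(\<lambda>j. if j \<in> insert a A then (\<lambda>\<omega>. c j * x j \<omega>) else x j) = ?y(a := (\<lambda>\<omega>. c a * x a \<omega>))"
      by auto
    moreover have "T (?y(a := (\<lambda>\<omega>. c a * x a \<omega>))) = c a *\<^sub>R T (?y(a := x a))"
      by (rule multilinear_operator_scale[OF T y x])
    moreover have "?y(a := x a) = ?y" using insert.hyps by auto
    ultimately show ?case using insert by simp
  qed simp
  from this[of UNIV] show ?thesis by simp
qed

text \<open>As the operator respects equality almost everywhere, the null coordinate may be replaced
  by 0 times itself.\<close>

lemma multilinear_null:
  fixes T :: "('m::finite \<Rightarrow> 'a \<Rightarrow> real) \<Rightarrow> 'y::real_vector"
  assumes T: "multilinear_operator M X T" and x: "\<And>j. x j \<in> elems (X j)"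
    and X: "\<And>j. function_subspace (elems (X j))" and null: "AE \<omega> in M i. x i \<omega> = 0"
  shows "T x = 0"
proof -
  have AE_cong: "T x = T y" if "\<And>j. y j \<in> elems (X j)" "\<And>j. AE \<omega> in M j. x j \<omega> = y j \<omega>" for y
    by (rule T[unfolded multilinear_operator_def, THEN conjunct2, THEN conjunct2, rule_format])
      (intro conjI allI x that)
  have "T x = T (x(i := (\<lambda>\<omega>. 0 * x i \<omega>)))"
  proof (rule AE_cong)
    show "(x(i := (\<lambda>\<omega>. 0 * x i \<omega>))) j \<in> elems (X j)" for j
      using x function_subspaceD(3)[OF X[of i] x[of i], of 0] by simp
    show "AE \<omega> in M j. x j \<omega> = (x(i := (\<lambda>\<omega>. 0 * x i \<omega>))) j \<omega>" for j
      using null by (cases "j = i") (auto elim!: eventually_mono)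
  qed
  also have "\<dots> = 0 *\<^sub>R T (x(i := x i))"
    by (rule multilinear_operator_scale[OF T x x])
  finally show ?thesis by simp
qed

text \<open>The operator lives on the spaces \<open>X j\<close> but is bounded in the norms of the
  \<open>Z j\<close>. Approximants can be chosen with norm at most that of the limit, so the
  constant \<open>D\<close> survives the extension.\<close>

locale dense_extension =
  fixes M :: "'m::finite \<Rightarrow> 'a measure" and X Z :: "'m \<Rightarrow> 'a function_space"
    and T :: "('m \<Rightarrow> 'a \<Rightarrow> real) \<Rightarrow> 'y::banach" and D :: real
  assumes X_subspace: "\<And>j. function_subspace (elems (X j))"
    and Z_normed: "\<And>j. normed_function_space (M j) (Z j)"
    and X_Z: "\<And>j f. f \<in> elems (X j) \<Longrightarrow> f \<in> elems (Z j)"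
    and dense: "\<And>j f. f \<in> elems (Z j) \<Longrightarrow> \<exists>u. (\<forall>n::nat. u n \<in> elems (X j)) \<and>
      (\<forall>n. fnorm (Z j) (u n) \<le> fnorm (Z j) f) \<and> (\<lambda>n. fnorm (Z j) (\<lambda>\<omega>. f \<omega> - u n \<omega>)) \<longlonglongrightarrow> 0"
    and T: "multilinear_operator M X T"
    and D: "0 \<le> D"
    and bound: "\<And>x. (\<And>j. x j \<in> elems (X j)) \<Longrightarrow> norm (T x) \<le> D * (\<Prod>j\<in>UNIV. fnorm (Z j) (x j))"
begin

lemma Z_subspace: "function_subspace (elems (Z j))"
  using Z_normed[of j] unfolding normed_function_space_def function_subspace_def by blast

lemmas Z_diff = function_subspaceD(5)[OF Z_subspace]

lemma Z_norm:
  shows "f \<in> elems (Z j) \<Longrightarrow> g \<in> elems (Z j) \<Longrightarrow>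
      fnorm (Z j) (\<lambda>\<omega>. f \<omega> + g \<omega>) \<le> fnorm (Z j) f + fnorm (Z j) g"
    and "f \<in> elems (Z j) \<Longrightarrow> fnorm (Z j) (\<lambda>\<omega>. c * f \<omega>) = \<bar>c\<bar> * fnorm (Z j) f"
    and "f \<in> elems (Z j) \<Longrightarrow> 0 \<le> fnorm (Z j) f"
    and "f \<in> elems (Z j) \<Longrightarrow> fnorm (Z j) f = 0 \<longleftrightarrow> (AE \<omega> in M j. f \<omega> = 0)"
  using Z_normed[of j] unfolding normed_function_space_def by blast+

lemma Z_norm_diff:
  assumes "f \<in> elems (Z j)" "g \<in> elems (Z j)" "k \<in> elems (Z j)"
  shows "fnorm (Z j) (\<lambda>\<omega>. f \<omega> - g \<omega>) \<le> fnorm (Z j) (\<lambda>\<omega>. k \<omega> - f \<omega>) + fnorm (Z j) (\<lambda>\<omega>. k \<omega> - g \<omega>)"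
proof -
  have kf: "(\<lambda>\<omega>. - (k \<omega> - f \<omega>)) \<in> elems (Z j)"
    by (rule function_subspaceD(4)[OF Z_subspace Z_diff[OF assms(3,1)]])
  have "fnorm (Z j) (\<lambda>\<omega>. f \<omega> - g \<omega>) = fnorm (Z j) (\<lambda>\<omega>. - (k \<omega> - f \<omega>) + (k \<omega> - g \<omega>))" by simp
  also have "\<dots> \<le> fnorm (Z j) (\<lambda>\<omega>. - (k \<omega> - f \<omega>)) + fnorm (Z j) (\<lambda>\<omega>. k \<omega> - g \<omega>)"
    by (rule Z_norm(1)[OF kf Z_diff[OF assms(3,2)]])
  also have "fnorm (Z j) (\<lambda>\<omega>. - (k \<omega> - f \<omega>)) = fnorm (Z j) (\<lambda>\<omega>. k \<omega> - f \<omega>)"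
    using Z_norm(2)[OF Z_diff[OF assms(3,1)], of "-1"] by simp
  finally show ?thesis .
qed

lemma T_add:
  assumes "\<And>i. x i \<in> elems (X i)" "f \<in> elems (X j)" "g \<in> elems (X j)"
  shows "T (x(j := (\<lambda>\<omega>. f \<omega> + g \<omega>))) = T (x(j := f)) + T (x(j := g))"
  using T assms unfolding multilinear_operator_def by blast

lemma T_scale:
  assumes "\<And>i. x i \<in> elems (X i)" "f \<in> elems (X j)"
  shows "T (x(j := (\<lambda>\<omega>. c * f \<omega>))) = c *\<^sub>R T (x(j := f))"
  by (rule multilinear_operator_scale[OF T assms])

text \<open>Telescoping over the coordinates: each replacement changes one slot, where
  \<open>T\<close> is additive, while the other slots have norm at most \<open>B\<close>. As
  \<open>B\<close> is at least 1, the power \<open>CARD('m)\<close> covers the product of the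
  remaining slots.\<close>

lemma T_diff_le:
  assumes y: "\<And>j. y j \<in> elems (X j)" "\<And>j. fnorm (Z j) (y j) \<le> B" and B: "1 \<le> B"
    and A: "finite A" "\<And>j. x j \<in> elems (X j)" "\<And>j. fnorm (Z j) (x j) \<le> B" "\<And>j. j \<notin> A \<Longrightarrow> x j = y j"
  shows "norm (T x - T y) \<le> D * B ^ CARD('m) * (\<Sum>j\<in>A. fnorm (Z j) (\<lambda>\<omega>. x j \<omega> - y j \<omega>))"
  using A
proof (induction A arbitrary: x rule: finite_induct)
  case empty
  then have "x = y" by auto
  then show ?case by simp
next
  case (insert a A)
  define x' where "x' = x(a := y a)"
  define d where "d = (\<lambda>\<omega>. x a \<omega> - y a \<omega>)"
  have d: "d \<in> elems (X a)"
    unfolding d_def by (rule function_subspaceD(5)[OF X_subspace insert.prems(1) y(1)])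
  have x': "\<And>j. x' j \<in> elems (X j)" "\<And>j. fnorm (Z j) (x' j) \<le> B"
    using insert.prems y by (auto simp: x'_def)
  have IH: "norm (T x' - T y) \<le> D * B ^ CARD('m) * (\<Sum>j\<in>A. fnorm (Z j) (\<lambda>\<omega>. x' j \<omega> - y j \<omega>))"
    by (rule insert.IH[OF x']) (use insert.prems(3) in \<open>auto simp: x'_def\<close>)
  have IH_sum: "(\<Sum>j\<in>A. fnorm (Z j) (\<lambda>\<omega>. x' j \<omega> - y j \<omega>)) = (\<Sum>j\<in>A. fnorm (Z j) (\<lambda>\<omega>. x j \<omega> - y j \<omega>))"
    using insert.hyps by (intro sum.cong) (auto simp: x'_def)
  have "T (x(a := (\<lambda>\<omega>. d \<omega> + y a \<omega>))) = T (x(a := d)) + T (x(a := y a))"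
    by (rule T_add[OF insert.prems(1) d y(1)])
  then have "T x - T x' = T (x(a := d))" by (simp add: x'_def d_def)
  also have "norm \<dots> \<le> D * (\<Prod>j\<in>UNIV. fnorm (Z j) ((x(a := d)) j))"
    using insert.prems(1) d by (intro bound) auto
  also have "(\<Prod>j\<in>UNIV. fnorm (Z j) ((x(a := d)) j)) = fnorm (Z a) d * (\<Prod>j\<in>UNIV - {a}. fnorm (Z j) (x j))"
    by (subst prod.remove[of UNIV a]) (auto intro!: prod.cong)
  also have "D * \<dots> \<le> D * (fnorm (Z a) d * B ^ CARD('m))"
  proof (intro mult_left_mono D)
    have "(\<Prod>j\<in>UNIV - {a}. fnorm (Z j) (x j)) \<le> (\<Prod>j\<in>UNIV - {a}. B)"
      using insert.prems X_Z by (intro prod_mono) (auto intro!: Z_norm(3))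
    also have "\<dots> \<le> B ^ CARD('m)"
      using B by (simp add: card_Diff_singleton power_increasing)
    finally show "(\<Prod>j\<in>UNIV - {a}. fnorm (Z j) (x j)) \<le> B ^ CARD('m)" .
    show "0 \<le> fnorm (Z a) d" using d X_Z by (intro Z_norm(3)) auto
  qed
  finally have step: "norm (T x - T x') \<le> D * B ^ CARD('m) * fnorm (Z a) d" by (simp add: mult_ac)
  have "norm (T x - T y) \<le> norm (T x - T x') + norm (T x' - T y)"
    using norm_triangle_ineq[of "T x - T x'" "T x' - T y"] by simp
  also have "\<dots> \<le> D * B ^ CARD('m) * (\<Sum>j\<in>insert a A. fnorm (Z j) (\<lambda>\<omega>. x j \<omega> - y j \<omega>))"
    using step IH insert.hyps unfolding IH_sum by (simp add: d_def distrib_left)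
  finally show ?case .
qed

definition approximates :: "(nat \<Rightarrow> 'm \<Rightarrow> 'a \<Rightarrow> real) \<Rightarrow> ('m \<Rightarrow> 'a \<Rightarrow> real) \<Rightarrow> bool" where
  "approximates y x \<longleftrightarrow> (\<forall>n j. y n j \<in> elems (X j)) \<and>
     (\<forall>j. (\<lambda>n. fnorm (Z j) (\<lambda>\<omega>. x j \<omega> - y n j \<omega>)) \<longlonglongrightarrow> 0)"

text \<open>Comparing two sequences serves both needs: with equal sequences it is the Cauchy
  property, with different ones it shows that the limit does not depend on the choice.\<close>

lemma approximates_close:
  assumes x: "\<And>j. x j \<in> elems (Z j)" and y: "approximates y x" "approximates y' x" and e: "0 < e"
  shows "\<exists>K. \<forall>n\<ge>K. \<forall>m\<ge>K. norm (T (y n) - T (y' m)) < e"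
proof -
  \<comment> \<open>The margin of 1 above the norms of the \<open>x j\<close> lets \<open>B\<close>
    also bound every approximant closer than \<open>\<delta> \<le> 1\<close>.\<close>
  define B where "B = 1 + (\<Sum>j\<in>UNIV. fnorm (Z j) (x j))"
  have x_le: "fnorm (Z j) (x j) + 1 \<le> B" for j
    unfolding B_def using member_le_sum[of j UNIV "\<lambda>j. fnorm (Z j) (x j)"] Z_norm(3)[OF x] by simp
  have B: "1 \<le> B" unfolding B_def using Z_norm(3)[OF x] by (simp add: sum_nonneg)
  define L where "L = D * B ^ CARD('m) * (2 * real CARD('m))"
  have L: "0 \<le> L" using D B by (simp add: L_def)
  \<comment> \<open>The denominator is \<open>L + 1\<close> because \<open>L\<close> may be 0. Both
    sequences contribute \<open>\<delta>\<close> in each coordinate, hence the factor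
    \<open>2 * real CARD('m)\<close> in \<open>L\<close>.\<close>
  define \<delta> where "\<delta> = min 1 (e / (L + 1))"
  have \<delta>: "0 < \<delta>" "\<delta> \<le> 1" "L * \<delta> < e"
  proof -
    show "0 < \<delta>" "\<delta> \<le> 1" using e L by (auto simp: \<delta>_def)
    have "L * \<delta> \<le> L * (e / (L + 1))" using L by (intro mult_left_mono) (auto simp: \<delta>_def)
    also have "\<dots> < e" using L e by (simp add: divide_simps)
    finally show "L * \<delta> < e" .
  qed
  have ev: "\<exists>K. \<forall>n\<ge>K. \<forall>j. fnorm (Z j) (\<lambda>\<omega>. x j \<omega> - z n j \<omega>) < \<delta>" if "approximates z x" for z
  proof -
    have "\<forall>\<^sub>F n in sequentially. \<forall>j. fnorm (Z j) (\<lambda>\<omega>. x j \<omega> - z n j \<omega>) < \<delta>"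
      using that \<delta>(1) unfolding approximates_def
      by (intro eventually_all_finite order_tendstoD(2)[of _ 0]) auto
    then show ?thesis unfolding eventually_sequentially .
  qed
  obtain K1 where K1: "\<And>n j. K1 \<le> n \<Longrightarrow> fnorm (Z j) (\<lambda>\<omega>. x j \<omega> - y n j \<omega>) < \<delta>" using ev[OF y(1)] by blast
  obtain K2 where K2: "\<And>n j. K2 \<le> n \<Longrightarrow> fnorm (Z j) (\<lambda>\<omega>. x j \<omega> - y' n j \<omega>) < \<delta>" using ev[OF y(2)] by blast
  have mem: "\<And>n j. y n j \<in> elems (X j)" "\<And>n j. y' n j \<in> elems (X j)"
    using y by (auto simp: approximates_def)
  have le_B: "fnorm (Z j) z \<le> B" if z: "z \<in> elems (X j)" "fnorm (Z j) (\<lambda>\<omega>. x j \<omega> - z \<omega>) < \<delta>" for j z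
  proof -
    have zZ: "z \<in> elems (Z j)" using z(1) X_Z by auto
    have zero: "(\<lambda>_. 0) \<in> elems (Z j)" by (rule function_subspaceD(1)[OF Z_subspace])
    have "fnorm (Z j) z \<le> fnorm (Z j) (\<lambda>\<omega>. x j \<omega> - z \<omega>) + fnorm (Z j) (x j)"
      using Z_norm_diff[OF zZ zero x] by simp
    then show ?thesis using z(2) \<delta>(2) x_le[of j] by linarith
  qed
  have "norm (T (y n) - T (y' m)) < e" if "max K1 K2 \<le> n" "max K1 K2 \<le> m" for n m
  proof -
    have "norm (T (y n) - T (y' m))
        \<le> D * B ^ CARD('m) * (\<Sum>j\<in>UNIV. fnorm (Z j) (\<lambda>\<omega>. y n j \<omega> - y' m j \<omega>))"
      using that K1 K2 by (intro T_diff_le B mem le_B) auto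
    also have "\<dots> \<le> D * B ^ CARD('m) * (\<Sum>j\<in>(UNIV :: 'm set). 2 * \<delta>)"
    proof (intro mult_left_mono sum_mono)
      fix j
      have "fnorm (Z j) (\<lambda>\<omega>. y n j \<omega> - y' m j \<omega>)
          \<le> fnorm (Z j) (\<lambda>\<omega>. x j \<omega> - y n j \<omega>) + fnorm (Z j) (\<lambda>\<omega>. x j \<omega> - y' m j \<omega>)"
        using mem X_Z x by (intro Z_norm_diff) auto
      then show "fnorm (Z j) (\<lambda>\<omega>. y n j \<omega> - y' m j \<omega>) \<le> 2 * \<delta>"
        using K1[of n j] K2[of m j] that by simp
    qed (use D B in simp)
    also have "\<dots> = L * \<delta>" by (simp add: L_def)
    finally show ?thesis using \<delta>(3) by simp
  qed
  then show ?thesis by blast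
qed

definition approx :: "'m \<Rightarrow> ('a \<Rightarrow> real) \<Rightarrow> nat \<Rightarrow> 'a \<Rightarrow> real" where
  "approx j f = (SOME u. (\<forall>n::nat. u n \<in> elems (X j)) \<and>
      (\<forall>n. fnorm (Z j) (u n) \<le> fnorm (Z j) f) \<and> (\<lambda>n. fnorm (Z j) (\<lambda>\<omega>. f \<omega> - u n \<omega>)) \<longlonglongrightarrow> 0)"

lemma approx:
  assumes "f \<in> elems (Z j)"
  shows "approx j f n \<in> elems (X j)" "fnorm (Z j) (approx j f n) \<le> fnorm (Z j) f"
    "(\<lambda>n. fnorm (Z j) (\<lambda>\<omega>. f \<omega> - approx j f n \<omega>)) \<longlonglongrightarrow> 0"
  using someI_ex[OF dense[OF assms]] unfolding approx_def[symmetric] by auto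

definition S :: "('m \<Rightarrow> 'a \<Rightarrow> real) \<Rightarrow> 'y" where
  "S x = lim (\<lambda>n. T (\<lambda>j. approx j (x j) n))"

lemma approximates_approx:
  "(\<And>j. x j \<in> elems (Z j)) \<Longrightarrow> approximates (\<lambda>n j. approx j (x j) n) x"
  unfolding approximates_def using approx by blast

text \<open>Every approximating sequence computes \<open>S\<close>. Multilinearity can then be read
  off from sequences assembled coordinatewise, although the choice \<open>approx\<close> need not
  respect sums or multiples.\<close>

lemma S_limit:
  assumes x: "\<And>j. x j \<in> elems (Z j)" and y: "approximates y x"
  shows "(\<lambda>n. T (y n)) \<longlonglongrightarrow> S x"
proof -
  let ?a = "\<lambda>n j. approx j (x j) n"
  note a = approximates_approx[OF x]
  have "Cauchy (\<lambda>n. T (?a n))"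
    using approximates_close[OF x a a] by (intro CauchyI) blast
  then have lim: "(\<lambda>n. T (?a n)) \<longlonglongrightarrow> S x"
    unfolding S_def by (simp add: Cauchy_convergent convergent_LIMSEQ_iff[symmetric])
  have "(\<lambda>n. T (y n) - T (?a n)) \<longlonglongrightarrow> 0"
  proof (rule LIMSEQ_I)
    fix e :: real assume "0 < e"
    then obtain K where "\<forall>n\<ge>K. \<forall>m\<ge>K. norm (T (y n) - T (?a m)) < e"
      using approximates_close[OF x y a] by blast
    then show "\<exists>K. \<forall>n\<ge>K. norm (T (y n) - T (?a n) - 0) < e" by auto
  qed
  from tendsto_add[OF this lim] show ?thesis by simp
qed

theorem bounded_extension: "bounded_multilinear_operator M Z S"
  unfolding bounded_multilinear_operator_def multilinear_operator_def
proof (intro conjI allI impI exI; (elim conjE)?)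
  fix x :: "'m \<Rightarrow> 'a \<Rightarrow> real" and j f g
  assume x: "\<forall>i. x i \<in> elems (Z i)" and f: "f \<in> elems (Z j)" and g: "g \<in> elems (Z j)"
  let ?y = "\<lambda>n i. approx i (x i) n"
  have y: "?y n i \<in> elems (X i)" for n i using x approx by blast
  have upd: "approximates (\<lambda>n. (?y n)(j := u n)) (x(j := k))"
    if "\<And>n. u n \<in> elems (X j)" "(\<lambda>n. fnorm (Z j) (\<lambda>\<omega>. k \<omega> - u n \<omega>)) \<longlonglongrightarrow> 0" for u k
    using that x approx unfolding approximates_def by auto
  have fg: "(\<lambda>\<omega>. f \<omega> + g \<omega>) \<in> elems (Z j)" using f g by (rule function_subspaceD(2)[OF Z_subspace])
  let ?u = "\<lambda>n \<omega>. approx j f n \<omega> + approx j g n \<omega>"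
  have u: "?u n \<in> elems (X j)" for n
    by (intro function_subspaceD(2)[OF X_subspace] approx f g)
  have "(\<lambda>n. fnorm (Z j) (\<lambda>\<omega>. (f \<omega> + g \<omega>) - ?u n \<omega>)) \<longlonglongrightarrow> 0"
  proof (rule Lim_null_comparison)
    show "(\<lambda>n. fnorm (Z j) (\<lambda>\<omega>. f \<omega> - approx j f n \<omega>) + fnorm (Z j) (\<lambda>\<omega>. g \<omega> - approx j g n \<omega>)) \<longlonglongrightarrow> 0"
      using tendsto_add[OF approx(3)[OF f] approx(3)[OF g]] by simp
    show "\<forall>\<^sub>F n in sequentially. norm (fnorm (Z j) (\<lambda>\<omega>. (f \<omega> + g \<omega>) - ?u n \<omega>))
        \<le> fnorm (Z j) (\<lambda>\<omega>. f \<omega> - approx j f n \<omega>) + fnorm (Z j) (\<lambda>\<omega>. g \<omega> - approx j g n \<omega>)"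
    proof (intro always_eventually allI)
      fix n
      have a: "approx j f n \<in> elems (Z j)" "approx j g n \<in> elems (Z j)"
        using approx(1)[OF f] approx(1)[OF g] X_Z by auto
      have "(\<lambda>\<omega>. (f \<omega> + g \<omega>) - ?u n \<omega>) = (\<lambda>\<omega>. (f \<omega> - approx j f n \<omega>) + (g \<omega> - approx j g n \<omega>))"
        by (simp add: algebra_simps)
      moreover have "0 \<le> fnorm (Z j) (\<lambda>\<omega>. (f \<omega> + g \<omega>) - ?u n \<omega>)"
        using u X_Z by (intro Z_norm(3) Z_diff fg) auto
      ultimately show "norm (fnorm (Z j) (\<lambda>\<omega>. (f \<omega> + g \<omega>) - ?u n \<omega>))
        \<le> fnorm (Z j) (\<lambda>\<omega>. f \<omega> - approx j f n \<omega>) + fnorm (Z j) (\<lambda>\<omega>. g \<omega> - approx j g n \<omega>)"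
        using Z_norm(1)[OF Z_diff[OF f a(1)] Z_diff[OF g a(2)]] by simp
    qed
  qed
  from upd[OF u this] have "(\<lambda>n. T ((?y n)(j := ?u n))) \<longlonglongrightarrow> S (x(j := (\<lambda>\<omega>. f \<omega> + g \<omega>)))"
    using x fg by (intro S_limit) auto
  moreover have "(\<lambda>n. T ((?y n)(j := ?u n))) \<longlonglongrightarrow> S (x(j := f)) + S (x(j := g))"
  proof -
    have "T ((?y n)(j := ?u n)) = T ((?y n)(j := approx j f n)) + T ((?y n)(j := approx j g n))" for n
      by (rule T_add[OF y approx(1)[OF f] approx(1)[OF g]])
    then show ?thesis
      using x f g by (auto intro!: tendsto_add S_limit upd approx)
  qed
  ultimately show "S (x(j := (\<lambda>\<omega>. f \<omega> + g \<omega>))) = S (x(j := f)) + S (x(j := g))"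
    by (rule LIMSEQ_unique)
next
  fix x :: "'m \<Rightarrow> 'a \<Rightarrow> real" and j f c
  assume x: "\<forall>i. x i \<in> elems (Z i)" and f: "f \<in> elems (Z j)"
  let ?y = "\<lambda>n i. approx i (x i) n"
  have y: "?y n i \<in> elems (X i)" for n i using x approx by blast
  have upd: "approximates (\<lambda>n. (?y n)(j := u n)) (x(j := k))"
    if "\<And>n. u n \<in> elems (X j)" "(\<lambda>n. fnorm (Z j) (\<lambda>\<omega>. k \<omega> - u n \<omega>)) \<longlonglongrightarrow> 0" for u k
    using that x approx unfolding approximates_def by auto
  have cf: "(\<lambda>\<omega>. c * f \<omega>) \<in> elems (Z j)" using f by (rule function_subspaceD(3)[OF Z_subspace])
  let ?u = "\<lambda>n \<omega>. c * approx j f n \<omega>"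
  have u: "?u n \<in> elems (X j)" for n
    by (intro function_subspaceD(3)[OF X_subspace] approx f)
  have "fnorm (Z j) (\<lambda>\<omega>. c * f \<omega> - ?u n \<omega>) = \<bar>c\<bar> * fnorm (Z j) (\<lambda>\<omega>. f \<omega> - approx j f n \<omega>)" for n
  proof -
    have "approx j f n \<in> elems (Z j)" using approx(1)[OF f] X_Z by auto
    from Z_norm(2)[OF Z_diff[OF f this], of c] show ?thesis by (simp add: right_diff_distrib)
  qed
  then have "(\<lambda>n. fnorm (Z j) (\<lambda>\<omega>. c * f \<omega> - ?u n \<omega>)) \<longlonglongrightarrow> 0"
    using tendsto_mult_right_zero[OF approx(3)[OF f], of "\<bar>c\<bar>"] by simp
  from upd[OF u this] have "(\<lambda>n. T ((?y n)(j := ?u n))) \<longlonglongrightarrow> S (x(j := (\<lambda>\<omega>. c * f \<omega>)))"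
    using x cf by (intro S_limit) auto
  moreover have "(\<lambda>n. T ((?y n)(j := ?u n))) \<longlonglongrightarrow> c *\<^sub>R S (x(j := f))"
  proof -
    have "T ((?y n)(j := ?u n)) = c *\<^sub>R T ((?y n)(j := approx j f n))" for n
      by (rule T_scale[OF y approx(1)[OF f]])
    then show ?thesis
      using x f by (auto intro!: tendsto_intros S_limit upd approx)
  qed
  ultimately show "S (x(j := (\<lambda>\<omega>. c * f \<omega>))) = c *\<^sub>R S (x(j := f))"
    by (rule LIMSEQ_unique)
next
  fix x y :: "'m \<Rightarrow> 'a \<Rightarrow> real"
  assume x: "\<forall>i. x i \<in> elems (Z i)" and y: "\<forall>i. y i \<in> elems (Z i)"
    and ae: "\<forall>i. AE \<omega> in M i. x i \<omega> = y i \<omega>"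
  let ?a = "\<lambda>n i. approx i (x i) n"
  \<comment> \<open>A sequence approximating \<open>x\<close> approximates \<open>y\<close> as well,
    since the norms do not see null sets.\<close>
  have "(\<lambda>n. fnorm (Z i) (\<lambda>\<omega>. y i \<omega> - ?a n i \<omega>)) \<longlonglongrightarrow> 0" for i
  proof (rule Lim_null_comparison[OF _ approx(3)[OF x[rule_format, of i]]])
    have xi: "x i \<in> elems (Z i)" and yi: "y i \<in> elems (Z i)" using x y by auto
    have "AE \<omega> in M i. x i \<omega> - y i \<omega> = 0" using ae[rule_format, of i] by eventually_elim simp
    then have "fnorm (Z i) (\<lambda>\<omega>. x i \<omega> - y i \<omega>) = 0" using Z_norm(4)[OF Z_diff[OF xi yi]] by simp
    moreover have "?a n i \<in> elems (Z i)" for n using approx(1)[OF xi] X_Z by auto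
    ultimately show "\<forall>\<^sub>F n in sequentially. norm (fnorm (Z i) (\<lambda>\<omega>. y i \<omega> - ?a n i \<omega>))
        \<le> fnorm (Z i) (\<lambda>\<omega>. x i \<omega> - approx i (x i) n \<omega>)"
      using Z_norm_diff[OF yi _ xi] Z_norm(3)[OF Z_diff[OF yi]] by (auto intro!: always_eventually)
  qed
  then have "approximates ?a y" unfolding approximates_def using x approx by blast
  then have "(\<lambda>n. T (?a n)) \<longlonglongrightarrow> S y" using y by (intro S_limit) auto
  moreover have "(\<lambda>n. T (?a n)) \<longlonglongrightarrow> S x" using x by (intro S_limit approximates_approx) auto
  ultimately show "S x = S y" by (rule LIMSEQ_unique[rotated])
next
  fix x :: "'m \<Rightarrow> 'a \<Rightarrow> real"
  assume x: "\<forall>j. x j \<in> elems (Z j)"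
  let ?a = "\<lambda>n i. approx i (x i) n"
  have "(\<lambda>n. norm (T (?a n))) \<longlonglongrightarrow> norm (S x)"
    using x by (intro tendsto_norm S_limit approximates_approx) auto
  moreover have "norm (T (?a n)) \<le> D * (\<Prod>j\<in>UNIV. fnorm (Z j) (x j))" for n
  proof -
    have a: "?a n j \<in> elems (X j)" for j using x approx by blast
    have "norm (T (?a n)) \<le> D * (\<Prod>j\<in>UNIV. fnorm (Z j) (?a n j))" by (rule bound[OF a])
    also have "\<dots> \<le> D * (\<Prod>j\<in>UNIV. fnorm (Z j) (x j))"
      using a X_Z x by (intro mult_left_mono prod_mono D conjI Z_norm(3) approx(2)) auto
    finally show ?thesis .
  qed
  ultimately show "norm (S x) \<le> D * (\<Prod>j\<in>UNIV. fnorm (Z j) (x j))"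
    by (intro LIMSEQ_le_const2) auto
qed

lemma S_extends:
  assumes x: "\<And>j. x j \<in> elems (X j)"
  shows "S x = T x"
proof -
  have xZ: "x j \<in> elems (Z j)" for j using x X_Z by auto
  have "fnorm (Z j) (\<lambda>\<omega>. x j \<omega> - x j \<omega>) = 0" for j
    using Z_norm(4)[OF Z_diff[OF xZ xZ]] by simp
  then have "approximates (\<lambda>_. x) x" unfolding approximates_def using x by simp
  then have "(\<lambda>_. T x) \<longlonglongrightarrow> S x" by (rule S_limit[OF xZ])
  then show ?thesis by (simp add: LIMSEQ_const_iff)
qed

end

section \<open>Domination and factorization\<close>

text \<open>The left side is the integral of \<open>weak_sum\<close> over \<open>\<nu>\<close>. The
  pointwise bound on the ball is integrated against a probability.\<close>

lemma (in S_lattice) sum_norm_powr_le: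
  assumes x: "\<And>k. k < n \<Longrightarrow> x k \<in> elems X"
  shows "(\<Sum>k<n. fnorm \<S> (x k) powr q) \<le> (SUP \<beta>\<in>lr_ball (gap_exponent p q) n.
      fnorm X (\<lambda>\<omega>. (\<Sum>k<n. \<bar>\<beta> k * x k \<omega>\<bar> powr p) powr (1 / p))) powr q" (is "_ \<le> ?U powr q")
proof -
  interpret prob_space \<nu> by (rule prob_\<nu>)
  let ?\<phi> = "\<lambda>k h. (\<integral>\<omega>. \<bar>x k \<omega>\<bar> powr p * h \<omega> \<partial>M) powr (q / p)"
  have "ennreal (\<Sum>k<n. fnorm \<S> (x k) powr q) = (\<Sum>k<n. J (x k))"
    using J_eq_norm[OF X_in_\<S>(1)[OF x]] by (simp flip: sum_ennreal)
  also have "\<dots> = (\<Sum>k<n. \<integral>\<^sup>+h. ennreal (?\<phi> k h) \<partial>\<nu>)"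
    using J_X[OF x] by simp
  also have "\<dots> = (\<integral>\<^sup>+h. (\<Sum>k<n. ennreal (?\<phi> k h)) \<partial>\<nu>)"
    using pairing_measurable[OF powr_in_V(1)[OF x]] by (intro nn_integral_sum[symmetric]) simp
  also have "\<dots> \<le> (\<integral>\<^sup>+h. ennreal (?U powr q) \<partial>\<nu>)"
  proof (rule nn_integral_mono)
    fix h assume "h \<in> space \<nu>"
    then have h: "h \<in> \<K>" by (simp add: space_\<nu>)
    have "(\<Sum>k<n. ennreal (?\<phi> k h)) = ennreal (weak_sum q n x h)"
      by (simp add: weak_sum_def)
    also have "\<dots> \<le> ennreal (?U powr q)" by (rule ennreal_leI[OF weak_sum_le_SUP_lr_ball[OF q x h]])
    finally show "(\<Sum>k<n. ennreal (?\<phi> k h)) \<le> ennreal (?U powr q)" .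
  qed
  also have "\<dots> = ennreal (?U powr q)" by (simp add: emeasure_space_1)
  finally show ?thesis by simp
qed

section \<open>From a mean to a measure with definite norm\<close>

context convex_lattice
begin

lemma continuous_map_powr_pairing:
  assumes F: "F \<in> E" "\<And>\<omega>. \<omega> \<in> space M \<Longrightarrow> 0 \<le> F \<omega>" and s: "0 < s"
  shows "continuous_map (koethe_pos_ball M V) euclideanreal (\<lambda>h. (\<integral>\<omega>. F \<omega> * h \<omega> \<partial>M) powr s)"
proof -
  \<comment> \<open>The pairing is nonnegative on the ball; the absolute value only provides a
    function that is continuous on the whole line.\<close>
  have "continuous_on UNIV (\<lambda>t::real. \<bar>t\<bar> powr s)"
    using s by (intro continuous_on_powr' continuous_intros) auto
  then have "continuous_map euclideanreal euclideanreal (\<lambda>t. \<bar>t\<bar> powr s)" by simp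
  from continuous_map_compose[OF continuous_map_pairing[OF F(1)] this]
  have "continuous_map (koethe_pos_ball M V) euclideanreal (\<lambda>h. \<bar>\<integral>\<omega>. F \<omega> * h \<omega> \<partial>M\<bar> powr s)"
    by (simp add: o_def)
  then show ?thesis
    by (rule continuous_map_eq) (use nn_integral_\<K>(2)[OF _ F] in simp)
qed

text \<open>Averaging with a point mass at a strictly positive functional makes the norm definite.\<close>

lemma ex_measure:
  assumes q: "p \<le> q"
    and lin: "linear_functional_on (bounded_functions_on \<K>) \<Lambda>"
    and le: "\<And>f. f \<in> bounded_functions_on \<K> \<Longrightarrow> \<Lambda> f \<le> (SUP h\<in>\<K>. f h)"
  shows "\<exists>\<nu> h0. S_lattice_definite M X p q \<nu> h0 2 \<and>
    (\<forall>x\<in>elems X. \<Lambda> (\<lambda>h. (\<integral>\<omega>. \<bar>x \<omega>\<bar> powr p * h \<omega> \<partial>M) powr (q / p))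
      \<le> 2 * fnorm (S_space M p q \<nu>) x powr q)"
proof -
  obtain h0 where h0: "h0 \<in> \<K>" "AE \<omega> in M. 0 < h0 \<omega>" using ex_strictly_positive by blast
  \<comment> \<open>On functions that are nonnegative on the ball, both \<open>\<Lambda>\<close> and
    the evaluation at \<open>h0\<close> are at most twice \<open>\<Lambda>'\<close>. This is the
    origin of the constant 2.\<close>
  define \<Lambda>' where "\<Lambda>' f = (\<Lambda> f + f h0) / 2" for f
  note top = compact_space_koethe_pos_ball normal_space_koethe_pos_ball \<K>_nonempty
  interpret L: bounded_mean "koethe_pos_ball M V" \<Lambda>
    by (rule bounded_mean.intro[OF top lin le])
  interpret L': bounded_mean "koethe_pos_ball M V" \<Lambda>'
  proof (rule bounded_mean.intro[OF top])
    show "linear_functional_on (bounded_functions_on \<K>) \<Lambda>'"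
      using lin unfolding linear_functional_on_def \<Lambda>'_def by (simp add: field_simps)
    fix f assume f: "f \<in> bounded_functions_on \<K>"
    have "f h0 \<le> (SUP h\<in>\<K>. f h)"
      using h0(1) bdd_above_bounded_functions_on[OF f] by (rule cSUP_upper)
    then show "\<Lambda>' f \<le> (SUP h\<in>\<K>. f h)" using le[OF f] by (simp add: \<Lambda>'_def)
  qed
  have qp: "0 < q / p" using p q by simp
  have \<phi>: "ennreal ((\<Lambda> (\<lambda>h. (\<integral>\<omega>. F \<omega> * h \<omega> \<partial>M) powr (q / p)) + (\<integral>\<omega>. F \<omega> * h0 \<omega> \<partial>M) powr (q / p)) / 2)
        = (\<integral>\<^sup>+h. ennreal ((\<integral>\<omega>. F \<omega> * h \<omega> \<partial>M) powr (q / p)) \<partial>L'.\<nu>)"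
    and \<Lambda>_nonneg: "0 \<le> \<Lambda> (\<lambda>h. (\<integral>\<omega>. F \<omega> * h \<omega> \<partial>M) powr (q / p))"
    if F: "F \<in> E" "\<And>\<omega>. \<omega> \<in> space M \<Longrightarrow> 0 \<le> F \<omega>" for F
  proof -
    let ?\<phi> = "\<lambda>h. (\<integral>\<omega>. F \<omega> * h \<omega> \<partial>M) powr (q / p)"
    note c = continuous_map_powr_pairing[OF F qp]
    have "(\<integral>\<^sup>+h. ennreal (?\<phi> h) \<partial>L'.\<nu>) = ennreal (integral\<^sup>L L'.\<nu> ?\<phi>)"
      using L'.integrable_\<nu>[OF c] by (intro nn_integral_eq_integral) auto
    then show "ennreal ((\<Lambda> ?\<phi> + ?\<phi> h0) / 2) = (\<integral>\<^sup>+h. ennreal (?\<phi> h) \<partial>L'.\<nu>)"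
      by (simp add: L'.integral_\<nu>[OF c] \<Lambda>'_def)
    have "\<Lambda> (\<lambda>_. 0) \<le> \<Lambda> ?\<phi>"
      using continuous_map_bounded_functions_on[OF top(1) c] L.BF_subspace(1) by (intro L.mono) auto
    then show "0 \<le> \<Lambda> ?\<phi>" by (simp add: L.const)
  qed
  have definite: "S_lattice_definite M X p q L'.\<nu> h0 2"
  proof (intro S_lattice_definite.intro S_lattice.intro convex_lattice_axioms
      S_lattice_axioms.intro S_lattice_definite_axioms.intro q L'.regular_\<nu> h0)
    fix F assume F: "F \<in> E" "\<And>\<omega>. \<omega> \<in> space M \<Longrightarrow> 0 \<le> F \<omega>"
    have "ennreal ((\<integral>\<omega>. F \<omega> * h0 \<omega> \<partial>M) powr (q / p)) \<le> ennreal (2 *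
        ((\<Lambda> (\<lambda>h. (\<integral>\<omega>. F \<omega> * h \<omega> \<partial>M) powr (q / p)) + (\<integral>\<omega>. F \<omega> * h0 \<omega> \<partial>M) powr (q / p)) / 2))"
      using \<Lambda>_nonneg[OF F] by (intro ennreal_leI) simp
    also have "\<dots> = ennreal 2 * (\<integral>\<^sup>+h. ennreal ((\<integral>\<omega>. F \<omega> * h \<omega> \<partial>M) powr (q / p)) \<partial>L'.\<nu>)"
      by (subst \<phi>[OF F(1), symmetric]) (use F(2) in \<open>simp, intro ennreal_mult', simp\<close>)
    finally show "ennreal ((\<integral>\<omega>. F \<omega> * h0 \<omega> \<partial>M) powr (q / p))
      \<le> ennreal 2 * (\<integral>\<^sup>+h. ennreal ((\<integral>\<omega>. F \<omega> * h \<omega> \<partial>M) powr (q / p)) \<partial>L'.\<nu>)" .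
  qed simp
  interpret D: S_lattice_definite M X p q L'.\<nu> h0 2 by (rule definite)
  have "\<Lambda> (\<lambda>h. (\<integral>\<omega>. \<bar>x \<omega>\<bar> powr p * h \<omega> \<partial>M) powr (q / p)) \<le> 2 * fnorm (S_space M p q L'.\<nu>) x powr q"
    (is "\<Lambda> ?\<phi> \<le> _") if x: "x \<in> elems X" for x
  proof -
    note F = powr_in_V(1)[OF x]
    have "ennreal ((\<Lambda> ?\<phi> + ?\<phi> h0) / 2) = ennreal (fnorm (S_space M p q L'.\<nu>) x powr q)"
      using \<phi>[OF F] D.J_X[OF x] D.J_eq_norm[OF D.X_in_\<S>(1)[OF x]] by simp
    moreover have "0 \<le> (\<Lambda> ?\<phi> + ?\<phi> h0) / 2" using \<Lambda>_nonneg[OF F] by simp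
    ultimately have "(\<Lambda> ?\<phi> + ?\<phi> h0) / 2 = fnorm (S_space M p q L'.\<nu>) x powr q" by simp
    moreover have "a \<le> 2 * s" if "(a + b) / 2 = s" "0 \<le> b" for a b s :: real
      using that by (simp add: field_simps)
    ultimately show ?thesis using powr_ge_zero by blast
  qed
  then show ?thesis using definite by blast
qed

lemma pos_ball_nonempty: "topspace (koethe_pos_ball M V) \<noteq> {}"
  by (rule \<K>_nonempty)

lemma powr_pairing_bounded:
  assumes "p \<le> q" "x \<in> elems X"
  shows "(\<lambda>h. (\<integral>\<omega>. \<bar>x \<omega>\<bar> powr p * h \<omega> \<partial>M) powr (q / p)) \<in> bounded_functions_on \<K>"
proof -
  have "0 < q / p" using p assms(1) by simp
  from continuous_map_powr_pairing[OF powr_in_V(1)[OF assms(2)] _ this] show ?thesis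
    by (intro continuous_map_bounded_functions_on[OF compact_space_koethe_pos_ball]) simp
qed

end

text \<open>The weights \<open>q0 / q j\<close> sum to 1. So after the bound for \<open>S\<close>,
  Hoelder's inequality in the index \<open>k\<close> separates the coordinates, and
  \<open>sum_norm_powr_le\<close> bounds each of them.\<close>

lemma factorization_imp_strongly_concave:
  fixes M :: "'m::finite \<Rightarrow> 'a measure" and X :: "'m \<Rightarrow> 'a function_space"
    and T S :: "('m \<Rightarrow> 'a \<Rightarrow> real) \<Rightarrow> 'y::real_normed_vector"
  assumes L: "\<And>j. S_lattice (M j) (X j) (p j) (q j) (\<nu> j)"
    and S: "bounded_multilinear_operator M (\<lambda>j. S_space (M j) (p j) (q j) (\<nu> j)) S"
    and TS: "\<And>x. (\<And>j. x j \<in> elems (X j)) \<Longrightarrow> T x = S x"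
  shows "strongly_concave X p q T"
proof -
  let ?Z = "\<lambda>j. S_space (M j) (p j) (q j) (\<nu> j)"
  define q0 where "q0 = 1 / (\<Sum>j\<in>UNIV. 1 / q j)"
  have q: "0 < q j" for j using S_lattice.pq_pos(2)[OF L] .
  have "0 < (\<Sum>j\<in>UNIV. 1 / q j)" using q by (intro sum_pos) auto
  then have q0: "0 < q0" "q0 * (\<Sum>j\<in>UNIV. 1 / q j) = 1" by (auto simp: q0_def)
  define w where "w j = q0 / q j" for j
  have w: "0 < w j" "sum w UNIV = 1" "q j * w j = q0" for j
    using q0 q[of j] by (auto simp: w_def sum_distrib_left)
  obtain C where C: "\<And>x. (\<And>j. x j \<in> elems (?Z j)) \<Longrightarrow> norm (S x) \<le> C * (\<Prod>j\<in>UNIV. fnorm (?Z j) (x j))"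
    using S unfolding bounded_multilinear_operator_def by blast
  \<comment> \<open>The bound for \<open>S\<close> is an arbitrary real number, whereas the
    concavity constant has to be positive.\<close>
  define D where "D = max C 1"
  have D: "0 < D" "C \<le> D" by (auto simp: D_def)
  have norm_nonneg: "0 \<le> fnorm (?Z j) f" for j f by (simp add: S_space_def)
  have "(\<Sum>k<n. norm (T (\<lambda>j. x j k)) powr q0) powr (1 / q0)
      \<le> D * (\<Prod>j\<in>UNIV. SUP \<beta>\<in>lr_ball (gap_exponent (p j) (q j)) n.
                 fnorm (X j) (\<lambda>\<omega>. (\<Sum>k<n. \<bar>\<beta> k * x j k \<omega>\<bar> powr p j) powr (1 / p j)))"
    (is "_ \<le> D * (\<Prod>j\<in>UNIV. ?U j)") if x: "\<forall>j. \<forall>k<n. x j k \<in> elems (X j)" for n :: nat and x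
  proof -
    have U: "0 \<le> ?U j" for j
      using x S_lattice.axioms(1)[OF L] S_lattice.q[OF L]
      by (intro convex_lattice.SUP_lr_ball_nonneg) auto
    have "(\<Sum>k<n. norm (T (\<lambda>j. x j k)) powr q0)
        \<le> (\<Sum>k<n. D powr q0 * (\<Prod>j\<in>UNIV. (fnorm (?Z j) (x j k) powr q j) powr w j))"
    proof (rule sum_mono)
      fix k assume "k \<in> {..<n}"
      then have xk: "x j k \<in> elems (X j)" for j using x by simp
      have "norm (T (\<lambda>j. x j k)) \<le> C * (\<Prod>j\<in>UNIV. fnorm (?Z j) (x j k))"
        unfolding TS[of "\<lambda>j. x j k", OF xk] using S_lattice.X_in_\<S>(1)[OF L xk] by (intro C)
      also have "\<dots> \<le> D * (\<Prod>j\<in>UNIV. fnorm (?Z j) (x j k))"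
        using D norm_nonneg by (intro mult_right_mono prod_nonneg) auto
      finally have "norm (T (\<lambda>j. x j k)) powr q0 \<le> (D * (\<Prod>j\<in>UNIV. fnorm (?Z j) (x j k))) powr q0"
        using q0 by (intro powr_mono2) auto
      also have "\<dots> = D powr q0 * (\<Prod>j\<in>UNIV. fnorm (?Z j) (x j k) powr q0)"
        using D norm_nonneg by (simp add: powr_mult prod_nonneg prod_powr_distrib_nonneg)
      also have "\<dots> = D powr q0 * (\<Prod>j\<in>UNIV. (fnorm (?Z j) (x j k) powr q j) powr w j)"
        by (simp add: powr_powr w(3))
      finally show "norm (T (\<lambda>j. x j k)) powr q0
          \<le> D powr q0 * (\<Prod>j\<in>UNIV. (fnorm (?Z j) (x j k) powr q j) powr w j)" .
    qed
    also have "\<dots> = D powr q0 * (\<Sum>k<n. \<Prod>j\<in>UNIV. (fnorm (?Z j) (x j k) powr q j) powr w j)"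
      by (rule sum_distrib_left[symmetric])
    also have "\<dots> \<le> D powr q0 * (\<Prod>j\<in>UNIV. (\<Sum>k<n. fnorm (?Z j) (x j k) powr q j) powr w j)"
      using w by (intro mult_left_mono generalized_holder_sum) auto
    also have "\<dots> \<le> D powr q0 * (\<Prod>j\<in>UNIV. (?U j powr q j) powr w j)"
      using x less_imp_le[OF w(1)]
      by (intro mult_left_mono prod_mono conjI powr_mono2 S_lattice.sum_norm_powr_le[OF L])
        (auto intro: sum_nonneg)
    also have "\<dots> = (D * (\<Prod>j\<in>UNIV. ?U j)) powr q0"
      using D U by (simp add: powr_powr w(3) powr_mult prod_nonneg prod_powr_distrib_nonneg)
    finally have "(\<Sum>k<n. norm (T (\<lambda>j. x j k)) powr q0) powr (1 / q0)
        \<le> ((D * (\<Prod>j\<in>UNIV. ?U j)) powr q0) powr (1 / q0)"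
      using q0 by (intro powr_mono2) (auto intro: sum_nonneg)
    then show ?thesis using q0 D U by (simp add: powr_powr prod_nonneg)
  qed
  then show ?thesis
    unfolding strongly_concave_def Let_def q0_def[symmetric] using D(1) by blast
qed

text \<open>A bound in the new norms on the original spaces leaves only the extension by density.
  The functionals \<open>h0 j\<close> and the constant 2 are carried along since they certify that
  the new norms are definite.\<close>

lemma strongly_concave_imp_domination:
  fixes M :: "'m::finite \<Rightarrow> 'a measure" and X :: "'m \<Rightarrow> 'a function_space"
    and T :: "('m \<Rightarrow> 'a \<Rightarrow> real) \<Rightarrow> 'y::real_normed_vector"
  assumes L: "\<And>j. convex_lattice (M j) (X j) (p j)" and pq: "\<And>j. p j \<le> q j"
    and T: "multilinear_operator M X T" and sc: "strongly_concave X p q T"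
  shows "\<exists>\<nu> h0 D. 0 \<le> D \<and> (\<forall>j. S_lattice_definite (M j) (X j) (p j) (q j) (\<nu> j) (h0 j) 2) \<and>
    (\<forall>x. (\<forall>j. x j \<in> elems (X j)) \<longrightarrow>
      norm (T x) \<le> D * (\<Prod>j\<in>UNIV. fnorm (S_space (M j) (p j) (q j) (\<nu> j)) (x j)))"
proof -
  have p: "1 \<le> p j" for j using convex_lattice.p[OF L] .
  have q: "0 < q j" for j using p[of j] pq[of j] by linarith
  have X_sub: "function_subspace (elems (X j))" for j by (rule convex_lattice.X_subspace[OF L])
  define K where "K j = topspace (koethe_pos_ball (M j) (concavification (M j) (p j) (X j)))" for j
  define \<phi> where "\<phi> j x h = (\<integral>\<omega>. \<bar>x \<omega>\<bar> powr p j * h \<omega> \<partial>M j) powr (q j / p j)"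
    for j and x h :: "'a \<Rightarrow> real"
  define ws where "ws j n x = (\<lambda>h. \<Sum>k<n. \<phi> j (x k) h)" for j and n :: nat and x
  have ws_eq: "ws j n x = convex_lattice.weak_sum (M j) (p j) (q j) n x" for j n x
    by (simp add: ws_def \<phi>_def convex_lattice.weak_sum_def[OF L] fun_eq_iff)
  have \<phi>_bounded: "\<phi> j x \<in> bounded_functions_on (K j)" if "x \<in> elems (X j)" for j x
    unfolding \<phi>_def K_def by (rule convex_lattice.powr_pairing_bounded[OF L pq that])
  have K: "K j \<noteq> {}" for j
    unfolding K_def
    by (rule convex_lattice.pos_ball_nonempty[OF L])
  define q0 where "q0 = 1 / (\<Sum>j\<in>UNIV. 1 / q j)"
  have "0 < (\<Sum>j\<in>UNIV. 1 / q j)" using q by (intro sum_pos) auto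
  then have q0: "0 < q0" "(\<Sum>j\<in>UNIV. 1 / q j) * q0 = 1" by (auto simp: q0_def)
  define w where "w j = q0 / q j" for j
  have w: "0 < w j" "sum w UNIV = 1" for j
    using q0 q[of j] by (auto simp: w_def sum_distrib_right)
  obtain C where C: "0 < C" and C_le: "\<And>(n::nat) x. (\<And>j k. k < n \<Longrightarrow> x j k \<in> elems (X j)) \<Longrightarrow>
        (\<Sum>k<n. norm (T (\<lambda>j. x j k)) powr q0) powr (1 / q0)
          \<le> C * (\<Prod>j\<in>UNIV. SUP \<beta>\<in>lr_ball (gap_exponent (p j) (q j)) n.
                 fnorm (X j) (\<lambda>\<omega>. (\<Sum>k<n. \<bar>\<beta> k * x j k \<omega>\<bar> powr p j) powr (1 / p j)))"
    using sc unfolding strongly_concave_def Let_def q0_def[symmetric] by blast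
  define c where "c j = C powr q0 * w j" for j
  have c: "0 < c j" for j using C w(1) by (simp add: c_def)
  have c_sum: "sum c UNIV = C powr q0" by (simp add: c_def w(2) flip: sum_distrib_left)
  \<comment> \<open>The term with \<open>T\<close> is spread evenly over the summands of the
    disjoint union, so that the sum of the suprema counts it exactly once.\<close>
  define m where "m = real CARD('m)"
  have m: "0 < m" by (simp add: m_def)

  \<comment> \<open>The suprema are exchanged first; Young's inequality then replaces the product of
    their powers with exponents \<open>w j\<close> by the sum weighted by \<open>w j\<close>. The
    constants \<open>c j\<close> absorb \<open>C powr q0\<close>.\<close>
  have sum_T_le: "(\<Sum>k<n. norm (T (\<lambda>j. x j k)) powr q0) \<le> (\<Sum>j\<in>UNIV. c j * (SUP h\<in>K j. ws j n (x j) h))"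
    if x: "\<And>j k. k < n \<Longrightarrow> x j k \<in> elems (X j)" for n :: nat and x
  proof -
    let ?t = "\<Sum>k<n. norm (T (\<lambda>j. x j k)) powr q0"
    let ?U = "\<lambda>j. SUP \<beta>\<in>lr_ball (gap_exponent (p j) (q j)) n.
                 fnorm (X j) (\<lambda>\<omega>. (\<Sum>k<n. \<bar>\<beta> k * x j k \<omega>\<bar> powr p j) powr (1 / p j))"
    let ?B = "\<lambda>j. SUP h\<in>K j. ws j n (x j) h"
    have B: "0 \<le> ?B j" for j
    proof -
      obtain h where h: "h \<in> K j" using K by blast
      have "0 \<le> ws j n (x j) h" by (simp add: ws_def \<phi>_def sum_nonneg)
      also have "\<dots> \<le> ?B j"
        using convex_lattice.bdd_above_weak_sum[OF L pq, of n "x j" j] x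
        by (intro cSUP_upper h) (simp add: ws_eq K_def)
      finally show ?thesis .
    qed
    have U: "0 \<le> ?U j" for j using x by (intro convex_lattice.SUP_lr_ball_nonneg[OF L pq])
    have UB: "?U j \<le> ?B j powr (1 / q j)" for j
      using convex_lattice.SUP_lr_ball_le[OF L pq, of n "x j" j] x by (simp add: ws_eq K_def)
    have "?t powr (1 / q0) \<le> C * (\<Prod>j\<in>UNIV. ?U j)" by (rule C_le[OF x])
    also have "\<dots> \<le> C * (\<Prod>j\<in>UNIV. ?B j powr (1 / q j))"
      using C U UB by (intro mult_left_mono prod_mono) auto
    finally have "(?t powr (1 / q0)) powr q0 \<le> (C * (\<Prod>j\<in>UNIV. ?B j powr (1 / q j))) powr q0"
      using q0 by (intro powr_mono2) auto
    moreover have "(?t powr (1 / q0)) powr q0 = ?t"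
      using q0 by (simp add: powr_powr sum_nonneg)
    moreover have "(C * (\<Prod>j\<in>UNIV. ?B j powr (1 / q j))) powr q0 = C powr q0 * (\<Prod>j\<in>UNIV. ?B j powr w j)"
      using C by (simp add: powr_mult prod_nonneg powr_powr w_def flip: prod_powr_distrib_nonneg)
    moreover have "C powr q0 * (\<Prod>j\<in>UNIV. ?B j powr w j) \<le> C powr q0 * (\<Sum>j\<in>UNIV. w j * ?B j)"
      using w B by (intro mult_left_mono weighted_am_gm) auto
    moreover have "C powr q0 * (\<Sum>j\<in>UNIV. w j * ?B j) = (\<Sum>j\<in>UNIV. c j * ?B j)"
      by (simp add: c_def sum_distrib_left mult.assoc)
    ultimately show ?thesis by simp
  qed

  \<comment> \<open>Functions on the disjoint union of the balls, encoded as functions of a pair;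
    boundedness is required over \<open>K j\<close> in the summand \<open>j\<close>.\<close>
  define V0 where "V0 = {F :: 'm \<times> ('a \<Rightarrow> real) \<Rightarrow> real. \<forall>j. (\<lambda>h. F (j, h)) \<in> bounded_functions_on (K j)}"
  note BF = function_subspaceD[OF function_subspace_bounded_functions_on]
  have V0: "function_subspace V0"
    unfolding function_subspace_def V0_def by (auto intro!: BF(1-3))
  define \<rho> where "\<rho> F = (\<Sum>j\<in>UNIV. SUP h\<in>K j. F (j, h))" for F :: "'m \<times> ('a \<Rightarrow> real) \<Rightarrow> real"
  have \<rho>: "sublinear_on V0 \<rho>"
    unfolding sublinear_on_def
  proof (intro conjI ballI allI impI)
    fix F assume F: "F \<in> V0"
    show "\<rho> (\<lambda>z. t * F z) = t * \<rho> F" if "0 \<le> t" for t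
      unfolding \<rho>_def sum_distrib_left using F that
      by (intro sum.cong sublinear_onD(2)[OF sublinear_SUP[OF K]]) (auto simp: V0_def)
    fix G assume G: "G \<in> V0"
    show "\<rho> (\<lambda>z. F z + G z) \<le> \<rho> F + \<rho> G"
      unfolding \<rho>_def sum.distrib[symmetric] using F G
      by (intro sum_mono sublinear_onD(1)[OF sublinear_SUP[OF K]]) (auto simp: V0_def)
  qed
  define g where "g x z = c (fst z) * \<phi> (fst z) (x (fst z)) (snd z) - norm (T x) powr q0 / m"
    for x and z :: "'m \<times> ('a \<Rightarrow> real)"
  have const_BF: "(\<lambda>_. d) \<in> bounded_functions_on A" for d and A :: "('a \<Rightarrow> real) set"
    by (rule bounded_functions_onI[of _ _ "\<bar>d\<bar>"]) simp
  have g_V0: "g x \<in> V0" if "\<And>j. x j \<in> elems (X j)" for x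
    unfolding V0_def g_def using BF(5)[OF BF(3)[OF \<phi>_bounded[OF that]] const_BF] by simp
  \<comment> \<open>Finite families with repetition: appending lists adds the functions
    \<open>G\<close>, so their image is closed under addition.\<close>
  define lists where "lists = {xs. \<forall>x\<in>set xs. \<forall>j. x j \<in> elems (X j)}"
  define G where "G xs = (\<lambda>z. sum_list (map (\<lambda>x. g x z) xs))" for xs
  have G_V0: "G xs \<in> V0" if "xs \<in> lists" for xs
    using that
  proof (induction xs)
    case Nil
    then show ?case using function_subspaceD(1)[OF V0] by (simp add: G_def)
  next
    case (Cons x xs)
    then show ?case using function_subspaceD(2)[OF V0 g_V0[of x], of "G xs"] by (auto simp: G_def lists_def)
  qed
  \<comment> \<open>With these exponents both terms of \<open>g\<close> are multiplied by
    \<open>t\<close>: each \<open>\<phi> j\<close> directly, and the power of the norm of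
    \<open>T x\<close> because the \<open>1 / q j\<close> sum to \<open>1 / q0\<close>.\<close>
  define scale where "scale t x = (\<lambda>j \<omega>. t powr (1 / q j) * x j \<omega>)" for t and x :: "'m \<Rightarrow> 'a \<Rightarrow> real"
  have g_scale: "g (scale t x) z = t * g x z" if t: "0 < t" and x: "\<And>j. x j \<in> elems (X j)" for t x z
  proof -
    have "norm (T (scale t x)) = \<bar>\<Prod>j\<in>UNIV. t powr (1 / q j)\<bar> * norm (T x)"
      unfolding scale_def by (simp add: multilinear_scale_all[OF T x X_sub])
    also have "(\<Prod>j\<in>UNIV. t powr (1 / q j)) = t powr (\<Sum>j\<in>UNIV. 1 / q j)"
      using t by (intro powr_sum[symmetric]) auto
    finally have "norm (T (scale t x)) powr q0 = t * norm (T x) powr q0"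
      using t q0 by (simp add: powr_mult powr_powr)
    moreover have "\<phi> j (scale t x j) h = t * \<phi> j (x j) h" for j h
    proof -
      have "\<bar>t powr (1 / q j) * x j \<omega>\<bar> powr p j * h \<omega>
          = t powr (p j / q j) * (\<bar>x j \<omega>\<bar> powr p j * h \<omega>)" for \<omega>
        using t by (simp add: abs_mult powr_mult powr_powr mult.assoc)
      then have "\<phi> j (scale t x j) h = (t powr (p j / q j) * (\<integral>\<omega>. \<bar>x j \<omega>\<bar> powr p j * h \<omega> \<partial>M j)) powr (q j / p j)"
        by (simp only: \<phi>_def scale_def integral_mult_right_zero)
      also have "\<dots> = t * \<phi> j (x j) h"
        using t p[of j] q[of j] by (simp add: powr_mult powr_powr \<phi>_def)
      finally show ?thesis .
    qed
    ultimately show ?thesis by (simp add: g_def algebra_simps)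
  qed
  \<comment> \<open>With lower bound 0 on the cone, the point to be checked is that
    \<open>\<rho>\<close> is nonnegative there, and this is \<open>sum_T_le\<close>.\<close>
  have "\<exists>\<Lambda>. linear_functional_on V0 \<Lambda> \<and> (\<forall>F\<in>V0. \<Lambda> F \<le> \<rho> F) \<and> (\<forall>F\<in>G ` lists. 0 \<le> \<Lambda> F)"
  proof (rule mazur_orlicz[OF V0 \<rho>, of "G ` lists" "\<lambda>_. 0"])
    show "G ` lists \<subseteq> V0" using G_V0 by auto
    have "G [] = (\<lambda>_. 0)" by (simp add: G_def)
    then show "(\<lambda>_. 0) \<in> G ` lists" by (intro image_eqI[of _ G "[]"]) (auto simp: lists_def)
    fix F assume "F \<in> G ` lists"
    then obtain xs where xs: "F = G xs" "xs \<in> lists" by blast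
    show "(\<lambda>z. t * F z) \<in> G ` lists" if t: "0 < t" for t
    proof (rule image_eqI)
      show "map (scale t) xs \<in> lists"
        using xs(2) function_subspaceD(3)[OF X_sub] by (auto simp: lists_def scale_def)
      have "sum_list (map (\<lambda>x. t * g x z) xs) = t * sum_list (map (\<lambda>x. g x z) xs)" for z
        by (rule sum_list_const_mult)
      moreover have "map (\<lambda>x. g (scale t x) z) xs = map (\<lambda>x. t * g x z) xs" for z
        using xs(2) g_scale[OF t] by (auto simp: lists_def)
      ultimately show "(\<lambda>z. t * F z) = G (map (scale t) xs)"
        by (simp add: xs(1) G_def o_def cong: map_cong)
    qed
    show "0 \<le> \<rho> F"
    proof -
      define n where "n = length xs"
      define x where "x j k = (xs ! k) j" for j k
      have x: "x j k \<in> elems (X j)" if "k < n" for j k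
        using xs(2) that by (auto simp: lists_def x_def n_def)
      define t where "t = (\<Sum>k<n. norm (T (\<lambda>j. x j k)) powr q0)"
      \<comment> \<open>On each summand the part with \<open>T\<close> is constant, so it can be
        moved out of the supremum.\<close>
      have F_eq: "F (j, h) = c j * ws j n (x j) h + - (t / m)" for j h
        by (simp add: xs(1) G_def sum_list_sum_nth atLeast0LessThan g_def ws_def t_def x_def n_def
            sum_subtractf sum_distrib_left sum_divide_distrib)
      have bdd: "bdd_above ((\<lambda>h. c j * ws j n (x j) h + - (t / m)) ` K j)" for j
      proof -
        have "(\<lambda>h. F (j, h)) \<in> bounded_functions_on (K j)"
          using G_V0[OF xs(2)] by (simp add: xs(1) V0_def)
        from bdd_above_bounded_functions_on[OF this] show ?thesis by (simp only: F_eq)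
      qed
      have "0 \<le> (\<Sum>j\<in>UNIV. c j * (SUP h\<in>K j. ws j n (x j) h)) - t"
        using sum_T_le[of n x, OF x] by (simp add: t_def)
      also have "\<dots> = (\<Sum>j\<in>UNIV. c j * (SUP h\<in>K j. ws j n (x j) h) + - (t / m))"
        by (simp add: sum_subtractf m_def)
      also have "\<dots> \<le> \<rho> F"
        unfolding \<rho>_def F_eq by (intro sum_mono SUP_affine_ge K c bdd)
      finally show ?thesis .
    qed
    fix F' assume "F' \<in> G ` lists"
    then obtain ys where ys: "F' = G ys" "ys \<in> lists" by blast
    show "(\<lambda>z. F z + F' z) \<in> G ` lists"
      by (rule image_eqI[of _ G "xs @ ys"]) (use xs ys in \<open>auto simp: lists_def G_def\<close>)
  qed simp_all
  then obtain \<Lambda> where \<Lambda>: "linear_functional_on V0 \<Lambda>" "\<And>F. F \<in> V0 \<Longrightarrow> \<Lambda> F \<le> \<rho> F"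
    and \<Lambda>_G: "\<And>xs. xs \<in> lists \<Longrightarrow> 0 \<le> \<Lambda> (G xs)" by blast
  note lin = linear_functional_onD[OF \<Lambda>(1)]

  \<comment> \<open>Extension by 0 to the other summands, where the supremum is then 0; so the
    restriction of \<open>\<Lambda>\<close> to one summand lies below the supremum over that ball
    alone.\<close>
  define emb where "emb j f z = (if fst z = j then f (snd z) else 0)"
    for j and f :: "('a \<Rightarrow> real) \<Rightarrow> real" and z :: "'m \<times> ('a \<Rightarrow> real)"
  have emb: "emb j f \<in> V0" if "f \<in> bounded_functions_on (K j)" for j f
    unfolding V0_def
  proof (intro CollectI allI)
    show "(\<lambda>h. emb j f (i, h)) \<in> bounded_functions_on (K i)" for i
      using that BF(1) by (cases "i = j") (simp_all add: emb_def)
  qed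
  define \<Lambda>j where "\<Lambda>j j f = \<Lambda> (emb j f)" for j f
  have \<Lambda>j_linear: "linear_functional_on (bounded_functions_on (K j)) (\<Lambda>j j)" for j
    unfolding linear_functional_on_def
  proof (intro conjI ballI allI)
    fix f assume f: "f \<in> bounded_functions_on (K j)"
    have "emb j (\<lambda>x. a * f x) = (\<lambda>z. a * emb j f z)" for a by (auto simp: emb_def)
    then show "\<Lambda>j j (\<lambda>x. a * f x) = a * \<Lambda>j j f" for a
      using lin(2)[OF emb[OF f]] by (simp add: \<Lambda>j_def)
    fix g assume g: "g \<in> bounded_functions_on (K j)"
    have "emb j (\<lambda>x. f x + g x) = (\<lambda>z. emb j f z + emb j g z)" by (auto simp: emb_def)
    then show "\<Lambda>j j (\<lambda>x. f x + g x) = \<Lambda>j j f + \<Lambda>j j g"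
      using lin(1)[OF emb[OF f] emb[OF g]] by (simp add: \<Lambda>j_def)
  qed
  have \<Lambda>j_le: "\<Lambda>j j f \<le> (SUP h\<in>K j. f h)" if f: "f \<in> bounded_functions_on (K j)" for j f
  proof -
    have "\<Lambda>j j f \<le> \<rho> (emb j f)" unfolding \<Lambda>j_def by (rule \<Lambda>(2)[OF emb[OF f]])
    also have "\<dots> = (\<Sum>i\<in>UNIV. if i = j then SUP h\<in>K j. f h else 0)"
      unfolding \<rho>_def using K by (intro sum.cong) (auto simp: emb_def)
    also have "\<dots> = (SUP h\<in>K j. f h)" by simp
    finally show ?thesis .
  qed
  have "\<exists>\<nu> h0. S_lattice_definite (M j) (X j) (p j) (q j) \<nu> h0 2 \<and>
    (\<forall>x\<in>elems (X j). \<Lambda>j j (\<phi> j x) \<le> 2 * fnorm (S_space (M j) (p j) (q j) \<nu>) x powr q j)" for j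
    using convex_lattice.ex_measure[OF L pq, of j "\<Lambda>j j", folded K_def] \<Lambda>j_linear \<Lambda>j_le
    unfolding \<phi>_def by blast
  then obtain \<nu> h0 where D: "\<And>j. S_lattice_definite (M j) (X j) (p j) (q j) (\<nu> j) (h0 j) 2"
    and \<Lambda>_\<nu>: "\<And>j x. x \<in> elems (X j) \<Longrightarrow>
      \<Lambda>j j (\<phi> j x) \<le> 2 * fnorm (S_space (M j) (p j) (q j) (\<nu> j)) x powr q j"
    by metis
  let ?Z = "\<lambda>j. S_space (M j) (p j) (q j) (\<nu> j)"
  have SL: "S_lattice (M j) (X j) (p j) (q j) (\<nu> j)" for j using D by (rule S_lattice_definite.axioms(1))
  \<comment> \<open>A list with a single entry already gives the additive bound. The constant part
    contributes at most minus the full power of the norm, as \<open>\<rho>\<close> adds it up over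
    all summands.\<close>
  have sum_bound: "norm (T x) powr q0 \<le> (\<Sum>j\<in>UNIV. 2 * c j * fnorm (?Z j) (x j) powr q j)"
    if x: "\<And>j. x j \<in> elems (X j)" for x
  proof -
    let ?s = "norm (T x) powr q0"
    have e: "emb j (\<lambda>h. c j * \<phi> j (x j) h) \<in> V0" for j by (rule emb[OF BF(3)[OF \<phi>_bounded[OF x]]])
    have s: "(\<lambda>_. - (?s / m)) \<in> V0" unfolding V0_def using const_BF by simp
    let ?e = "\<lambda>z. \<Sum>j\<in>UNIV. emb j (\<lambda>h. c j * \<phi> j (x j) h) z"
    have sum_e: "?e \<in> V0" "\<Lambda> ?e = (\<Sum>j\<in>UNIV. \<Lambda> (emb j (\<lambda>h. c j * \<phi> j (x j) h)))"
      using linear_functional_on_sum[OF V0 \<Lambda>(1), of UNIV "\<lambda>j. emb j (\<lambda>h. c j * \<phi> j (x j) h)"] e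
      by auto
    have G_eq: "G [x] = (\<lambda>z. ?e z + - (?s / m))"
      by (auto simp: G_def g_def emb_def)
    have "\<Lambda> (G [x]) = (\<Sum>j\<in>UNIV. \<Lambda> (emb j (\<lambda>h. c j * \<phi> j (x j) h))) + \<Lambda> (\<lambda>_. - (?s / m))"
      unfolding G_eq lin(1)[OF sum_e(1) s] sum_e(2) ..
    moreover have "0 \<le> \<Lambda> (G [x])" using x by (intro \<Lambda>_G) (simp add: lists_def)
    moreover have "\<Lambda> (\<lambda>_. - (?s / m)) \<le> - ?s"
    proof -
      have "\<Lambda> (\<lambda>_. - (?s / m)) \<le> (\<Sum>j\<in>(UNIV :: 'm set). - (?s / m))"
        using \<Lambda>(2)[OF s] K unfolding \<rho>_def by simp
      also have "\<dots> = - ?s" by (simp add: m_def)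
      finally show ?thesis .
    qed
    moreover have "\<Lambda> (emb j (\<lambda>h. c j * \<phi> j (x j) h)) \<le> 2 * c j * fnorm (?Z j) (x j) powr q j" for j
    proof -
      have "\<Lambda> (emb j (\<lambda>h. c j * \<phi> j (x j) h)) = c j * \<Lambda>j j (\<phi> j (x j))"
        using linear_functional_onD(2)[OF \<Lambda>j_linear \<phi>_bounded[OF x], of j "c j"] by (simp add: \<Lambda>j_def)
      also have "\<dots> \<le> c j * (2 * fnorm (?Z j) (x j) powr q j)"
        using c[of j] by (intro mult_left_mono \<Lambda>_\<nu> x) simp
      finally show ?thesis by simp
    qed
    ultimately show ?thesis
      using sum_mono[of UNIV "\<lambda>j. \<Lambda> (emb j (\<lambda>h. c j * \<phi> j (x j) h))"
          "\<lambda>j. 2 * c j * fnorm (?Z j) (x j) powr q j"] by force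
  qed
  \<comment> \<open>The additive bound with all new norms equal to 1, raised to
    \<open>1 / q0\<close>; the \<open>c j\<close> sum to \<open>C powr q0\<close>.\<close>
  define A where "A = (2 * C powr q0) powr (1 / q0)"
  have "norm (T x) \<le> A * (\<Prod>j\<in>UNIV. fnorm (?Z j) (x j))" if x: "\<And>j. x j \<in> elems (X j)" for x
  proof -
    have xZ: "x j \<in> elems (?Z j)" for j by (rule S_lattice.X_in_\<S>(1)[OF SL x])
    have Zn: "normed_function_space (M j) (?Z j)" for j by (rule S_lattice_definite.\<S>_normed[OF D])
    let ?a = "\<lambda>j. fnorm (?Z j) (x j)"
    have a: "0 \<le> ?a j" for j using Zn[of j] xZ unfolding normed_function_space_def by blast
    show ?thesis
    proof (cases "\<exists>i. ?a i = 0")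
      \<comment> \<open>Rescaling is impossible here, but definiteness of the norm makes this
        coordinate null, so \<open>T x\<close> vanishes.\<close>
      case True
      then obtain i where "?a i = 0" by blast
      then have "AE \<omega> in M i. x i \<omega> = 0" using Zn[of i] xZ unfolding normed_function_space_def by blast
      then have "T x = 0" by (rule multilinear_null[OF T x X_sub])
      moreover have "0 \<le> A * (\<Prod>j\<in>UNIV. ?a j)"
        using a by (intro mult_nonneg_nonneg prod_nonneg) (auto simp: A_def)
      ultimately show ?thesis by simp
    next
      case False
      then have pos: "0 < ?a j" for j using a[of j] by (simp add: less_le)
      \<comment> \<open>Dividing each coordinate by its norm turns the additive bound into a
        constant, and multilinearity restores the product of the norms.\<close>
      define y where "y = (\<lambda>j \<omega>. 1 / ?a j * x j \<omega>)"
      have y: "y j \<in> elems (X j)" for j unfolding y_def by (rule function_subspaceD(3)[OF X_sub x])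
      have "fnorm (?Z j) (y j) = \<bar>1 / ?a j\<bar> * ?a j" for j
        using Zn[of j] xZ[of j] unfolding normed_function_space_def y_def by blast
      then have y1: "fnorm (?Z j) (y j) = 1" for j using pos[of j] by simp
      have "T y = (\<Prod>j\<in>UNIV. 1 / ?a j) *\<^sub>R T x"
        unfolding y_def by (rule multilinear_scale_all[OF T x X_sub])
      then have "norm (T y) = norm (T x) / (\<Prod>j\<in>UNIV. ?a j)"
        using prod_pos[of UNIV ?a] pos by (simp add: prod_dividef)
      moreover have "norm (T y) powr q0 \<le> 2 * C powr q0"
        using sum_bound[OF y] by (simp add: y1 c_sum flip: sum_distrib_left)
      then have "(norm (T y) powr q0) powr (1 / q0) \<le> A"
        unfolding A_def using q0 by (intro powr_mono2) auto
      then have "norm (T y) \<le> A" using q0 by (simp add: powr_powr)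
      ultimately show ?thesis using pos by (simp add: divide_le_eq prod_pos)
    qed
  qed
  moreover have "0 \<le> A" by (simp add: A_def)
  ultimately show ?thesis using D by blast
qed

theorem corollary3p5:
  fixes M :: "'m::finite \<Rightarrow> 'a measure"
    and X :: "'m \<Rightarrow> 'a function_space"
    and p q :: "'m \<Rightarrow> real"
    and T :: "('m \<Rightarrow> 'a \<Rightarrow> real) \<Rightarrow> 'y::banach"
  assumes "\<And>j. 1 \<le> p j" and "\<And>j. p j \<le> q j"
    and "\<And>j. sigma_finite_measure (M j)"
    and "\<And>j. banach_function_lattice (M j) (X j)"
    and "\<And>j. order_continuous (M j) (X j)"
    and "\<And>j. p_convex (p j) (X j)"
    and "multilinear_operator M X T"
  shows "strongly_concave X p q T \<longleftrightarrow>
    (\<exists>\<nu> :: 'm \<Rightarrow> ('a \<Rightarrow> real) measure.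
       (\<forall>j. regular_borel_prob (koethe_pos_ball (M j) (concavification (M j) (p j) (X j))) (\<nu> j) \<and>
            banach_function_lattice (M j) (S_space (M j) (p j) (q j) (\<nu> j)) \<and>
            continuous_inclusion (X j) (S_space (M j) (p j) (q j) (\<nu> j))) \<and>
       (\<exists>S :: ('m \<Rightarrow> 'a \<Rightarrow> real) \<Rightarrow> 'y.
          bounded_multilinear_operator M (\<lambda>j. S_space (M j) (p j) (q j) (\<nu> j)) S \<and>
          (\<forall>x. (\<forall>j. x j \<in> elems (X j)) \<longrightarrow> T x = S x)))"
    (is "_ \<longleftrightarrow> ?factorization")
proof
  have L: "convex_lattice (M j) (X j) (p j)" for j
    by (rule convex_lattice.intro) (use assms in auto)
  {
    assume sc: "strongly_concave X p q T"
    obtain \<nu> h0 D where D: "0 \<le> D"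
      and def: "\<And>j. S_lattice_definite (M j) (X j) (p j) (q j) (\<nu> j) (h0 j) 2"
      and dom: "\<And>x. (\<And>j. x j \<in> elems (X j)) \<Longrightarrow>
        norm (T x) \<le> D * (\<Prod>j\<in>UNIV. fnorm (S_space (M j) (p j) (q j) (\<nu> j)) (x j))"
      using strongly_concave_imp_domination[OF L assms(2,7) sc] by blast
    let ?Z = "\<lambda>j. S_space (M j) (p j) (q j) (\<nu> j)"
    have SL: "S_lattice (M j) (X j) (p j) (q j) (\<nu> j)" for j
      using def by (rule S_lattice_definite.axioms(1))
    \<comment> \<open>Domination is boundedness of \<open>T\<close> in the norms of the spaces
      \<open>?Z j\<close>, in which the \<open>X j\<close> are dense by truncation.\<close>
    interpret ext: dense_extension M X ?Z T D
    proof (rule dense_extension.intro[OF _ _ _ _ assms(7) D dom])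
      show "function_subspace (elems (X j))" for j by (rule convex_lattice.X_subspace[OF L])
      show "normed_function_space (M j) (?Z j)" for j by (rule S_lattice_definite.\<S>_normed[OF def])
      show "f \<in> elems (?Z j)" if "f \<in> elems (X j)" for f j by (rule S_lattice.X_in_\<S>(1)[OF SL that])
      show "\<exists>u. (\<forall>n::nat. u n \<in> elems (X j)) \<and> (\<forall>n. fnorm (?Z j) (u n) \<le> fnorm (?Z j) f) \<and>
          (\<lambda>n. fnorm (?Z j) (\<lambda>\<omega>. f \<omega> - u n \<omega>)) \<longlonglongrightarrow> 0" if "f \<in> elems (?Z j)" for f j
        by (rule S_lattice.ex_X_approximation[OF SL that]) blast
    qed
    show ?factorization
    proof (intro exI[of _ \<nu>] exI[of _ ext.S] conjI allI impI)
      fix j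
      show "regular_borel_prob (koethe_pos_ball (M j) (concavification (M j) (p j) (X j))) (\<nu> j)"
        by (rule S_lattice.\<nu>[OF SL])
      show "banach_function_lattice (M j) (?Z j)"
        by (rule S_lattice_definite.banach_function_lattice_\<S>[OF def])
      show "continuous_inclusion (X j) (?Z j)" by (rule S_lattice.continuous_inclusion_\<S>[OF SL])
    next
      show "bounded_multilinear_operator M ?Z ext.S" by (rule ext.bounded_extension)
      fix x assume "\<forall>j. x j \<in> elems (X j)"
      then show "T x = ext.S x" using ext.S_extends[of x] by simp
    qed
  }
  assume ?factorization
  then obtain \<nu> S where \<nu>: "\<And>j. regular_borel_prob
        (koethe_pos_ball (M j) (concavification (M j) (p j) (X j))) (\<nu> j)"
    and S: "bounded_multilinear_operator M (\<lambda>j. S_space (M j) (p j) (q j) (\<nu> j)) S"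
    and TS: "\<And>x. (\<And>j. x j \<in> elems (X j)) \<Longrightarrow> T x = S x"
    by blast
  have "S_lattice (M j) (X j) (p j) (q j) (\<nu> j)" for j
    by (intro S_lattice.intro S_lattice_axioms.intro L assms(2) \<nu>)
  then show "strongly_concave X p q T"
    by (rule factorization_imp_strongly_concave[OF _ S TS])
qed

end
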